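(* Let $C_n$ be chosen uniformly at random from all caterpillars with vertex set $\{1,\dots,n\}$, and let $G_n$ be chosen uniformly at random from all forests of caterpillars with vertex set $\{1,\dots,n\}$. Then: (1) the first-order zero-one law fails for $C_n$, i.e. there is a first-order sentence $\varphi$ for which $\lim_{n\to\infty}\Pr(C_n\models\varphi)$ does not exist or is not in $\{0,1\}$; (2) the first-order convergence law holds for $G_n$, i.e. $\lim_{n\to\infty}\Pr(G_n\models\varphi)$ exists for every first-order sentence $\varphi$; (3) $\overline{\{\lim_{n\to\infty}\Pr(G_n\models\varphi):\varphi\text{ a first-order sentence}\}}=[0,1]$, the bar denoting topological closure.
   Context: A caterpillar is a tree consisting of a path together with vertices of degree one attached to vertices of the path (equivalently, a tree such that removing all leaves leaves a path). A forest of caterpillars is a graph all of whose components are caterpillars. First-order logic of graphs: vertex variables, quantifiers, connectives, $=$ and adjacency. *)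

theory Defs
  imports "HOL-Probability.Probability_Mass_Function" "Graph_Theory.Graph_Theory"
begin

section \<open>First-order logic of graphs\<close>

datatype fo =
    Eq nat nat
  | Adj nat nat
  | Neg fo
  | And fo fo
  | Or fo fo
  | Imp fo fo
  | All nat fo
  | Ex nat fo

primrec fv :: "fo \<Rightarrow> nat set" where
  "fv (Eq x y) = {x, y}"
| "fv (Adj x y) = {x, y}"
| "fv (Neg \<phi>) = fv \<phi>"
| "fv (And \<phi> \<psi>) = fv \<phi> \<union> fv \<psi>"
| "fv (Or \<phi> \<psi>) = fv \<phi> \<union> fv \<psi>"
| "fv (Imp \<phi> \<psi>) = fv \<phi> \<union> fv \<psi>"
| "fv (All x \<phi>) = fv \<phi> - {x}"
| "fv (Ex x \<phi>) = fv \<phi> - {x}"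

definition sentence :: "fo \<Rightarrow> bool" where
  "sentence \<phi> \<longleftrightarrow> fv \<phi> = {}"

primrec sat :: "'a pair_pre_digraph \<Rightarrow> (nat \<Rightarrow> 'a) \<Rightarrow> fo \<Rightarrow> bool" where
  "sat G e (Eq x y) \<longleftrightarrow> e x = e y"
| "sat G e (Adj x y) \<longleftrightarrow> (e x, e y) \<in> parcs G"
| "sat G e (Neg \<phi>) \<longleftrightarrow> \<not> sat G e \<phi>"
| "sat G e (And \<phi> \<psi>) \<longleftrightarrow> sat G e \<phi> \<and> sat G e \<psi>"
| "sat G e (Or \<phi> \<psi>) \<longleftrightarrow> sat G e \<phi> \<or> sat G e \<psi>"
| "sat G e (Imp \<phi> \<psi>) \<longleftrightarrow> (sat G e \<phi> \<longrightarrow> sat G e \<psi>)"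
| "sat G e (All x \<phi>) \<longleftrightarrow> (\<forall>v\<in>pverts G. sat G (e(x := v)) \<phi>)"
| "sat G e (Ex x \<phi>) \<longleftrightarrow> (\<exists>v\<in>pverts G. sat G (e(x := v)) \<phi>)"

text \<open>Used for sentences only, whose truth value does not depend on the assignment
  (lemma \<open>models_iff_sat\<close>), so assignments need not be restricted to vertices of \<open>G\<close>.\<close>

definition models :: "'a pair_pre_digraph \<Rightarrow> fo \<Rightarrow> bool" where
  "models G \<phi> \<longleftrightarrow> (\<forall>e. sat G e \<phi>)"

lemma sat_cong: "(\<And>x. x \<in> fv \<phi> \<Longrightarrow> e x = e' x) \<Longrightarrow> sat G e \<phi> \<longleftrightarrow> sat G e' \<phi>"
proof (induction \<phi> arbitrary: e e')
  case (All x \<phi>)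
  have "sat G (e(x := v)) \<phi> \<longleftrightarrow> sat G (e'(x := v)) \<phi>" for v
    by (rule All.IH) (use All.prems in auto)
  then show ?case by simp
next
  case (Ex x \<phi>)
  have "sat G (e(x := v)) \<phi> \<longleftrightarrow> sat G (e'(x := v)) \<phi>" for v
    by (rule Ex.IH) (use Ex.prems in auto)
  then show ?case by simp
next
  case (And \<phi> \<psi>)
  then show ?case by (metis fv.simps(4) sat.simps(4) UnCI)
next
  case (Or \<phi> \<psi>)
  then show ?case by (metis fv.simps(5) sat.simps(5) UnCI)
next
  case (Imp \<phi> \<psi>)
  then show ?case by (metis fv.simps(6) sat.simps(6) UnCI)
next
  case (Neg \<phi>)
  then show ?case by (metis fv.simps(3) sat.simps(3))
qed auto

lemma models_iff_sat: "sentence \<phi> \<Longrightarrow> models G \<phi> \<longleftrightarrow> sat G e \<phi>"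
  using sat_cong[of \<phi> e] by (auto simp: models_def sentence_def)


section \<open>Caterpillars\<close>

text \<open>A simple graph is a loop-free symmetric digraph without parallel arcs (locale
  \<^locale>\<open>graph\<close>), each edge being a pair of opposite arcs; the degree of a vertex is its out-degree.
  The library predicates \<^const>\<open>forest\<close> and \<^const>\<open>tree\<close> are unsuitable here: they refer to
  directed cycles, and a pair of opposite arcs is already one. An undirected cycle is given by
  the list of its vertices, of which there are at least three.\<close>

definition undirected_cycle :: "('a, 'b) pre_digraph \<Rightarrow> 'a list \<Rightarrow> bool" where
  "undirected_cycle G p \<longleftrightarrow> vpath p G \<and> 3 \<le> length p \<and> (last p, hd p) \<in> arcs_ends G"

definition undirected_tree :: "('a, 'b) pre_digraph \<Rightarrow> bool" where
  "undirected_tree G \<longleftrightarrow>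
     graph G \<and> Digraph_Component.connected G \<and> (\<nexists>p. undirected_cycle G p)"

text \<open>The path \<open>p\<close> may be a single vertex, but it is not empty. In particular the trees with one
  and with two vertices are caterpillars.\<close>

definition caterpillar :: "('a, 'b) pre_digraph \<Rightarrow> bool" where
  "caterpillar G \<longleftrightarrow> undirected_tree G \<and>
     (\<exists>p. vpath p G \<and>
        (\<forall>v\<in>verts G - set p. out_degree G v = 1 \<and> (\<exists>u\<in>set p. (u, v) \<in> arcs_ends G)))"

text \<open>In a symmetric digraph the strongly connected components \<^const>\<open>pre_digraph.sccs\<close> are the
  connected components.\<close>

definition caterpillar_forest :: "('a, 'b) pre_digraph \<Rightarrow> bool" where
  "caterpillar_forest G \<longleftrightarrow> graph G \<and> (\<forall>H\<in>pre_digraph.sccs G. caterpillar H)"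


section \<open>Random caterpillars and random forests of caterpillars\<close>

definition caterpillars_on :: "nat \<Rightarrow> nat pair_pre_digraph set" where
  "caterpillars_on n = {G. pverts G = {1..n} \<and> caterpillar (with_proj G)}"

definition caterpillar_forests_on :: "nat \<Rightarrow> nat pair_pre_digraph set" where
  "caterpillar_forests_on n = {G. pverts G = {1..n} \<and> caterpillar_forest (with_proj G)}"

text \<open>\<^const>\<open>pmf_of_set\<close> is the uniform distribution only on a finite nonempty set; see the lemmas
  at the end of the theory. There is no caterpillar without vertices, so \<open>random_caterpillar 0\<close>
  is unspecified, which does not affect limits.\<close>

definition random_caterpillar :: "nat \<Rightarrow> nat pair_pre_digraph pmf" where
  "random_caterpillar n = pmf_of_set (caterpillars_on n)"

definition random_caterpillar_forest :: "nat \<Rightarrow> nat pair_pre_digraph pmf" where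
  "random_caterpillar_forest n = pmf_of_set (caterpillar_forests_on n)"

definition prob_models :: "(nat \<Rightarrow> nat pair_pre_digraph pmf) \<Rightarrow> fo \<Rightarrow> nat \<Rightarrow> real" where
  "prob_models R \<phi> n = measure_pmf.prob (R n) {G. models G \<phi>}"

lemma finite_graphs_on:
  "finite {G :: nat pair_pre_digraph. pverts G = {1..n} \<and> wf_digraph (with_proj G)}"
proof (rule finite_subset)
  show "{G :: nat pair_pre_digraph. pverts G = {1..n} \<and> wf_digraph (with_proj G)}
    \<subseteq> (\<lambda>E. \<lparr>pverts = {1..n}, parcs = E\<rparr>) ` Pow ({1..n} \<times> {1..n})"
  proof
    fix G :: "nat pair_pre_digraph"
    assume "G \<in> {G. pverts G = {1..n} \<and> wf_digraph (with_proj G)}"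
    then have V: "pverts G = {1..n}" and "wf_digraph (with_proj G)" by auto
    then interpret pair_wf_digraph G by (simp add: wf_digraph_wp_iff)
    have "parcs G \<subseteq> {1..n} \<times> {1..n}"
      using V wellformed' by auto
    moreover have "G = \<lparr>pverts = {1..n}, parcs = parcs G\<rparr>"
      using V by (cases G) simp
    ultimately show "G \<in> (\<lambda>E. \<lparr>pverts = {1..n}, parcs = E\<rparr>) ` Pow ({1..n} \<times> {1..n})"
      by blast
  qed
qed auto

lemma graph_imp_wf: "graph G \<Longrightarrow> wf_digraph G"
  by (simp add: graph_def digraph_def fin_digraph_def)

lemma finite_caterpillars_on: "finite (caterpillars_on n)"
  by (rule finite_subset[OF _ finite_graphs_on[of n]])
     (auto simp: caterpillars_on_def caterpillar_def undirected_tree_def graph_imp_wf)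

lemma finite_caterpillar_forests_on: "finite (caterpillar_forests_on n)"
  by (rule finite_subset[OF _ finite_graphs_on[of n]])
     (auto simp: caterpillar_forests_on_def caterpillar_forest_def graph_imp_wf)

lemma star_mem_caterpillars_on:
  assumes "n \<ge> 1"
  shows "\<lparr>pverts = {1..n}, parcs = {1} \<times> {2..n} \<union> {2..n} \<times> {1}\<rparr> \<in> caterpillars_on n"
proof -
  define G :: "nat pair_pre_digraph" where
    "G = \<lparr>pverts = {1..n}, parcs = {1} \<times> {2..n} \<union> {2..n} \<times> {1}\<rparr>"
  have V: "pverts G = {1..n}" and A: "parcs G = {1} \<times> {2..n} \<union> {2..n} \<times> {1}"
    by (auto simp: G_def)
  interpret pair_graph G
    by unfold_locales (auto simp: V A symmetric_def sym_def)
  have gr: "graph (with_proj G)" by unfold_locales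
  have to_1: "v \<rightarrow>\<^sup>*\<^bsub>with_proj G\<^esub> 1" and from_1: "1 \<rightarrow>\<^sup>*\<^bsub>with_proj G\<^esub> v" if v: "v \<in> pverts G" for v
  proof -
    consider "v = 1" | "v \<in> {2..n}" using v by (force simp: V)
    then have "v \<rightarrow>\<^sup>*\<^bsub>with_proj G\<^esub> 1 \<and> 1 \<rightarrow>\<^sup>*\<^bsub>with_proj G\<^esub> v"
    proof cases
      case 1
      then show ?thesis using that by (auto intro: reachable_refl)
    next
      case 2
      then have "(v, 1) \<in> parcs G" "(1, v) \<in> parcs G" by (auto simp: A)
      then show ?thesis by (auto intro: reachable_adjI)
    qed
    then show "v \<rightarrow>\<^sup>*\<^bsub>with_proj G\<^esub> 1" "1 \<rightarrow>\<^sup>*\<^bsub>with_proj G\<^esub> v" by auto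
  qed
  have mk: "mk_symmetric (with_proj G) = G"
    by (rule pair_pre_digraph.equality) (auto simp: mk_symmetric_def A)
  have "strongly_connected (with_proj G)"
    unfolding strongly_connected_def
    using assms reachable_trans[OF to_1 from_1] by (auto simp: V)
  then have conn: "Digraph_Component.connected (with_proj G)"
    by (simp add: Digraph_Component.connected_def mk)
  have "\<not> undirected_cycle (with_proj G) p" for p
  proof
    assume c: "undirected_cycle (with_proj G) p"
    then obtain x y z q where p: "p = x # y # z # q"
      unfolding undirected_cycle_def by (cases p rule: vwalk_arcs.cases; cases "tl (tl p)") auto
    have d: "distinct p" and xy: "(x, y) \<in> parcs G" and yz: "(y, z) \<in> parcs G"
      and l: "(last p, x) \<in> parcs G"
      using c by (auto simp: undirected_cycle_def vpath_def vwalk_def p)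
    have y: "y = 1" using xy yz d by (auto simp: A p)
    have "last p \<in> set (z # q)" by (simp add: p)
    then have "last p \<noteq> y" using d by (auto simp: p)
    then show False using l d y by (auto simp: A p)
  qed
  then have "undirected_tree (with_proj G)"
    using gr conn by (simp add: undirected_tree_def)
  moreover have "vpath [1] (with_proj G)"
    using assms by (auto simp: vpath_def vwalk_def V)
  moreover have "out_degree (with_proj G) v = 1" "(1, v) \<in> parcs G" if "v \<in> pverts G - {1}" for v
  proof -
    have "v \<in> {2..n}" using that by (auto simp: V)
    then have "out_arcs (with_proj G) v = {(v, 1)}" by (auto simp: out_arcs_def A)
    then show "out_degree (with_proj G) v = 1" by (simp add: out_degree_def)
    show "(1, v) \<in> parcs G" using \<open>v \<in> {2..n}\<close> by (auto simp: A)
  qed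
  ultimately have "caterpillar (with_proj G)"
    unfolding caterpillar_def by (intro conjI exI[of _ "[1]"]) auto
  then show ?thesis using V by (simp add: caterpillars_on_def G_def)
qed

lemma caterpillars_on_nonempty: "n \<ge> 1 \<Longrightarrow> caterpillars_on n \<noteq> {}"
  using star_mem_caterpillars_on by blast

lemma caterpillar_imp_caterpillar_forest:
  assumes "caterpillar G"
  shows "caterpillar_forest G"
proof -
  have gr: "graph G" and conn: "Digraph_Component.connected G"
    using assms by (auto simp: caterpillar_def undirected_tree_def)
  interpret graph G by (rule gr)
  have sc: "strongly_connected G"
    using conn by (rule symmetric_connected_imp_strongly_connected[OF sym_arcs])
  have "H = G" if "H \<in> sccs" for H
  proof -
    have H: "induced_subgraph H G"
      and max: "\<nexists>H'. induced_subgraph H' G \<and> strongly_connected H' \<and> verts H \<subset> verts H'"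
      using that by (auto simp: sccs_def)
    have "induced_subgraph G G"
      by (auto simp: induced_subgraph_def subgraph_def compatible_def wf_digraph)
    then have "verts H = verts G"
      using H max sc by (auto simp: induced_subgraph_def subgraph_def)
    then show "H = G"
      using H tail_in_verts head_in_verts
      by (intro pre_digraph.equality)
        (fastforce simp: induced_subgraph_def subgraph_def compatible_def)+
  qed
  then show ?thesis
    using assms gr by (auto simp: caterpillar_forest_def)
qed

lemma caterpillar_forests_on_nonempty: "caterpillar_forests_on n \<noteq> {}"
proof (cases n)
  case (Suc m)
  then obtain G where "G \<in> caterpillars_on n" using caterpillars_on_nonempty[of n] by auto
  then have "G \<in> caterpillar_forests_on n"
    by (simp add: caterpillars_on_def caterpillar_forests_on_def caterpillar_imp_caterpillar_forest)
  then show ?thesis by blast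
next
  case 0
  define G :: "nat pair_pre_digraph" where "G = \<lparr>pverts = {}, parcs = {}\<rparr>"
  interpret pair_graph G
    by unfold_locales (auto simp: G_def symmetric_def sym_def)
  have "graph (with_proj G)" by unfold_locales
  moreover have "pre_digraph.sccs (with_proj G) = {}"
    by (auto simp: pre_digraph.sccs_def induced_subgraph_def subgraph_def strongly_connected_def G_def)
  ultimately have "G \<in> caterpillar_forests_on n"
    by (simp add: caterpillar_forests_on_def caterpillar_forest_def 0 G_def)
  then show ?thesis by blast
qed

end

theory Submission
  imports Defs "HOL-Analysis.Analysis" "HOL-Computational_Algebra.Formal_Power_Series"
    "HOL-Real_Asymp.Real_Asymp" "HOL-Library.Nat_Bijection"
begin

text \<open>A caterpillar is, up to reversal, a sequence of path vertices with their leaf sets, so its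
  exponential generating function is rational in \<open>x\<close> and \<open>exp x\<close>, with a simple dominant pole at the
  solution \<open>rho\<close> of \<open>rho * exp rho = 1\<close>. The forests have the exponential of this function, a series
  with coefficients \<open>h n\<close> for which, after rescaling, \<open>h n / h (n + 1)\<close> tends to 1 and
  \<open>h m \<le> B * h n\<close> for \<open>m \<le> n\<close>. By dominated convergence the number of components in an
  isomorphism-closed class whose generating function converges at \<open>rho\<close> is asymptotically Poisson,
  independently for disjoint classes; if it diverges, then the number of components tends to infinity
  in probability. A first-order sentence only sees the numbers, up to a threshold, of
  components of finitely many types, whence the convergence law.

  The probability that no component lies in a given finite set of isomorphism types tends to
  \<open>exp (- s)\<close>, with \<open>s\<close> the sum of the masses. The masses tend to 0 and have divergent sum, so the
  values \<open>s\<close> are dense in the nonnegative reals.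

  For a single caterpillar, the number of leaves at an end of the spine has a nondegenerate limit law
  and is definable.\<close>

section \<open>Absolutely summable power series\<close>

text \<open>After rescaling, the series of caterpillars is c/(1 - x) + A with A absolutely summable,
  so that of forests is exp(c/(1 - x) + A), with an essential singularity at 1. Precise asymptotics
  of its coefficients would call for a saddle-point argument, but limits of probabilities only need
  the ratios h (n - i) / h n. For the pure pole these come from a three-term recurrence; the factor
  exp A is absorbed by convolution. Absolute summability of coefficients takes the place of complex
  analysis. The residue is c = (1 - rho)^2 / (2 * (1 + rho)): the 2 comes from reversal, 1 / (1 +
  rho) from the pole of the series of all encodings, and (1 - rho)^2 from requiring a leaf at both
  ends of the spine, which makes the encoding unique up to reversal and misses at most n stars on n
  vertices. As c > 0, the masses have divergent sum; a type with m vertices has at most m!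
  labellings, so its mass is at most rho^m and tends to 0. For a single caterpillar no limit is
  computed: lower bounds for the sentence and for its negation suffice.\<close>

definition abs_summable_fps :: "real fps \<Rightarrow> bool" where
  "abs_summable_fps F \<longleftrightarrow> summable (\<lambda>n. \<bar>fps_nth F n\<bar>)"

text \<open>Evaluation at the point 1, where the dominant singularity sits after rescaling.\<close>

definition fps_sum :: "real fps \<Rightarrow> real" where
  "fps_sum F = (\<Sum>n. fps_nth F n)"

lemma abs_summable_fps_imp_summable: "abs_summable_fps F \<Longrightarrow> summable (fps_nth F)"
  unfolding abs_summable_fps_def by (rule summable_rabs_cancel)

lemma abs_summable_fps_add:
  assumes "abs_summable_fps F" "abs_summable_fps G"
  shows "abs_summable_fps (F + G)" "fps_sum (F + G) = fps_sum F + fps_sum G"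
proof -
  show "abs_summable_fps (F + G)"
    unfolding abs_summable_fps_def
    by (rule summable_comparison_test'[of "\<lambda>n. \<bar>fps_nth F n\<bar> + \<bar>fps_nth G n\<bar>" 0])
      (use assms in \<open>auto simp: abs_summable_fps_def intro: summable_add\<close>)
  show "fps_sum (F + G) = fps_sum F + fps_sum G"
    using suminf_add[OF abs_summable_fps_imp_summable[OF assms(1)] abs_summable_fps_imp_summable[OF assms(2)]]
    by (simp add: fps_sum_def)
qed

lemma abs_summable_fps_uminus:
  "abs_summable_fps (- F) \<longleftrightarrow> abs_summable_fps F"
  by (simp add: abs_summable_fps_def)

lemma fps_sum_uminus: "abs_summable_fps F \<Longrightarrow> fps_sum (- F) = - fps_sum F"
  using suminf_minus[OF abs_summable_fps_imp_summable[of F]] by (simp add: fps_sum_def)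

lemma abs_summable_fps_diff:
  assumes "abs_summable_fps F" "abs_summable_fps G"
  shows "abs_summable_fps (F - G)" "fps_sum (F - G) = fps_sum F - fps_sum G"
  using abs_summable_fps_add[of F "- G"] assms by (auto simp: abs_summable_fps_uminus fps_sum_uminus)

lemma abs_summable_fps_finite:
  assumes "\<And>n. n \<ge> N \<Longrightarrow> fps_nth F n = 0"
  shows "abs_summable_fps F" "fps_sum F = (\<Sum>n<N. fps_nth F n)"
proof -
  show "abs_summable_fps F" unfolding abs_summable_fps_def
    by (rule summable_finite[of "{..<N}"]) (use assms in \<open>auto simp: not_less\<close>)
  show "fps_sum F = (\<Sum>n<N. fps_nth F n)" unfolding fps_sum_def
    by (rule suminf_finite) (use assms in \<open>auto simp: not_less\<close>)
qed

lemma abs_summable_fps_const: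
  "abs_summable_fps (fps_const c)" "fps_sum (fps_const c) = c"
  using abs_summable_fps_finite[of 1 "fps_const c"] by auto

lemma abs_summable_fps_1: "abs_summable_fps 1" "fps_sum 1 = 1"
  using abs_summable_fps_const[of 1] by auto

lemma abs_summable_fps_X: "abs_summable_fps fps_X" "fps_sum fps_X = 1"
  using abs_summable_fps_finite[of 2 fps_X] by (auto simp: numeral_2_eq_2 fps_X_def)

text \<open>The triangle i + j <= N lies in a square. This controls partial sums of a product before
  any convergence is known, which is the situation for the inverse below.\<close>

lemma sum_convolution_le:
  fixes a b :: "nat \<Rightarrow> real"
  assumes "\<And>n. a n \<ge> 0" "\<And>n. b n \<ge> 0"
  shows "(\<Sum>n\<le>N. \<Sum>i\<le>n. a i * b (n - i)) \<le> (\<Sum>i\<le>N. a i) * (\<Sum>i\<le>N. b i)"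
proof -
  have "(\<Sum>n\<le>N. \<Sum>i\<le>n. a i * b (n - i)) = (\<Sum>(i,j)\<in>{(i,j). i + j \<le> N}. a i * b j)"
    using sum.triangle_reindex_eq[of "\<lambda>i j. a i * b j" N] by simp
  also have "\<dots> \<le> (\<Sum>(i,j)\<in>{..N} \<times> {..N}. a i * b j)"
    by (rule sum_mono2) (use assms in auto)
  also have "\<dots> = (\<Sum>i\<le>N. a i) * (\<Sum>i\<le>N. b i)"
    by (simp add: sum_product sum.cartesian_product)
  finally show ?thesis .
qed

lemma fps_mult_nth_atMost: "fps_nth (F * G) n = (\<Sum>i\<le>n. fps_nth F i * fps_nth G (n - i))"
  by (simp add: fps_mult_nth atMost_atLeast0)

lemma abs_fps_mult_nth_le:
  fixes F G :: "real fps"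
  shows "\<bar>fps_nth (F * G) n\<bar> \<le> (\<Sum>i\<le>n. \<bar>fps_nth F i\<bar> * \<bar>fps_nth G (n - i)\<bar>)"
  unfolding fps_mult_nth_atMost by (rule order.trans[OF sum_abs]) (simp add: abs_mult)

lemma abs_summable_fps_mult:
  assumes "abs_summable_fps F" "abs_summable_fps G"
  shows "abs_summable_fps (F * G)" "fps_sum (F * G) = fps_sum F * fps_sum G"
proof -
  have "summable (\<lambda>n. \<Sum>i\<le>n. \<bar>fps_nth F i\<bar> * \<bar>fps_nth G (n - i)\<bar>)"
    using assms by (intro summable_Cauchy_product) (auto simp: abs_summable_fps_def)
  then show "abs_summable_fps (F * G)"
    unfolding abs_summable_fps_def
    by (rule summable_comparison_test'[where N = 0]) (use abs_fps_mult_nth_le in simp)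
  show "fps_sum (F * G) = fps_sum F * fps_sum G"
    unfolding fps_sum_def fps_mult_nth_atMost
    using assms by (intro Cauchy_product[symmetric]) (auto simp: abs_summable_fps_def)
qed

lemma abs_summable_fps_power:
  assumes "abs_summable_fps F"
  shows "abs_summable_fps (F ^ k)" "fps_sum (F ^ k) = fps_sum F ^ k"
  by (induction k) (use assms in \<open>auto simp: abs_summable_fps_1 abs_summable_fps_mult\<close>)

lemma suminf_abs_fps_power_le:
  assumes "abs_summable_fps F"
  shows "(\<Sum>n. \<bar>fps_nth (F ^ k) n\<bar>) \<le> (\<Sum>n. \<bar>fps_nth F n\<bar>) ^ k"
proof (induction k)
  case 0
  have "(\<Sum>n. \<bar>fps_nth (1 :: real fps) n\<bar>) = (\<Sum>n<1. \<bar>fps_nth (1 :: real fps) n\<bar>)"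
    by (rule suminf_finite) auto
  then show ?case by simp
next
  case (Suc k)
  have s: "summable (\<lambda>n. \<bar>fps_nth (F ^ j) n\<bar>)" for j
    using abs_summable_fps_power(1)[OF assms] by (simp add: abs_summable_fps_def)
  have "(\<Sum>n. \<bar>fps_nth (F ^ Suc k) n\<bar>) \<le> (\<Sum>n. \<Sum>i\<le>n. \<bar>fps_nth F i\<bar> * \<bar>fps_nth (F ^ k) (n - i)\<bar>)"
    using s[of 1] s[of k] s[of "Suc k"] abs_fps_mult_nth_le[of F "F ^ k"]
    by (intro suminf_le summable_Cauchy_product) auto
  also have "\<dots> = (\<Sum>n. \<bar>fps_nth F n\<bar>) * (\<Sum>n. \<bar>fps_nth (F ^ k) n\<bar>)"
    using s[of 1] s[of k] by (intro Cauchy_product[symmetric]) auto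
  also have "\<dots> \<le> (\<Sum>n. \<bar>fps_nth F n\<bar>) ^ Suc k"
    using Suc s[of 1] by (auto intro!: mult_left_mono suminf_nonneg)
  finally show ?case .
qed

text \<open>A Neumann series, argued on partial sums: since G = 1 - P * G, the partial sums S of |G|
  satisfy S <= 1 + theta * S with theta < 1 the absolute sum of P, so they stay below 1 / (1 -
  theta).\<close>

lemma abs_summable_fps_inverse:
  assumes 0: "fps_nth P 0 = 0" and P: "abs_summable_fps P" and less: "(\<Sum>n. \<bar>fps_nth P n\<bar>) < 1"
  shows "abs_summable_fps (inverse (1 + P))"
proof -
  define G where "G = inverse (1 + P)"
  define \<theta> where "\<theta> = (\<Sum>n. \<bar>fps_nth P n\<bar>)"
  have "(1 + P) * G = 1" unfolding G_def by (rule inverse_mult_eq_1') (simp add: 0)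
  then have G: "G = 1 - P * G" by (simp add: algebra_simps)
  have le: "\<bar>fps_nth G n\<bar> \<le> (if n = 0 then 1 else 0) + (\<Sum>i\<le>n. \<bar>fps_nth P i\<bar> * \<bar>fps_nth G (n - i)\<bar>)" for n
  proof -
    have "fps_nth G n = (if n = 0 then 1 else 0) - fps_nth (P * G) n"
      by (subst G) simp
    then show ?thesis using abs_fps_mult_nth_le[of P G n] by auto
  qed
  have bound: "(\<Sum>n\<le>N. \<bar>fps_nth G n\<bar>) \<le> 1 / (1 - \<theta>)" for N
  proof -
    let ?S = "\<Sum>n\<le>N. \<bar>fps_nth G n\<bar>"
    have "?S \<le> (\<Sum>n\<le>N. (if n = 0 then 1 else 0) + (\<Sum>i\<le>n. \<bar>fps_nth P i\<bar> * \<bar>fps_nth G (n - i)\<bar>))"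
      by (rule sum_mono) (rule le)
    also have "\<dots> = 1 + (\<Sum>n\<le>N. \<Sum>i\<le>n. \<bar>fps_nth P i\<bar> * \<bar>fps_nth G (n - i)\<bar>)"
      by (simp add: sum.distrib)
    also have "\<dots> \<le> 1 + (\<Sum>n\<le>N. \<bar>fps_nth P n\<bar>) * ?S"
      using sum_convolution_le[of "\<lambda>n. \<bar>fps_nth P n\<bar>" "\<lambda>n. \<bar>fps_nth G n\<bar>" N] by simp
    also have "\<dots> \<le> 1 + \<theta> * ?S"
    proof -
      have "(\<Sum>n\<le>N. \<bar>fps_nth P n\<bar>) \<le> \<theta>"
        unfolding \<theta>_def using P by (intro sum_le_suminf) (auto simp: abs_summable_fps_def)
      then show ?thesis by (intro add_left_mono mult_right_mono) (auto intro: sum_nonneg)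
    qed
    finally show ?thesis using less by (simp add: \<theta>_def field_simps)
  qed
  show ?thesis unfolding G_def[symmetric] abs_summable_fps_def
    by (rule bounded_imp_summable[OF _ bound]) simp
qed

section \<open>Exponentials of power series without constant term\<close>

definition fps_Exp :: "real fps \<Rightarrow> real fps" where
  "fps_Exp A = fps_compose (fps_exp 1) A"

lemma fps_Exp_0: "fps_nth (fps_Exp A) 0 = 1"
  by (simp add: fps_Exp_def)

lemma fps_Exp_deriv: "fps_nth A 0 = 0 \<Longrightarrow> fps_deriv (fps_Exp A) = fps_deriv A * fps_Exp A"
  by (simp add: fps_Exp_def fps_compose_deriv)

lemma fps_eq_1_if_deriv_0: "fps_nth F 0 = 1 \<Longrightarrow> fps_deriv (F :: real fps) = 0 \<Longrightarrow> F = 1"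
  by (metis fps_deriv_eq_0_iff fps_const_1_eq_1)

lemma fps_Exp_uminus:
  assumes "fps_nth A 0 = 0"
  shows "fps_Exp A * fps_Exp (- A) = 1"
  by (rule fps_eq_1_if_deriv_0) (use assms in \<open>auto simp: fps_Exp_deriv fps_Exp_0 algebra_simps\<close>)

text \<open>Multiplying by exp (- A) turns the differential equation into a vanishing
  derivative.\<close>

lemma fps_Exp_unique:
  assumes "fps_nth A 0 = 0" "fps_nth F 0 = 1" "fps_deriv F = fps_deriv A * F"
  shows "F = fps_Exp A"
proof -
  have "F * fps_Exp (- A) = 1"
    by (rule fps_eq_1_if_deriv_0) (use assms in \<open>auto simp: fps_Exp_deriv fps_Exp_0 algebra_simps\<close>)
  then have "F * (fps_Exp A * fps_Exp (- A)) = fps_Exp A"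
    by (metis mult.commute mult.left_commute mult.right_neutral)
  then show ?thesis using fps_Exp_uminus[OF assms(1)] by simp
qed

lemma fps_Exp_add:
  assumes "fps_nth A 0 = 0" "fps_nth B 0 = 0"
  shows "fps_Exp (A + B) = fps_Exp A * fps_Exp B"
  by (rule fps_Exp_unique[symmetric])
    (use assms in \<open>auto simp: fps_Exp_deriv fps_Exp_0 algebra_simps\<close>)

text \<open>Coefficient form of F' = A' * F. Marking a vertex of a forest and removing its component
  yields exactly this recurrence.\<close>

lemma fps_Exp_unique_recurrence:
  assumes A: "fps_nth A 0 = 0" and F: "fps_nth F 0 = 1"
    and rec: "\<And>n. n > 0 \<Longrightarrow> real n * fps_nth F n = (\<Sum>k\<le>n. real k * fps_nth A k * fps_nth F (n - k))"
  shows "F = fps_Exp A"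
proof (rule fps_Exp_unique[OF A F], rule fps_ext)
  fix n
  have "fps_nth (fps_deriv F) n = real (Suc n) * fps_nth F (Suc n)" by simp
  also have "\<dots> = (\<Sum>k\<le>Suc n. real k * fps_nth A k * fps_nth F (Suc n - k))"
    by (rule rec) simp
  also have "\<dots> = fps_nth (fps_deriv A * F) n"
    by (subst sum.atMost_Suc_shift) (simp add: fps_mult_nth_atMost)
  finally show "fps_nth (fps_deriv F) n = fps_nth (fps_deriv A * F) n" .
qed

lemma fps_Exp_nth_recurrence:
  assumes "fps_nth A 0 = 0"
  shows "real n * fps_nth (fps_Exp A) n = (\<Sum>k\<le>n. real k * fps_nth A k * fps_nth (fps_Exp A) (n - k))"
proof (cases n)
  case (Suc m)
  have "real n * fps_nth (fps_Exp A) n = fps_nth (fps_deriv (fps_Exp A)) m" by (simp add: Suc)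
  also have "\<dots> = (\<Sum>k\<le>Suc m. real k * fps_nth A k * fps_nth (fps_Exp A) (Suc m - k))"
    unfolding fps_Exp_deriv[OF assms]
    by (subst sum.atMost_Suc_shift) (simp add: fps_mult_nth_atMost)
  finally show ?thesis using Suc by simp
qed simp

text \<open>The double family of coefficients of A^i / i! has rows dominated by beta^i / i!, with
  beta the absolute sum of A, so it may be summed in either order: the columns give the coefficients
  of the exponential, the rows the exponential series at the value of A at 1.\<close>

lemma fps_Exp_abs_summable:
  assumes 0: "fps_nth A 0 = 0" and A: "abs_summable_fps A"
  shows "abs_summable_fps (fps_Exp A)" "fps_sum (fps_Exp A) = exp (fps_sum A)"
proof -
  define f where "f = (\<lambda>i n. fps_nth (A ^ i) n / fact i)"
  define \<beta> where "\<beta> = (\<Sum>n. \<bar>fps_nth A n\<bar>)"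
  have s: "summable (\<lambda>n. \<bar>f i n\<bar>)" for i
    using abs_summable_fps_power(1)[OF A, of i] unfolding abs_summable_fps_def f_def
    by (simp add: abs_div summable_divide)
  have fs: "(f i has_sum (fps_sum A ^ i / fact i)) UNIV" for i
  proof (rule norm_summable_imp_has_sum)
    show "f i sums (fps_sum A ^ i / fact i)"
      unfolding f_def
      using abs_summable_fps_power[OF A, of i] abs_summable_fps_imp_summable
      by (intro sums_divide) (simp add: fps_sum_def sums_iff)
  qed (use s in simp)
  have abs_le: "(\<Sum>\<^sub>\<infinity>n. \<bar>f i n\<bar>) \<le> \<beta> ^ i / fact i" for i
  proof -
    have "(\<Sum>\<^sub>\<infinity>n. \<bar>f i n\<bar>) = (\<Sum>n. \<bar>f i n\<bar>)"
      by (rule infsumI[OF norm_summable_imp_has_sum]) (use s in auto)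
    also have "\<dots> = (\<Sum>n. \<bar>fps_nth (A ^ i) n\<bar>) / fact i"
      unfolding f_def using abs_summable_fps_power(1)[OF A, of i]
      by (simp add: abs_div suminf_divide abs_summable_fps_def)
    also have "\<dots> \<le> \<beta> ^ i / fact i"
      unfolding \<beta>_def by (intro divide_right_mono suminf_abs_fps_power_le[OF A]) simp
    finally show ?thesis .
  qed
  have "(\<lambda>x. norm (case x of (i, n) \<Rightarrow> f i n)) summable_on (UNIV \<times> UNIV)"
  proof (rule iffD2[OF Infinite_Sum.abs_summable_on_Sigma_iff], intro conjI ballI)
    show "(\<lambda>n. norm (case (i, n) of (i, n) \<Rightarrow> f i n)) summable_on UNIV" for i
      using norm_summable_imp_summable_on[of "\<lambda>n. \<bar>f i n\<bar>"] s[of i] by simp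
    have "summable (\<lambda>i. \<beta> ^ i / fact i)"
      using summable_exp[of \<beta>] by (simp add: field_simps)
    then have "summable (\<lambda>i. norm (\<Sum>\<^sub>\<infinity>n. \<bar>f i n\<bar>))"
      by (rule summable_comparison_test'[where N = 0]) (simp add: abs_le infsum_nonneg)
    then show "(\<lambda>i. norm (\<Sum>\<^sub>\<infinity>n. norm (case (i, n) of (i, n) \<Rightarrow> f i n))) summable_on UNIV"
      using norm_summable_imp_summable_on[of "\<lambda>i. norm (\<Sum>\<^sub>\<infinity>n. \<bar>f i n\<bar>)"] by simp
  qed
  then have summ: "(\<lambda>(i,n). f i n) summable_on (UNIV \<times> UNIV)"
    by (rule abs_summable_summable)
  \<comment> \<open>Without constant term, A^i starts at degree i, so only i <= n contribute and the
    sum is the finite one that defines the composition.\<close>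
  have col: "(\<Sum>\<^sub>\<infinity>i. f i n) = fps_nth (fps_Exp A) n" for n
  proof -
    have "(\<Sum>\<^sub>\<infinity>i. f i n) = (\<Sum>\<^sub>\<infinity>i\<in>{0..n}. f i n)"
      by (rule infsum_cong_neutral) (auto simp: f_def startsby_zero_power_prefix[OF 0])
    also have "\<dots> = fps_nth (fps_Exp A) n"
      by (simp add: fps_Exp_def fps_compose_nth f_def field_simps)
    finally show ?thesis .
  qed
  have summ': "(\<lambda>(n,i). f i n) summable_on (UNIV \<times> UNIV)"
    using summ by (subst (asm) summable_on_swap) (simp add: case_prod_unfold)
  have "fps_nth (fps_Exp A) summable_on UNIV"
    using summable_on_Sigma_banach[OF summ'] by (simp add: col)
  then have has: "(fps_nth (fps_Exp A) has_sum (\<Sum>\<^sub>\<infinity>n. fps_nth (fps_Exp A) n)) UNIV"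
    by (rule has_sum_infsum)
  have "(\<lambda>n. norm (fps_nth (fps_Exp A) n)) summable_on UNIV"
    by (rule iffD1[OF summable_on_iff_abs_summable_on_real]) fact
  then show "abs_summable_fps (fps_Exp A)"
    unfolding abs_summable_fps_def real_norm_def
    by (intro sums_summable[OF has_sum_imp_sums[OF has_sum_infsum]])
  have "fps_sum (fps_Exp A) = (\<Sum>\<^sub>\<infinity>n. fps_nth (fps_Exp A) n)"
    unfolding fps_sum_def using has_sum_imp_sums[OF has] by (simp add: sums_iff)
  also have "\<dots> = (\<Sum>\<^sub>\<infinity>n. \<Sum>\<^sub>\<infinity>i. f i n)" by (simp add: col)
  also have "\<dots> = (\<Sum>\<^sub>\<infinity>i. \<Sum>\<^sub>\<infinity>n. f i n)" using infsum_swap_banach[OF summ] by simp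
  also have "\<dots> = (\<Sum>\<^sub>\<infinity>i. fps_sum A ^ i / fact i)" by (simp add: infsumI[OF fs])
  also have "\<dots> = exp (fps_sum A)"
  proof -
    have "(\<lambda>i. fps_sum A ^ i / fact i) sums exp (fps_sum A)"
      using exp_converges[of "fps_sum A"] by (simp add: field_simps)
    moreover have "summable (\<lambda>i. norm (fps_sum A ^ i / fact i))"
      using summable_exp[of "\<bar>fps_sum A\<bar>"] by (simp add: field_simps power_abs)
    ultimately show ?thesis by (intro infsumI norm_summable_imp_has_sum)
  qed
  finally show "fps_sum (fps_Exp A) = exp (fps_sum A)" .
qed

text \<open>The quotient (F(1) - F(x)) / (1 - x): it divides out the zero that F(1) - F has at
  1.\<close>

definition fps_tail :: "real fps \<Rightarrow> real fps" where
  "fps_tail F = Abs_fps (\<lambda>n. \<Sum>j. fps_nth F (Suc n + j))"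

lemma fps_tail_mult:
  assumes "abs_summable_fps F"
  shows "(1 - fps_X) * fps_tail F = fps_const (fps_sum F) - F"
proof (rule fps_ext)
  have s: "summable (\<lambda>j. fps_nth F (n + j))" for n
    using abs_summable_fps_imp_summable[OF assms] summable_iff_shift[of "fps_nth F" n]
    by (simp add: add.commute)
  have rec: "(\<Sum>j. fps_nth F (n + j)) = fps_nth F n + fps_nth (fps_tail F) n" for n
    using suminf_split_head[OF s[of n]] by (simp add: fps_tail_def)
  fix n
  show "fps_nth ((1 - fps_X) * fps_tail F) n = fps_nth (fps_const (fps_sum F) - F) n"
    using rec[of 0] rec[of n] by (cases n) (auto simp: algebra_simps fps_sum_def fps_tail_def)
qed

definition fps_ones :: "real fps" where
  "fps_ones = Abs_fps (\<lambda>_. 1)"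

lemma fps_ones_mult: "(1 - fps_X) * fps_ones = 1"
proof (rule fps_ext)
  fix n show "fps_nth ((1 - fps_X) * fps_ones) n = fps_nth 1 n"
    by (cases n) (auto simp: fps_ones_def algebra_simps)
qed

text \<open>Splits F(x) / (1 - x) into a simple pole at 1 with residue F(1) and the remaining
  regular part.\<close>

lemma fps_ones_mult_eq:
  assumes "abs_summable_fps F"
  shows "fps_ones * F = fps_const (fps_sum F) * fps_ones - fps_tail F"
proof -
  have "fps_tail F = ((1 - fps_X) * fps_ones) * fps_tail F" by (simp add: fps_ones_mult)
  also have "\<dots> = fps_ones * ((1 - fps_X) * fps_tail F)" by (simp only: ac_simps)
  also have "\<dots> = fps_ones * fps_const (fps_sum F) - fps_ones * F"
    unfolding fps_tail_mult[OF assms] by (rule right_diff_distrib)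
  finally have tail: "fps_tail F = fps_ones * fps_const (fps_sum F) - fps_ones * F" .
  show ?thesis unfolding tail by (simp add: mult.commute)
qed

text \<open>The tail and the derivative of an absolutely summable series need not be absolutely
  summable. Geometric decay is inherited by the tail and makes the derivative summable; the ratio
  1/2 is an arbitrary number below 1, available because the series concerned are entire.\<close>

definition rapid :: "real fps \<Rightarrow> bool" where
  "rapid F \<longleftrightarrow> (\<exists>M. \<forall>n. \<bar>fps_nth F n\<bar> \<le> M * (1/2) ^ n)"

lemma rapid_abs_summable:
  assumes "rapid F"
  shows "abs_summable_fps F"
proof -
  obtain M where M: "\<bar>fps_nth F n\<bar> \<le> M * (1/2) ^ n" for n using assms by (auto simp: rapid_def)
  have "summable (\<lambda>n. M * (1/2::real) ^ n)" by (intro summable_mult summable_geometric) simp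
  then show ?thesis unfolding abs_summable_fps_def
    by (rule summable_comparison_test'[where N = 0]) (use M in simp)
qed

lemma rapid_deriv_abs_summable:
  assumes "rapid F"
  shows "abs_summable_fps (fps_deriv F)"
proof -
  obtain M where M: "\<bar>fps_nth F n\<bar> \<le> M * (1/2) ^ n" for n using assms by (auto simp: rapid_def)
  have "summable (\<lambda>n. (M/2) * (real (Suc n) * (1/2) ^ n))"
    using geometric_deriv_sums[of "1/2 :: real"] by (intro summable_mult) (auto simp: sums_iff)
  then show ?thesis unfolding abs_summable_fps_def
  proof (rule summable_comparison_test'[where N = 0])
    fix n :: nat
    have "real (Suc n) * \<bar>fps_nth F (Suc n)\<bar> \<le> real (Suc n) * (M * (1/2) ^ Suc n)"
      by (intro mult_left_mono M) simp
    moreover have "norm \<bar>fps_nth (fps_deriv F) n\<bar> = real (Suc n) * \<bar>fps_nth F (Suc n)\<bar>"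
      by (simp add: abs_mult del: of_nat_Suc)
    ultimately show "norm \<bar>fps_nth (fps_deriv F) n\<bar> \<le> M / 2 * (real (Suc n) * (1 / 2) ^ n)"
      by (simp add: field_simps del: of_nat_Suc)
  qed
qed

lemma rapid_tail:
  assumes "rapid F"
  shows "rapid (fps_tail F)"
proof -
  obtain M where M: "\<bar>fps_nth F n\<bar> \<le> M * (1/2) ^ n" for n using assms by (auto simp: rapid_def)
  have "\<bar>fps_nth (fps_tail F) n\<bar> \<le> M * (1/2) ^ n" for n
  proof -
    have g: "(\<lambda>j. M * (1/2) ^ Suc n * (1/2::real) ^ j) sums (M * (1/2) ^ Suc n * (1 / (1 - 1/2)))"
      by (intro sums_mult geometric_sums) simp
    have le: "\<bar>fps_nth F (Suc n + j)\<bar> \<le> M * (1/2) ^ Suc n * (1/2) ^ j" for j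
      using M[of "Suc n + j"] by (simp add: power_add mult.assoc)
    have s: "summable (\<lambda>j. \<bar>fps_nth F (Suc n + j)\<bar>)"
      by (rule summable_comparison_test'[OF sums_summable[OF g], where N = 0]) (use le in simp)
    have "\<bar>fps_nth (fps_tail F) n\<bar> \<le> (\<Sum>j. \<bar>fps_nth F (Suc n + j)\<bar>)"
      unfolding fps_tail_def using summable_rabs[OF s] by simp
    also have "\<dots> \<le> (\<Sum>j. M * (1/2) ^ Suc n * (1/2) ^ j)"
      by (rule suminf_le[OF le s sums_summable[OF g]])
    also have "\<dots> = M * (1/2) ^ n" using g by (simp add: sums_iff)
    finally show ?thesis .
  qed
  then show ?thesis by (auto simp: rapid_def)
qed

lemma LIMSEQ_bounded:
  fixes f :: "nat \<Rightarrow> real"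
  assumes "f \<longlonglongrightarrow> L"
  obtains C where "\<And>n. \<bar>f n\<bar> \<le> C"
proof -
  have "Bseq f" using assms by (intro convergent_imp_Bseq convergentI)
  then obtain C where "\<forall>n. norm (f n) \<le> C" by (auto simp: Bseq_def)
  then show thesis by (intro that[of C]) simp
qed

lemma rapid_power_fact:
  fixes a :: real
  shows "\<exists>M. \<forall>n. \<bar>a ^ n / fact n\<bar> \<le> M * (1/2) ^ n"
proof -
  have "(\<lambda>n. (2 * \<bar>a\<bar>) ^ n / fact n) \<longlonglongrightarrow> 0"
    using summable_LIMSEQ_zero[OF summable_exp[of "2 * \<bar>a\<bar>"]]
    by (simp only: divide_inverse mult.commute)
  then obtain M where M: "\<bar>(2 * \<bar>a\<bar>) ^ n / fact n\<bar> \<le> M" for n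
    using LIMSEQ_bounded by blast
  have "\<bar>a ^ n / fact n\<bar> \<le> M * (1/2) ^ n" for n
    using M[of n] by (simp add: abs_mult power_abs field_simps power_mult_distrib)
  then show ?thesis by blast
qed

section \<open>The dominant pole of the series of blob lists\<close>

definition rho :: real where
  "rho = (SOME x. 0 < x \<and> x * exp x = 1)"

lemma rho: "0 < rho" "rho * exp rho = 1"
proof -
  have "\<exists>x\<ge>0. x \<le> 1 \<and> x * exp x = (1::real)"
    by (rule IVT') (auto intro!: continuous_intros)
  then obtain x :: real where x: "0 \<le> x" "x * exp x = 1" by auto
  then have "0 < x" by (cases "x = 0") auto
  then have "0 < x \<and> x * exp x = 1" using x by simp
  then have "0 < rho \<and> rho * exp rho = 1"
    unfolding rho_def by (rule someI)
  then show "0 < rho" "rho * exp rho = 1" by auto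
qed

text \<open>The bound enters three times: it makes the nonconstant coefficients of
  \<open>fps_tail blob_gf\<close> sum to less than 1, it keeps the residue of the caterpillar series
  away from 0, and it lets the masses of large types tend to 0.\<close>

lemma rho_less_1: "rho < 1"
proof (rule ccontr)
  assume "\<not> rho < 1"
  then have "1 \<le> rho" "1 < exp rho" using rho(1) by auto
  then have "1 * 1 < rho * exp rho" by (intro mult_le_less_imp_less) auto
  then show False using rho by simp
qed

text \<open>The rescaled exponential generating function of a single blob, x * exp x at rho * x: on
  n labels there are n choices of the spine vertex, all other labels being its leaves, and n / n! =
  1 / (n - 1)!.\<close>

definition blob_gf :: "real fps" where
  "blob_gf = Abs_fps (\<lambda>n. if n = 0 then 0 else rho ^ n / fact (n - 1))"

lemma blob_gf_0: "fps_nth blob_gf 0 = 0" by (simp add: blob_gf_def)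

lemma blob_gf_eq: "blob_gf = fps_const rho * fps_X * fps_exp rho"
  by (rule fps_ext) (auto simp: blob_gf_def mult.assoc gr0_conv_Suc)

lemma abs_summable_exp: "abs_summable_fps (fps_exp a)" "fps_sum (fps_exp a) = exp a"
proof -
  have "summable (\<lambda>n. \<bar>a ^ n / fact n\<bar>)"
    using summable_exp[of "\<bar>a\<bar>"] by (simp add: field_simps power_abs)
  then show "abs_summable_fps (fps_exp a)" by (simp add: abs_summable_fps_def)
  show "fps_sum (fps_exp a) = exp a"
    using exp_converges[of a] by (simp add: fps_sum_def sums_iff field_simps)
qed

lemma rapid_blob_gf: "rapid blob_gf"
proof -
  obtain M where M: "\<bar>rho ^ n / fact n\<bar> \<le> M * (1/2) ^ n" for n using rapid_power_fact by blast
  have "M \<ge> 0" using M[of 0] by simp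
  have "\<bar>fps_nth blob_gf n\<bar> \<le> (2 * rho * M) * (1/2) ^ n" for n
  proof (cases n)
    case (Suc m)
    have "\<bar>fps_nth blob_gf n\<bar> = rho * \<bar>rho ^ m / fact m\<bar>"
      using rho by (simp add: Suc blob_gf_def abs_mult)
    also have "\<dots> \<le> rho * (M * (1/2) ^ m)" using M rho by (intro mult_left_mono) auto
    finally show ?thesis by (simp add: Suc)
  qed (use rho \<open>M \<ge> 0\<close> in \<open>simp add: blob_gf_0\<close>)
  then show ?thesis by (auto simp: rapid_def)
qed

lemma abs_summable_blob_gf: "abs_summable_fps blob_gf"
  by (rule rapid_abs_summable[OF rapid_blob_gf])

lemma fps_sum_blob_gf: "fps_sum blob_gf = 1"
  unfolding blob_gf_eq
  by (simp add: abs_summable_fps_mult abs_summable_fps_const abs_summable_fps_X abs_summable_exp rho)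

text \<open>Dividing the pole at 1 out of \<open>1 - blob_gf\<close> leaves \<open>fps_tail blob_gf\<close>, whose coefficients
  after the constant term 1 sum to \<open>rho < 1\<close>; so the geometric series for its inverse converges
  absolutely and no location of complex zeros is needed.\<close>

lemma fps_tail_blob_gf:
  defines "Q \<equiv> fps_tail blob_gf"
  shows "(1 - fps_X) * Q = 1 - blob_gf" "fps_nth Q 0 = 1" "fps_nth Q n \<ge> 0"
    "abs_summable_fps Q" "fps_sum Q = 1 + rho"
proof -
  show mult: "(1 - fps_X) * Q = 1 - blob_gf"
    unfolding Q_def fps_tail_mult[OF abs_summable_blob_gf] fps_sum_blob_gf by simp
  have "fps_nth ((1 - fps_X) * Q) 0 = 1" unfolding mult by (simp add: blob_gf_0)
  then show "fps_nth Q 0 = 1" by simp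
  show "fps_nth Q n \<ge> 0"
    using suminf_nonneg[of "\<lambda>j. fps_nth blob_gf (Suc n + j)"]
      summable_iff_shift[of "fps_nth blob_gf" "Suc n"] abs_summable_fps_imp_summable[OF abs_summable_blob_gf] rho
    by (simp add: Q_def fps_tail_def blob_gf_def add.commute)
  have Q: "rapid Q" unfolding Q_def by (rule rapid_tail[OF rapid_blob_gf])
  show sQ: "abs_summable_fps Q" by (rule rapid_abs_summable[OF Q])
  note sums = abs_summable_fps_mult abs_summable_fps_add abs_summable_fps_diff abs_summable_fps_const
    abs_summable_fps_X abs_summable_exp abs_summable_fps_1
  \<comment> \<open>A form of l'Hopital's rule: differentiating the factorisation and evaluating at
    1 kills the term with factor 1 - x and leaves Q(1) equal to the derivative of
    \<open>blob_gf\<close> at 1, which is rho * exp rho * (1 + rho) = 1 + rho.\<close>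
  have "fps_deriv ((1 - fps_X) * Q) = fps_deriv (1 - blob_gf)" by (simp add: mult)
  then have "Q = (1 - fps_X) * fps_deriv Q + fps_deriv blob_gf"
    by (simp add: algebra_simps)
  moreover have "fps_sum ((1 - fps_X) * fps_deriv Q) = 0"
    by (simp add: sums rapid_deriv_abs_summable[OF Q])
  moreover have "abs_summable_fps ((1 - fps_X) * fps_deriv Q)"
    by (simp add: sums rapid_deriv_abs_summable[OF Q])
  moreover have "fps_sum (fps_deriv blob_gf) = 1 + rho"
    unfolding blob_gf_eq using rho
    by (simp add: sums algebra_simps)
  moreover have "abs_summable_fps (fps_deriv blob_gf)"
    by (rule rapid_deriv_abs_summable[OF rapid_blob_gf])
  ultimately show "fps_sum Q = 1 + rho"
    by (metis abs_summable_fps_add(2) add_0)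
qed

text \<open>The equation says V = 1 / (1 - \<open>blob_gf\<close>) = 1 / ((1 - x) * Q). Its residue
  is 1 / Q(1) = 1 / (1 + rho), and the rest is T / ((1 + rho) * Q) with T = (Q(1) - Q) / (1 - x);
  both T and 1 / Q are absolutely summable.\<close>

lemma inverse_1_minus_blob_gf:
  assumes V: "V = 1 + blob_gf * V"
  shows "\<exists>W. abs_summable_fps W \<and> V = fps_const (1 / (1 + rho)) * fps_ones + W"
proof -
  define Q where "Q = fps_tail blob_gf"
  note Q = fps_tail_blob_gf[folded Q_def]
  define G where "G = inverse Q"
  have QG: "Q * G = 1" unfolding G_def by (rule inverse_mult_eq_1') (simp add: Q)
  have G: "abs_summable_fps G"
  proof -
    have nn: "\<bar>fps_nth (Q - 1) n\<bar> = fps_nth (Q - 1) n" for n using Q(2) Q(3)[of n] by (cases n) auto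
    have "(\<Sum>n. fps_nth (Q - 1) n) = rho"
      using abs_summable_fps_diff(2)[OF Q(4) abs_summable_fps_1(1)] Q(5)
      by (simp only: fps_sum_def[symmetric] abs_summable_fps_1)
    then have "abs_summable_fps (inverse (1 + (Q - 1)))"
      using rho_less_1 Q abs_summable_fps_diff(1)[OF Q(4) abs_summable_fps_1(1)]
      by (intro abs_summable_fps_inverse) (simp_all only: nn, auto)
    then show ?thesis by (simp add: G_def)
  qed
  have V': "V = fps_ones * G"
  proof -
    have "(1 - blob_gf) * V = 1" using V by (simp add: algebra_simps)
    then have "V * ((1 - fps_X) * Q) = 1" unfolding Q(1) by (simp add: mult.commute)
    then have "fps_ones * G = fps_ones * G * (V * ((1 - fps_X) * Q))" by simp
    also have "\<dots> = V * ((1 - fps_X) * fps_ones) * (Q * G)" by (simp only: ac_simps)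
    finally show ?thesis by (simp add: fps_ones_mult QG)
  qed
  define T where "T = fps_tail Q"
  have T: "(1 - fps_X) * T = fps_const (1 + rho) - Q"
    using fps_tail_mult[OF Q(4)] by (simp add: T_def Q(5))
  have "((1 - fps_X) * T) * G = fps_const (1 + rho) * G - 1"
    unfolding T using QG by (simp add: left_diff_distrib)
  then have "fps_ones * (((1 - fps_X) * T) * G) = fps_ones * (fps_const (1 + rho) * G - 1)"
    by (rule arg_cong)
  also have "\<dots> = fps_const (1 + rho) * V - fps_ones"
    unfolding V' right_diff_distrib mult_1_right by (simp only: ac_simps)
  finally have "fps_ones * (((1 - fps_X) * T) * G) = fps_const (1 + rho) * V - fps_ones" .
  moreover have "fps_ones * (((1 - fps_X) * T) * G) = ((1 - fps_X) * fps_ones) * (T * G)"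
    by (simp only: ac_simps)
  then have "fps_ones * (((1 - fps_X) * T) * G) = T * G" by (simp add: fps_ones_mult)
  ultimately have tg: "T * G = fps_const (1 + rho) * V - fps_ones" by (simp only:)
  have *: "fps_const (1 + rho) * V = fps_ones + T * G" unfolding tg by simp
  have c: "fps_const (1 / (1 + rho)) * fps_const (1 + rho) = 1"
    using rho by simp
  have "V = (fps_const (1 / (1 + rho)) * fps_const (1 + rho)) * V"
    unfolding c by (rule mult_1_left[symmetric])
  also have "\<dots> = fps_const (1 / (1 + rho)) * (fps_const (1 + rho) * V)"
    by (rule mult.assoc)
  also have "\<dots> = fps_const (1 / (1 + rho)) * fps_ones + fps_const (1 / (1 + rho)) * (T * G)"
    unfolding * by (simp add: distrib_left)
  finally have "V = fps_const (1 / (1 + rho)) * fps_ones + fps_const (1 / (1 + rho)) * (T * G)" .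
  moreover have "abs_summable_fps (fps_const (1 / (1 + rho)) * (T * G))"
    unfolding T_def Q_def
    by (intro abs_summable_fps_mult abs_summable_fps_const G rapid_abs_summable rapid_tail rapid_blob_gf)
  ultimately show ?thesis by blast
qed

section \<open>Smooth sequences\<close>

definition smooth_seq :: "(nat \<Rightarrow> real) \<Rightarrow> bool" where
  "smooth_seq h \<longleftrightarrow> (\<forall>n. h n > 0) \<and> (\<lambda>n. h n / h (Suc n)) \<longlonglongrightarrow> 1 \<and> (\<exists>B. \<forall>m n. m \<le> n \<longrightarrow> h m \<le> B * h n)"

lemma smooth_seq_shift:
  assumes "smooth_seq h"
  shows "(\<lambda>n. h n / h (n + i)) \<longlonglongrightarrow> 1"
proof (induction i)
  case 0
  have "h n / h (n + 0) = 1" for n using assms[unfolded smooth_seq_def] by (metis add_0_right divide_self less_irrefl)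
  then show ?case by simp
next
  case (Suc i)
  have 1: "(\<lambda>n. h (n + i) / h (Suc (n + i))) \<longlonglongrightarrow> 1"
    using assms LIMSEQ_ignore_initial_segment[of "\<lambda>n. h n / h (Suc n)" 1 i] by (simp add: smooth_seq_def)
  have "h n \<noteq> 0" for n using assms[unfolded smooth_seq_def] by (metis less_irrefl)
  then show ?case using tendsto_mult[OF Suc 1] by simp
qed

text \<open>Tannery's theorem: convergence of the ratios of \<open>h\<close> gives the limit of each
  term, and the comparison of earlier with later values bounds term i by a constant times the
  absolute value of coefficient i. Allowing any \<open>g\<close> comparable to \<open>h\<close>, not
  only \<open>h\<close> itself, lets the lemma be iterated when components are removed one by
  one.\<close>

lemma smooth_seq_convolution:
  fixes g h :: "nat \<Rightarrow> real"
  assumes h: "smooth_seq h" and a: "abs_summable_fps a" and g: "(\<lambda>n. g n / h n) \<longlonglongrightarrow> L"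
  shows "(\<lambda>n. (\<Sum>i\<le>n. fps_nth a i * g (n - i)) / h n) \<longlonglongrightarrow> L * fps_sum a"
proof -
  obtain B where B: "m \<le> n \<Longrightarrow> h m \<le> B * h n" for m n using h by (auto simp: smooth_seq_def)
  have pos: "h n > 0" for n using h by (simp add: smooth_seq_def)
  have "1 * h 0 \<le> B * h 0" using B[of 0 0] by simp
  then have "B \<ge> 1" using pos[of 0] by (simp only: mult_le_cancel_right_pos)
  obtain C where C: "\<bar>g n / h n\<bar> \<le> C" for n
    using LIMSEQ_bounded[OF g] by blast
  have gC: "\<bar>g n\<bar> \<le> C * h n" for n using C[of n] pos[of n] by (simp add: field_simps)
  have "C \<ge> 0" using C[of 0] by linarith
  define f where "f = (\<lambda>i n. if i \<le> n then fps_nth a i * g (n - i) / h n else 0)"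
  have lim: "(\<lambda>n. f i n) \<longlonglongrightarrow> fps_nth a i * L" for i
  proof (rule LIMSEQ_offset[of _ i])
    have "(\<lambda>n. fps_nth a i * ((g n / h n) * (h n / h (n + i)))) \<longlonglongrightarrow> fps_nth a i * (L * 1)"
      by (intro tendsto_intros g smooth_seq_shift[OF h])
    moreover have "fps_nth a i * ((g n / h n) * (h n / h (n + i))) = f i (n + i)" for n
      using pos[of n] by (simp add: f_def)
    ultimately show "(\<lambda>n. f i (n + i)) \<longlonglongrightarrow> fps_nth a i * L" by simp
  qed
  have bound: "norm (f i n) \<le> \<bar>fps_nth a i\<bar> * (B * C)" for i n
  proof (cases "i \<le> n")
    case True
    have "\<bar>g (n - i)\<bar> \<le> C * h (n - i)" by (rule gC)
    also have "\<dots> \<le> C * (B * h n)" using \<open>C \<ge> 0\<close> by (intro mult_left_mono B) auto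
    finally have "\<bar>g (n - i)\<bar> / h n \<le> B * C" using pos[of n] by (simp add: field_simps)
    then have "\<bar>fps_nth a i\<bar> * (\<bar>g (n - i)\<bar> / h n) \<le> \<bar>fps_nth a i\<bar> * (B * C)"
      by (intro mult_left_mono) auto
    then show ?thesis using True pos[of n] by (simp add: f_def abs_mult)
  next
    case False
    then show ?thesis using \<open>C \<ge> 0\<close> \<open>B \<ge> 1\<close> by (simp add: f_def)
  qed
  have M: "summable (\<lambda>i. \<bar>fps_nth a i\<bar> * (B * C))"
    using a by (intro summable_mult2) (simp add: abs_summable_fps_def)
  have "(\<lambda>n. \<Sum>i. f i n) \<longlonglongrightarrow> (\<Sum>i. fps_nth a i * L)"
    using tannerys_theorem[OF lim always_eventually M] bound by simp
  moreover have "(\<Sum>i. f i n) = (\<Sum>i\<le>n. fps_nth a i * g (n - i)) / h n" for n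
  proof -
    have "(\<Sum>i. f i n) = (\<Sum>i\<le>n. f i n)" by (rule suminf_finite) (auto simp: f_def)
    then show ?thesis by (simp add: f_def sum_divide_distrib)
  qed
  moreover have "(\<Sum>i. fps_nth a i * L) = L * fps_sum a"
    using suminf_mult2[OF abs_summable_fps_imp_summable[OF a], of L] by (simp add: fps_sum_def mult.commute)
  ultimately show ?thesis by simp
qed

text \<open>The series is exp (c * x / (1 - x)), whose coefficients grow like exp (2 * sqrt (c * n))
  up to powers of n. Its differential equation gives a three-term recurrence; from it the
  coefficients are seen to increase from index 1 on, with relative increments of order 1 / sqrt
  n.\<close>

lemma smooth_seq_Exp_pole:
  assumes c: "c > 0"
  defines "e \<equiv> fps_nth (fps_Exp (fps_const c * (fps_ones - 1)))"
  shows "smooth_seq e"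
proof -
  define B where "B = fps_const c * (fps_ones - 1)"
  have B: "fps_nth B n = (if n = 0 then 0 else c)" for n by (simp add: B_def fps_ones_def)
  have e0: "e 0 = 1" by (simp add: e_def fps_Exp_0)
  have sum: "real n * e n = (\<Sum>k\<le>n. real k * fps_nth B k * e (n - k))" for n
    unfolding e_def B_def[symmetric] by (rule fps_Exp_nth_recurrence) (simp add: B)
  have e1: "e 1 = c" using sum[of 1] by (simp add: B e0)
  have pos: "e n > 0" for n
  proof (induction n rule: less_induct)
    case (less n)
    show ?case
    proof (cases n)
      case (Suc m)
      have "0 < (\<Sum>k\<le>n. real k * fps_nth B k * e (n - k))"
      proof (rule sum_pos2[of _ 1])
        show "0 < real 1 * fps_nth B 1 * e (n - 1)" using less[of m] c by (simp add: Suc B)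
        show "0 \<le> real k * fps_nth B k * e (n - k)" if "k \<in> {..n}" for k
          using less[of "n - k"] c by (cases "k = 0") (auto simp: B Suc intro!: mult_nonneg_nonneg less_imp_le)
      qed (auto simp: Suc)
      then have "0 < real n * e n" by (simp only: sum)
      then show ?thesis by (simp add: Suc zero_less_mult_iff)
    qed (simp add: e0)
  qed
  have rev: "real n * e n = c * (\<Sum>j<n. real (n - j) * e j)" for n
  proof -
    have "(\<Sum>k\<le>n. real k * fps_nth B k * e (n - k)) = (\<Sum>k\<in>{1..n}. c * (real k * e (n - k)))"
      by (rule sum.mono_neutral_cong_right) (auto simp: B)
    also have "\<dots> = (\<Sum>j<n. c * (real (n - j) * e j))"
      by (rule sum.reindex_bij_witness[of _ "\<lambda>j. n - j" "\<lambda>k. n - k"]) auto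
    finally show ?thesis using sum[of n] by (simp add: sum_distrib_left)
  qed
  have step: "real (Suc n) * e (Suc n) = real n * e n + c * (\<Sum>j<Suc n. e j)" for n
  proof -
    have "(\<Sum>j<Suc n. real (Suc n - j) * e j) = (\<Sum>j<Suc n. real (n - j) * e j + e j)"
      by (rule sum.cong) (auto simp: Suc_diff_le algebra_simps)
    also have "\<dots> = (\<Sum>j<n. real (n - j) * e j) + (\<Sum>j<Suc n. e j)"
      by (simp add: sum.distrib)
    finally show ?thesis using rev[of "Suc n"] rev[of n] by (simp add: algebra_simps)
  qed
  \<comment> \<open>Differencing \<open>step\<close> once more removes the partial sum; written in
    the increments of \<open>e\<close>, the recurrence has only nonnegative coefficients, so
    increments stay nonnegative.\<close>
  have rec: "real (n + 2) * (e (n + 2) - e (n + 1)) = real n * (e (n + 1) - e n) + c * e (n + 1)" for n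
    using step[of n] step[of "Suc n"] by (simp add: algebra_simps)
  have mono: "e (n + 2) - e (n + 1) \<ge> 0" for n
  proof (induction n)
    case 0
    have "2 * (e (0 + 2) - e (0 + 1)) = c * e (0 + 1)" using rec[of 0] by simp
    moreover have "0 < c * e (0 + 1)" by (intro mult_pos_pos c pos)
    ultimately have "0 < 2 * (e (0 + 2) - e (0 + 1))" by (simp only:)
    then show ?case by (simp only: zero_less_mult_iff) auto
  next
    case (Suc n)
    have "0 \<le> real (Suc n) * (e (Suc n + 1) - e (Suc n)) + c * e (Suc n + 1)"
      using Suc c pos[of "Suc n + 1"] by (intro add_nonneg_nonneg mult_nonneg_nonneg) auto
    then show ?case unfolding rec[of "Suc n", symmetric] by (simp add: zero_le_mult_iff)
  qed
  \<comment> \<open>Relative increments start at index 1: \<open>e 0\<close> is 1 and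
    \<open>e 1\<close> is c, so the very first step goes down when c < 1.\<close>
  define x where "x = (\<lambda>n. e (n + 2) / e (n + 1) - 1)"
  have x0: "x n \<ge> 0" for n using mono[of n] pos[of "n + 1"] by (simp add: x_def field_simps)
  have xrec: "real (n + 3) * x (Suc n) = real (n + 1) * (x n / (1 + x n)) + c" for n
  proof -
    have 1: "x n / (1 + x n) = (e (n + 2) - e (n + 1)) / e (n + 2)"
      using pos[of "n+1"] pos[of "n+2"] by (simp add: x_def field_simps)
    have 2: "x (Suc n) = (e (n + 3) - e (n + 2)) / e (n + 2)"
      using pos[of "n+2"] by (simp add: x_def field_simps numeral_3_eq_3)
    have 3: "real (n + 3) * (e (n + 3) - e (n + 2)) = real (n + 1) * (e (n + 2) - e (n + 1)) + c * e (n + 2)"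
      using rec[of "n + 1"] by (simp add: numeral_3_eq_3 algebra_simps)
    have "real (n + 3) * x (Suc n) = (real (n + 1) * (e (n + 2) - e (n + 1)) + c * e (n + 2)) / e (n + 2)"
      unfolding 2 times_divide_eq_right 3 ..
    also have "\<dots> = real (n + 1) * (x n / (1 + x n)) + c"
      unfolding 1 using pos[of "n+2"] by (simp add: add_divide_distrib)
    finally show ?thesis .
  qed
  \<comment> \<open>Chosen so that c * (1 + a) <= a * (a - 1/2), the inequality on which the
    induction below closes.\<close>
  define a where "a = c + 2"
  have xle: "x n \<le> a / sqrt (real (n + 2))" for n
  proof (induction n)
    case 0
    have "x 0 = c / 2" using rec[of 0] pos[of 1] by (simp add: x_def field_simps e1 numeral_2_eq_2)
    moreover have "c / 2 \<le> a / sqrt 2"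
    proof -
      have "sqrt 2 \<le> 2" by (rule real_le_lsqrt) auto
      then have "a / 2 \<le> a / sqrt 2" using c by (intro divide_left_mono) (auto simp: a_def)
      then show ?thesis by (simp add: a_def)
    qed
    ultimately show ?case by (simp only: add_0 of_nat_numeral)
  next
    case (Suc n)
    define s t where "s = sqrt (real (n + 2))" and "t = sqrt (real (n + 3))"
    have s: "s \<ge> 1" "s * s = real (n + 2)" and t: "t * t = real (n + 3)" by (auto simp: s_def t_def)
    have st: "s \<le> t" "t \<ge> 1" by (auto simp: s_def t_def)
    have a: "a > 2" using c by (simp add: a_def)
    \<comment> \<open>The cost of passing from n + 2 to n + 3 under the root; it accounts for the
      1/2 in a - 1/2.\<close>
    have t1: "t \<le> s + 1 / 2"
    proof (rule power2_le_imp_le)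
      show "t\<^sup>2 \<le> (s + 1 / 2)\<^sup>2" using s t by (simp add: power2_eq_square algebra_simps)
    qed (use s in auto)
    have "x n / (1 + x n) \<le> (a / s) / (1 + a / s)"
    proof -
      have "u / (1 + u) \<le> v / (1 + v)" if "0 \<le> u" "u \<le> v" for u v :: real
        using that by (simp add: field_simps)
      moreover have "x n \<le> a / s" using Suc by (simp add: s_def)
      ultimately show ?thesis using x0[of n] by blast
    qed
    also have "\<dots> = a / (s + a)" using s a by (simp add: field_simps)
    finally have 1: "x n / (1 + x n) \<le> a / (s + a)" .
    have "real (n + 3) * x (Suc n) \<le> real (n + 3) * (a / (s + a)) + c"
      unfolding xrec using 1 x0[of n] s a
      by (intro add_right_mono mult_mono) auto
    also have "\<dots> \<le> real (n + 3) * (a / t)"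
    proof -
      \<comment> \<open>Cleared of denominators, the claim is c * (s + a) * t <= t^2 * a * (s + a -
        t). The left side is at most c * (1 + a) * t^2 since s <= t and t >= 1, the right side at
        least a * (a - 1/2) * t^2.\<close>
      have "c * ((s + a) * t) \<le> c * ((t + a * t) * t)"
        using c st a by (intro mult_left_mono mult_right_mono add_mono) (auto simp: mult_le_cancel_left1)
      also have "\<dots> = c * (1 + a) * (t * t)" by (simp add: algebra_simps)
      also have "\<dots> \<le> a * (a - 1/2) * (t * t)"
        using c by (intro mult_right_mono) (auto simp: a_def algebra_simps)
      also have "\<dots> \<le> a * (s + a - t) * (t * t)"
        using t1 a by (intro mult_right_mono mult_left_mono) auto
      finally have "c * ((s + a) * t) \<le> (t * t) * a * (s + a - t)" by (simp add: algebra_simps)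
      then have "c \<le> (t * t) * a * (s + a - t) / ((s + a) * t)"
        using s st a by (simp add: pos_le_divide_eq)
      also have "\<dots> = (t * t) * (a / t) - (t * t) * (a / (s + a))"
      proof -
        have frac: "q * a * (u - v) / (u * v) = q * (a / v) - q * (a / u)" if "u \<noteq> 0" "v \<noteq> 0" for u v q :: real
          using that by (simp add: field_simps)
        show ?thesis by (rule frac) (use s st a in auto)
      qed
      finally show ?thesis using t by simp
    qed
    finally have "x (Suc n) \<le> a / t" by (rule mult_left_le_imp_le) simp
    moreover have "real (n + 3) = real (Suc n + 2)" by simp
    ultimately show ?case unfolding t_def by (simp only:)
  qed
  have "(\<lambda>n. a / sqrt (real (n + 2))) \<longlonglongrightarrow> 0"
    by real_asymp
  then have "x \<longlonglongrightarrow> 0"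
    by (rule tendsto_sandwich[rotated 2, OF tendsto_const]) (use x0 xle in auto)
  then have "(\<lambda>n. 1 / (1 + x n)) \<longlonglongrightarrow> 1 / (1 + 0)"
    by (intro tendsto_intros) auto
  moreover have "1 / (1 + x n) = e (n + 1) / e (Suc (n + 1))" for n by (simp add: x_def)
  ultimately have "(\<lambda>n. e n / e (Suc n)) \<longlonglongrightarrow> 1"
    using LIMSEQ_offset[of "\<lambda>n. e n / e (Suc n)" 1 1] by simp
  moreover have "\<exists>B. \<forall>m n. m \<le> n \<longrightarrow> e m \<le> B * e n"
  proof (intro exI allI impI)
    fix m n :: nat assume mn: "m \<le> n"
    have up: "e (m + 1) \<le> e (n + 1)" if "m \<le> n" for m n
      using that by (rule lift_Suc_mono_le[of "\<lambda>n. e (n + 1)", rotated]) (use mono in auto)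
    \<comment> \<open>The summand 1 covers the increasing part from index 1 on; 1 / c covers index
      0, where \<open>e 0\<close> is 1 / c times \<open>e 1\<close>.\<close>
    show "e m \<le> (1 + 1 / c) * e n"
    proof (cases m)
      case 0
      show ?thesis
      proof (cases n)
        case (Suc k)
        have "c \<le> e n" using up[of 0 k] e1 Suc by simp
        moreover have "0 < c * e n" by (intro mult_pos_pos c pos)
        ultimately have "c \<le> e n + c * e n" by linarith
        then show ?thesis using c by (simp add: 0 e0 field_simps)
      qed (use c 0 e0 in simp)
    next
      case (Suc j)
      then obtain k where k: "n = k + 1" "j \<le> k" using mn by (cases n) auto
      have "e m \<le> 1 * e n" using up[OF k(2)] Suc k by simp
      also have "\<dots> \<le> (1 + 1 / c) * e n" using c pos[of n] by (intro mult_right_mono) auto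
      finally show ?thesis .
    qed
  qed
  ultimately show ?thesis using pos by (auto simp: smooth_seq_def)
qed

lemma smooth_seq_asymp:
  assumes e: "smooth_seq e" and h: "\<And>n. h n > 0" and lim: "(\<lambda>n. h n / e n) \<longlonglongrightarrow> K" and K: "K > 0"
  shows "smooth_seq h"
proof -
  have e0: "e n > 0" for n using e by (simp add: smooth_seq_def)
  obtain B where B: "m \<le> n \<Longrightarrow> e m \<le> B * e n" for m n using e by (auto simp: smooth_seq_def)
  have lim': "(\<lambda>n. e n / h n) \<longlonglongrightarrow> 1 / K"
    using tendsto_divide[OF tendsto_const[of 1] lim] K by simp
  have "(\<lambda>n. (h n / e n) * (e n / e (Suc n)) * (e (Suc n) / h (Suc n))) \<longlonglongrightarrow> K * 1 * (1 / K)"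
    using e lim LIMSEQ_Suc[OF lim'] by (intro tendsto_mult) (auto simp: smooth_seq_def)
  moreover have "e n \<noteq> 0" for n using e0 by (metis less_irrefl)
  ultimately have "(\<lambda>n. h n / h (Suc n)) \<longlonglongrightarrow> 1" using K by simp
  moreover obtain C where C: "\<bar>h n / e n\<bar> \<le> C" for n
    using LIMSEQ_bounded[OF lim] by blast
  obtain D where D: "\<bar>e n / h n\<bar> \<le> D" for n
    using LIMSEQ_bounded[OF lim'] by blast
  have CD: "C \<ge> 0" "D \<ge> 0" using C[of 0] D[of 0] by linarith+
  have B0: "B \<ge> 0"
  proof -
    have "0 \<le> B * e 0" using B[of 0 0] e0[of 0] by linarith
    then show ?thesis using e0[of 0] by (simp add: zero_le_mult_iff)
  qed
  have "h m \<le> (C * B * D) * h n" if "m \<le> n" for m n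
  proof -
    have "h m \<le> C * e m" using C[of m] h[of m] e0[of m] by (simp add: field_simps)
    also have "\<dots> \<le> C * (B * e n)" using CD by (intro mult_left_mono B that)
    also have "\<dots> \<le> C * (B * (D * h n))"
      using D[of n] h[of n] e0[of n] CD B0 by (intro mult_left_mono) (auto simp: field_simps)
    finally show ?thesis by (simp add: mult.assoc)
  qed
  ultimately show ?thesis using h unfolding smooth_seq_def by blast
qed

text \<open>The exponential of the sum is a product: the coefficients are asymptotic to those of the
  pure pole, multiplied by the value at 1 of the exponential of the regular part.\<close>

lemma smooth_seq_Exp:
  assumes c: "c > 0" and A: "abs_summable_fps A" and C: "C = fps_const c * fps_ones + A" and C0: "fps_nth C 0 = 0"
    and pos: "\<And>n. fps_nth (fps_Exp C) n > 0"
  shows "smooth_seq (fps_nth (fps_Exp C))"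
proof -
  define E where "E = fps_const c * (fps_ones - 1)"
  \<comment> \<open>The constant c moves from the pole to the regular part, so that both summands
    have constant term 0 and can be exponentiated separately.\<close>
  define A' where "A' = A + fps_const c"
  have A': "abs_summable_fps A'" unfolding A'_def by (intro abs_summable_fps_add A abs_summable_fps_const)
  have CE: "C = A' + E" unfolding C A'_def E_def by (simp add: algebra_simps)
  have E0: "fps_nth E 0 = 0" by (simp add: E_def fps_ones_def)
  then have A0: "fps_nth A' 0 = 0" using C0 CE by simp
  have e: "smooth_seq (fps_nth (fps_Exp E))" unfolding E_def by (rule smooth_seq_Exp_pole[OF c])
  have e0: "fps_nth (fps_Exp E) n > 0" for n using e by (simp add: smooth_seq_def)
  have "(\<lambda>n. (\<Sum>i\<le>n. fps_nth (fps_Exp A') i * fps_nth (fps_Exp E) (n - i)) / fps_nth (fps_Exp E) n)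
    \<longlonglongrightarrow> 1 * fps_sum (fps_Exp A')"
    using e0 by (intro smooth_seq_convolution[OF e] fps_Exp_abs_summable[OF A0 A']) (simp add: less_imp_neq[symmetric])
  then have "(\<lambda>n. fps_nth (fps_Exp C) n / fps_nth (fps_Exp E) n) \<longlonglongrightarrow> exp (fps_sum A')"
    unfolding CE fps_Exp_add[OF A0 E0] fps_mult_nth_atMost by (simp add: fps_Exp_abs_summable[OF A0 A'])
  then show ?thesis by (rule smooth_seq_asymp[OF e pos]) simp
qed

section \<open>Ehrenfeucht-Fraisse games on unions of components\<close>

primrec quantifier_rank :: "fo \<Rightarrow> nat" where
  "quantifier_rank (Eq x y) = 0"
| "quantifier_rank (Adj x y) = 0"
| "quantifier_rank (Neg \<phi>) = quantifier_rank \<phi>"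
| "quantifier_rank (And \<phi> \<psi>) = max (quantifier_rank \<phi>) (quantifier_rank \<psi>)"
| "quantifier_rank (Or \<phi> \<psi>) = max (quantifier_rank \<phi>) (quantifier_rank \<psi>)"
| "quantifier_rank (Imp \<phi> \<psi>) = max (quantifier_rank \<phi>) (quantifier_rank \<psi>)"
| "quantifier_rank (All x \<phi>) = Suc (quantifier_rank \<phi>)"
| "quantifier_rank (Ex x \<phi>) = Suc (quantifier_rank \<phi>)"

definition partial_iso :: "'a pair_pre_digraph \<Rightarrow> 'b pair_pre_digraph \<Rightarrow> ('a \<times> 'b) set \<Rightarrow> bool" where
  "partial_iso G H R \<longleftrightarrow> (\<forall>u v u' v'. (u, v) \<in> R \<longrightarrow> (u', v') \<in> R \<longrightarrow>
     (u = u' \<longleftrightarrow> v = v') \<and> ((u, u') \<in> parcs G \<longleftrightarrow> (v, v') \<in> parcs H))"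

text \<open>Duplicator wins the \<open>k\<close>-round Ehrenfeucht-Fraisse game from the position \<open>R\<close>.\<close>

primrec ef :: "nat \<Rightarrow> 'a pair_pre_digraph \<Rightarrow> 'b pair_pre_digraph \<Rightarrow> ('a \<times> 'b) set \<Rightarrow> bool" where
  "ef 0 G H R \<longleftrightarrow> partial_iso G H R"
| "ef (Suc k) G H R \<longleftrightarrow> partial_iso G H R \<and>
     (\<forall>x\<in>pverts G. \<exists>y\<in>pverts H. ef k G H (insert (x, y) R)) \<and>
     (\<forall>y\<in>pverts H. \<exists>x\<in>pverts G. ef k G H (insert (x, y) R))"

lemma ef_partial_iso: "ef k G H R \<Longrightarrow> partial_iso G H R"
  by (cases k) auto

lemma ef_Suc_imp: "ef (Suc k) G H R \<Longrightarrow> ef k G H R"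
proof (induction k arbitrary: R)
  case (Suc k)
  have "\<exists>y\<in>pverts H. ef k G H (insert (x, y) R)" if "x \<in> pverts G" for x
    using Suc.prems that Suc.IH by (metis ef.simps(2))
  moreover have "\<exists>x\<in>pverts G. ef k G H (insert (x, y) R)" if "y \<in> pverts H" for y
    using Suc.prems that Suc.IH by (metis ef.simps(2))
  ultimately show ?case using ef_partial_iso[OF Suc.prems] by simp
qed auto

lemma ef_le: "ef k G H R \<Longrightarrow> j \<le> k \<Longrightarrow> ef j G H R"
proof (induction k)
  case (Suc k)
  show ?case
  proof (cases "j = Suc k")
    case False
    then show ?thesis using Suc.IH ef_Suc_imp[OF Suc.prems(1)] Suc.prems(2) by simp
  qed (use Suc.prems in simp)
qed simp

lemma partial_iso_converse: "partial_iso H G (R\<inverse>) \<longleftrightarrow> partial_iso G H R"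
  unfolding partial_iso_def by auto

lemma ef_converse: "ef k H G (R\<inverse>) \<longleftrightarrow> ef k G H R"
proof (induction k arbitrary: R)
  case (Suc k)
  have "insert (y, x) (R\<inverse>) = (insert (x, y) R)\<inverse>" for x y by auto
  then show ?case by (auto simp: partial_iso_converse Suc.IH)
qed (simp add: partial_iso_converse)

text \<open>Positions are relations rather than tuples, so rebinding a variable adds a pair to
  \<open>R\<close> and never withdraws one; only the pairs of current values of free variables have
  to lie in \<open>R\<close>.\<close>

lemma ef_sat:
  assumes "ef k G H R" "quantifier_rank \<phi> \<le> k" "\<And>x. x \<in> fv \<phi> \<Longrightarrow> (e x, e' x) \<in> R"
  shows "sat G e \<phi> \<longleftrightarrow> sat H e' \<phi>"
  using assms
proof (induction \<phi> arbitrary: k R e e')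
  case (Eq x y)
  then have "(e x, e' x) \<in> R" "(e y, e' y) \<in> R" by auto
  then show ?case using ef_partial_iso[OF Eq.prems(1)] unfolding partial_iso_def sat.simps by blast
next
  case (Adj x y)
  then have "(e x, e' x) \<in> R" "(e y, e' y) \<in> R" by auto
  then show ?case using ef_partial_iso[OF Adj.prems(1)] unfolding partial_iso_def sat.simps by blast
next
  case (Neg \<phi>)
  have "sat G e \<phi> = sat H e' \<phi>" using Neg.prems by (intro Neg.IH) auto
  then show ?case by simp
next
  case (And \<phi> \<psi>)
  have "sat G e \<phi> = sat H e' \<phi>" using And.prems by (intro And.IH(1)) auto
  moreover have "sat G e \<psi> = sat H e' \<psi>" using And.prems by (intro And.IH(2)) auto
  ultimately show ?case by simp
next
  case (Or \<phi> \<psi>)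
  have "sat G e \<phi> = sat H e' \<phi>" using Or.prems by (intro Or.IH(1)) auto
  moreover have "sat G e \<psi> = sat H e' \<psi>" using Or.prems by (intro Or.IH(2)) auto
  ultimately show ?case by simp
next
  case (Imp \<phi> \<psi>)
  have "sat G e \<phi> = sat H e' \<phi>" using Imp.prems by (intro Imp.IH(1)) auto
  moreover have "sat G e \<psi> = sat H e' \<psi>" using Imp.prems by (intro Imp.IH(2)) auto
  ultimately show ?case by simp
next
  case (All x \<phi>)
  then obtain j where k: "k = Suc j" "quantifier_rank \<phi> \<le> j" by (cases k) auto
  have step: "sat G (e(x := u)) \<phi> \<longleftrightarrow> sat H (e'(x := v)) \<phi>" if "ef j G H (insert (u, v) R)" for u v
    using that k(2) All.prems(3) by (intro All.IH) auto
  have "\<exists>v\<in>pverts H. ef j G H (insert (u, v) R)" if "u \<in> pverts G" for u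
    using All.prems(1) that unfolding k(1) by simp
  moreover have "\<exists>u\<in>pverts G. ef j G H (insert (u, v) R)" if "v \<in> pverts H" for v
    using All.prems(1) that unfolding k(1) by simp
  ultimately show ?case using step unfolding sat.simps by blast
next
  case (Ex x \<phi>)
  then obtain j where k: "k = Suc j" "quantifier_rank \<phi> \<le> j" by (cases k) auto
  have step: "sat G (e(x := u)) \<phi> \<longleftrightarrow> sat H (e'(x := v)) \<phi>" if "ef j G H (insert (u, v) R)" for u v
    using that k(2) Ex.prems(3) by (intro Ex.IH) auto
  have "\<exists>v\<in>pverts H. ef j G H (insert (u, v) R)" if "u \<in> pverts G" for u
    using Ex.prems(1) that unfolding k(1) by simp
  moreover have "\<exists>u\<in>pverts G. ef j G H (insert (u, v) R)" if "v \<in> pverts H" for v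
    using Ex.prems(1) that unfolding k(1) by simp
  ultimately show ?case using step unfolding sat.simps by blast
qed

section \<open>Rank types of tuples\<close>

definition atomic_diagram :: "'a pair_pre_digraph \<Rightarrow> 'a list \<Rightarrow> nat set" where
  "atomic_diagram G as =
     {prod_encode (0, prod_encode (i, j)) | i j. i < length as \<and> j < length as \<and> as ! i = as ! j} \<union>
     {prod_encode (1, prod_encode (i, j)) | i j. i < length as \<and> j < length as \<and> (as ! i, as ! j) \<in> parcs G}"

text \<open>The Hintikka type of a tuple at depth \<open>k\<close>, without formulas. Coding it as a
  natural number makes types of graphs over different vertex types comparable and keeps the
  recursion within one type.\<close>

primrec rank_type :: "nat \<Rightarrow> 'a pair_pre_digraph \<Rightarrow> 'a list \<Rightarrow> nat" where
  "rank_type 0 G as = set_encode (atomic_diagram G as)"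
| "rank_type (Suc k) G as = prod_encode (set_encode (atomic_diagram G as),
     set_encode ((\<lambda>v. rank_type k G (as @ [v])) ` pverts G))"

lemma atomic_diagram_subset:
  "atomic_diagram G as \<subseteq> (\<lambda>(b, i, j). prod_encode (b, prod_encode (i, j))) ` ({0, 1} \<times> {..<length as} \<times> {..<length as})"
  by (auto simp: atomic_diagram_def image_iff)

lemma finite_atomic_diagram: "finite (atomic_diagram G as)"
  by (rule finite_subset[OF atomic_diagram_subset]) auto

lemma atomic_diagram_partial_iso:
  assumes "atomic_diagram G as = atomic_diagram H bs" "length as = length bs"
  shows "partial_iso G H (set (zip as bs))"
proof -
  have 1: "as ! i = as ! j \<longleftrightarrow> bs ! i = bs ! j" if "i < length as" "j < length as" for i j
  proof -
    have "as ! i = as ! j \<longleftrightarrow> prod_encode (0, prod_encode (i, j)) \<in> atomic_diagram G as"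
      using that by (auto simp: atomic_diagram_def)
    also have "\<dots> \<longleftrightarrow> bs ! i = bs ! j"
      unfolding assms(1) using that assms(2) by (auto simp: atomic_diagram_def)
    finally show ?thesis .
  qed
  have 2: "(as ! i, as ! j) \<in> parcs G \<longleftrightarrow> (bs ! i, bs ! j) \<in> parcs H" if "i < length as" "j < length as" for i j
  proof -
    have "(as ! i, as ! j) \<in> parcs G \<longleftrightarrow> prod_encode (1, prod_encode (i, j)) \<in> atomic_diagram G as"
      using that by (auto simp: atomic_diagram_def)
    also have "\<dots> \<longleftrightarrow> (bs ! i, bs ! j) \<in> parcs H"
      unfolding assms(1) using that assms(2) by (auto simp: atomic_diagram_def)
    finally show ?thesis .
  qed
  show ?thesis unfolding partial_iso_def using 1 2 assms(2) by (auto simp: set_zip)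
qed

text \<open>A type of depth \<open>Suc k\<close> consists of a diagram, a subset of a finite set
  depending on \<open>l\<close> only, and a set of types of depth \<open>k\<close> of tuples one
  longer; hence the induction for all lengths at once.\<close>

lemma finite_rank_types: "finite {rank_type k G as | (G :: 'a pair_pre_digraph) as. length as = l}"
proof (induction k arbitrary: l)
  case 0
  have "{rank_type 0 G as | (G :: 'a pair_pre_digraph) as. length as = l} \<subseteq>
    set_encode ` Pow ((\<lambda>(b, i, j). prod_encode (b, prod_encode (i, j))) ` ({0, 1} \<times> {..<l} \<times> {..<l}))"
    using atomic_diagram_subset by fastforce
  then show ?case by (rule finite_subset) auto
next
  case (Suc k)
  let ?D = "set_encode ` Pow ((\<lambda>(b, i, j). prod_encode (b, prod_encode (i, j))) ` ({0, 1} \<times> {..<l} \<times> {..<l}))"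
  let ?T = "{rank_type k G as | (G :: 'a pair_pre_digraph) as. length as = Suc l}"
  have "{rank_type (Suc k) G as | (G :: 'a pair_pre_digraph) as. length as = l} \<subseteq>
    prod_encode ` (?D \<times> set_encode ` Pow ?T)"
  proof
    fix t assume "t \<in> {rank_type (Suc k) G as | (G :: 'a pair_pre_digraph) as. length as = l}"
    then obtain G :: "'a pair_pre_digraph" and as where t: "t = rank_type (Suc k) G as" "length as = l" by auto
    have "set_encode (atomic_diagram G as) \<in> ?D" using atomic_diagram_subset[of G as] t(2) by auto
    moreover have "(\<lambda>v. rank_type k G (as @ [v])) ` pverts G \<in> Pow ?T"
      using t(2) by (force simp del: rank_type.simps)
    ultimately show "t \<in> prod_encode ` (?D \<times> set_encode ` Pow ?T)" unfolding t(1) by auto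
  qed
  then show ?case by (rule finite_subset) (use Suc in auto)
qed

text \<open>Equal codes give equal sets of types of one-point extensions, so Duplicator answers with
  a vertex of the same type. Decoding relies on \<open>set_encode\<close> being injective on finite
  sets.\<close>

lemma rank_type_ef:
  assumes "rank_type k G as = rank_type k H bs" "length as = length bs" "finite (pverts G)" "finite (pverts H)"
  shows "ef k G H (set (zip as bs))"
  using assms
proof (induction k arbitrary: as bs)
  case 0
  then have "atomic_diagram G as = atomic_diagram H bs"
    by (intro inj_onD[OF inj_on_set_encode]) (auto simp: finite_atomic_diagram)
  then show ?case using atomic_diagram_partial_iso 0 by simp
next
  case (Suc k)
  have eq: "(\<lambda>v. rank_type k G (as @ [v])) ` pverts G = (\<lambda>v. rank_type k H (bs @ [v])) ` pverts H"
    using Suc.prems by (intro inj_onD[OF inj_on_set_encode]) auto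
  have "atomic_diagram G as = atomic_diagram H bs"
    using Suc.prems by (intro inj_onD[OF inj_on_set_encode]) (auto simp: finite_atomic_diagram)
  then have "partial_iso G H (set (zip as bs))" by (rule atomic_diagram_partial_iso) fact
  moreover have step: "ef k G H (insert (x, y) (set (zip as bs)))"
    if "rank_type k G (as @ [x]) = rank_type k H (bs @ [y])" for x y
    using Suc.IH[OF that] Suc.prems by simp
  have "\<exists>y\<in>pverts H. ef k G H (insert (x, y) (set (zip as bs)))" if "x \<in> pverts G" for x
  proof -
    have "rank_type k G (as @ [x]) \<in> (\<lambda>v. rank_type k H (bs @ [v])) ` pverts H" using that eq by blast
    then show ?thesis using step by auto
  qed
  moreover have "\<exists>x\<in>pverts G. ef k G H (insert (x, y) (set (zip as bs)))" if "y \<in> pverts H" for y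
  proof -
    have "rank_type k H (bs @ [y]) \<in> (\<lambda>v. rank_type k G (as @ [v])) ` pverts G" using that eq by blast
    then obtain x where x: "x \<in> pverts G" "rank_type k G (as @ [x]) = rank_type k H (bs @ [y])" by auto
    show ?thesis using step[OF x(2)] x(1) by blast
  qed
  ultimately show ?case by simp
qed

section \<open>Composing games over parts without arcs between them\<close>

definition restrict_graph :: "'a pair_pre_digraph \<Rightarrow> 'a set \<Rightarrow> 'a pair_pre_digraph" where
  "restrict_graph G S = \<lparr>pverts = S, parcs = parcs G \<inter> S \<times> S\<rparr>"

lemma restrict_graph_simps [simp]:
  "pverts (restrict_graph G S) = S" "parcs (restrict_graph G S) = parcs G \<inter> S \<times> S"
  by (auto simp: restrict_graph_def)

definition splits :: "'a pair_pre_digraph \<Rightarrow> 'a set set \<Rightarrow> bool" where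
  "splits G \<C> \<longleftrightarrow> finite \<C> \<and> \<Union> \<C> = pverts G \<and> disjoint \<C> \<and>
     (\<forall>(u, v)\<in>parcs G. \<exists>S\<in>\<C>. u \<in> S \<and> v \<in> S)"

lemma splits_unique:
  assumes "splits G \<C>" "S \<in> \<C>" "T \<in> \<C>" "x \<in> S" "x \<in> T"
  shows "S = T"
proof (rule ccontr)
  assume "S \<noteq> T"
  then have "S \<inter> T = {}" using assms(1-3) disjointD unfolding splits_def by metis
  then show False using assms(4,5) by blast
qed

lemma splits_arc:
  assumes "splits G \<C>" "S \<in> \<C>" "T \<in> \<C>" "u \<in> S" "v \<in> T" "(u, v) \<in> parcs G"
  shows "S = T"
proof -
  obtain U where "U \<in> \<C>" "u \<in> U" "v \<in> U" using assms(1,6) unfolding splits_def by blast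
  then show ?thesis using splits_unique[OF assms(1)] assms by metis
qed

text \<open>The invariant of the game on unions of components: \<open>M\<close> matches the components played in so
  far, and the unmatched components of each type agree in number up to the number of rounds left.\<close>

definition matching :: "nat \<Rightarrow> 'a pair_pre_digraph \<Rightarrow> 'b pair_pre_digraph \<Rightarrow> 'a set set \<Rightarrow> 'b set set \<Rightarrow>
    ('a set \<Rightarrow> 'c) \<Rightarrow> ('b set \<Rightarrow> 'c) \<Rightarrow> ('a \<times> 'b) set \<Rightarrow> ('a set \<times> 'b set) set \<Rightarrow> bool" where
  "matching k G H \<C> \<D> t t' R M \<longleftrightarrow> M \<subseteq> \<C> \<times> \<D> \<and>
     (\<forall>S S' T T'. (S, S') \<in> M \<longrightarrow> (T, T') \<in> M \<longrightarrow> (S = T \<longleftrightarrow> S' = T')) \<and>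
     (\<forall>u v. (u, v) \<in> R \<longrightarrow> (\<exists>S S'. (S, S') \<in> M \<and> u \<in> S \<and> v \<in> S')) \<and>
     (\<forall>S S'. (S, S') \<in> M \<longrightarrow> ef k (restrict_graph G S) (restrict_graph H S') (R \<inter> S \<times> S')) \<and>
     (\<forall>\<tau>. min k (card {S \<in> \<C> - Domain M. t S = \<tau>}) = min k (card {S \<in> \<D> - Range M. t' S = \<tau>}))"

lemma matchingI:
  assumes "M \<subseteq> \<C> \<times> \<D>"
    and "\<And>S S' T T'. (S, S') \<in> M \<Longrightarrow> (T, T') \<in> M \<Longrightarrow> (S = T \<longleftrightarrow> S' = T')"
    and "\<And>u v. (u, v) \<in> R \<Longrightarrow> \<exists>S S'. (S, S') \<in> M \<and> u \<in> S \<and> v \<in> S'"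
    and "\<And>S S'. (S, S') \<in> M \<Longrightarrow> ef k (restrict_graph G S) (restrict_graph H S') (R \<inter> S \<times> S')"
    and "\<And>\<tau>. min k (card {S \<in> \<C> - Domain M. t S = \<tau>}) = min k (card {S \<in> \<D> - Range M. t' S = \<tau>})"
  shows "matching k G H \<C> \<D> t t' R M"
  unfolding matching_def by (intro conjI allI impI) (fact assms(1), (erule assms(2), assumption),
    (erule assms(3)), (erule assms(4)), (rule assms(5)))

lemma matchingD:
  assumes "matching k G H \<C> \<D> t t' R M"
  shows "M \<subseteq> \<C> \<times> \<D>"
    and "\<And>S S' T T'. (S, S') \<in> M \<Longrightarrow> (T, T') \<in> M \<Longrightarrow> (S = T \<longleftrightarrow> S' = T')"
    and "\<And>u v. (u, v) \<in> R \<Longrightarrow> \<exists>S S'. (S, S') \<in> M \<and> u \<in> S \<and> v \<in> S'"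
    and "\<And>S S'. (S, S') \<in> M \<Longrightarrow> ef k (restrict_graph G S) (restrict_graph H S') (R \<inter> S \<times> S')"
    and "\<And>\<tau>. min k (card {S \<in> \<C> - Domain M. t S = \<tau>}) = min k (card {S \<in> \<D> - Range M. t' S = \<tau>})"
  using assms[unfolded matching_def, THEN conjunct1]
    assms[unfolded matching_def, THEN conjunct2, THEN conjunct1, rule_format]
    assms[unfolded matching_def, THEN conjunct2, THEN conjunct2, THEN conjunct1, rule_format]
    assms[unfolded matching_def, THEN conjunct2, THEN conjunct2, THEN conjunct2, THEN conjunct1, rule_format]
    assms[unfolded matching_def, THEN conjunct2, THEN conjunct2, THEN conjunct2, THEN conjunct2, rule_format]
  by -

lemma matching_converse:
  assumes "matching k G H \<C> \<D> t t' R M"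
  shows "matching k H G \<D> \<C> t' t (R\<inverse>) (M\<inverse>)"
proof (rule matchingI)
  note m = matchingD[OF assms]
  show "M\<inverse> \<subseteq> \<D> \<times> \<C>" using m(1) by auto
  show "S = T \<longleftrightarrow> S' = T'" if "(S, S') \<in> M\<inverse>" "(T, T') \<in> M\<inverse>" for S S' T T'
    using m(2) that by simp
  show "\<exists>S S'. (S, S') \<in> M\<inverse> \<and> u \<in> S \<and> v \<in> S'" if "(u, v) \<in> R\<inverse>" for u v
    using m(3)[of v u] that by auto
  show "ef k (restrict_graph H S) (restrict_graph G S') (R\<inverse> \<inter> S \<times> S')" if "(S, S') \<in> M\<inverse>" for S S'
  proof -
    have "R\<inverse> \<inter> S \<times> S' = (R \<inter> S' \<times> S)\<inverse>" by auto
    then show ?thesis using m(4)[of S' S] that by (simp add: ef_converse)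
  qed
  show "min k (card {S \<in> \<D> - Domain (M\<inverse>). t' S = \<tau>}) = min k (card {S \<in> \<C> - Range (M\<inverse>). t S = \<tau>})" for \<tau>
    using m(5) by simp
qed

lemma matching_partial_iso:
  assumes G: "splits G \<C>" and H: "splits H \<D>" and m: "matching k G H \<C> \<D> t t' R M"
  shows "partial_iso G H R"
  unfolding partial_iso_def
proof (intro allI impI)
  fix u v u' v' assume R: "(u, v) \<in> R" "(u', v') \<in> R"
  obtain S T where ST: "(S, T) \<in> M" "u \<in> S" "v \<in> T" using matchingD(3)[OF m R(1)] by blast
  obtain S' T' where ST': "(S', T') \<in> M" "u' \<in> S'" "v' \<in> T'" using matchingD(3)[OF m R(2)] by blast
  have C: "S \<in> \<C>" "S' \<in> \<C>" "T \<in> \<D>" "T' \<in> \<D>" using matchingD(1)[OF m] ST ST' by auto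
  have eq: "S = S' \<longleftrightarrow> T = T'" using matchingD(2)[OF m ST(1) ST'(1)] .
  show "(u = u' \<longleftrightarrow> v = v') \<and> ((u, u') \<in> parcs G \<longleftrightarrow> (v, v') \<in> parcs H)"
  proof (cases "S = S'")
    case True
    have "partial_iso (restrict_graph G S) (restrict_graph H T) (R \<inter> S \<times> T)"
      using ef_partial_iso[OF matchingD(4)[OF m ST(1)]] .
    moreover have "(u, v) \<in> R \<inter> S \<times> T" "(u', v') \<in> R \<inter> S \<times> T" using R ST ST' True eq by auto
    ultimately have "(u = u' \<longleftrightarrow> v = v') \<and>
        ((u, u') \<in> parcs (restrict_graph G S) \<longleftrightarrow> (v, v') \<in> parcs (restrict_graph H T))"
      unfolding partial_iso_def by blast
    then show ?thesis using ST ST' True eq by simp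
  next
    case False
    then have "T \<noteq> T'" using eq by simp
    have "u \<noteq> u'" using splits_unique[OF G C(1,2) ST(2)] ST'(2) False by auto
    moreover have "v \<noteq> v'" using splits_unique[OF H C(3,4) ST(3)] ST'(3) \<open>T \<noteq> T'\<close> by auto
    moreover have "(u, u') \<notin> parcs G" using splits_arc[OF G C(1,2) ST(2) ST'(2)] False by auto
    moreover have "(v, v') \<notin> parcs H" using splits_arc[OF H C(3,4) ST(3) ST'(3)] \<open>T \<noteq> T'\<close> by auto
    ultimately show ?thesis by simp
  qed
qed

lemma min_Suc_eq_imp: "min (Suc k) a = min (Suc k) b \<Longrightarrow> min k a = min k (b :: nat)"
  by (auto simp: min_def split: if_splits)

text \<open>If the chosen vertex lies in a matched component, Duplicator follows the game inside
  that pair; otherwise an unmatched component of the same type is opened on the other side. All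
  other pairs merely have one round fewer left.\<close>

lemma matching_forth:
  assumes G: "splits G \<C>" and H: "splits H \<D>" and m: "matching (Suc k) G H \<C> \<D> t t' R M"
    and K: "Suc k \<le> K"
    and t: "\<And>S S'. S \<in> \<C> \<Longrightarrow> S' \<in> \<D> \<Longrightarrow> t S = t' S' \<Longrightarrow> ef K (restrict_graph G S) (restrict_graph H S') {}"
    and x: "x \<in> pverts G"
  shows "\<exists>y\<in>pverts H. \<exists>M'. matching k G H \<C> \<D> t t' (insert (x, y) R) M'"
proof -
  note M = matchingD(1)[OF m] and M1 = matchingD(2)[OF m] and M2 = matchingD(3)[OF m]
    and M3 = matchingD(4)[OF m] and M4 = matchingD(5)[OF m]
  have fin: "finite \<C>" "finite \<D>" using G H unfolding splits_def by auto
  obtain S where S: "S \<in> \<C>" "x \<in> S" using x G unfolding splits_def by auto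
  show ?thesis
  proof (cases "S \<in> Domain M")
    case True
    then obtain S' where S': "(S, S') \<in> M" by auto
    then have SD: "S' \<in> \<D>" using M by auto
    obtain y where y: "y \<in> S'" "ef k (restrict_graph G S) (restrict_graph H S') (insert (x, y) (R \<inter> S \<times> S'))"
      using M3[OF S'] S(2) by auto
    have yH: "y \<in> pverts H" using y(1) SD H unfolding splits_def by auto
    have "ef k (restrict_graph G T) (restrict_graph H T') (insert (x, y) R \<inter> T \<times> T')" if T: "(T, T') \<in> M" for T T'
    proof (cases "T = S")
      case True
      then have "T' = S'" using M1[OF T S'] by simp
      then have "insert (x, y) R \<inter> T \<times> T' = insert (x, y) (R \<inter> S \<times> S')" using True S(2) y(1) by auto
      then show ?thesis using y(2) True \<open>T' = S'\<close> by simp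
    next
      case False
      then have "x \<notin> T" using splits_unique[OF G _ S(1)] S(2) T M by blast
      then have "insert (x, y) R \<inter> T \<times> T' = R \<inter> T \<times> T'" by auto
      then show ?thesis using ef_Suc_imp[OF M3[OF T]] by simp
    qed
    moreover have "\<exists>T T'. (T, T') \<in> M \<and> u \<in> T \<and> v \<in> T'" if "(u, v) \<in> insert (x, y) R" for u v
      using that M2 S' S(2) y(1) by blast
    ultimately have "matching k G H \<C> \<D> t t' (insert (x, y) R) M"
      using M M1 min_Suc_eq_imp[OF M4] by (intro matchingI) auto
    then show ?thesis using yH by blast
  next
    case False
    have "S \<in> {T \<in> \<C> - Domain M. t T = t S}" using S False by auto
    then have "card {T \<in> \<C> - Domain M. t T = t S} > 0" using fin by (auto simp: card_gt_0_iff)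
    \<comment> \<open>The threshold \<open>Suc k\<close> is positive, so truncated counts still tell
      whether an unmatched component of this type exists.\<close>
    then have "card {T \<in> \<D> - Range M. t' T = t S} > 0" using M4[of "t S"] by (auto simp: min_def split: if_splits)
    then obtain S' where S': "S' \<in> \<D>" "S' \<notin> Range M" "t' S' = t S" by (auto simp: card_gt_0_iff)
    have "ef (Suc k) (restrict_graph G S) (restrict_graph H S') {}"
      using ef_le[OF t[OF S(1) S'(1)] K] S'(3) by simp
    then obtain y where y: "y \<in> S'" "ef k (restrict_graph G S) (restrict_graph H S') {(x, y)}"
      using S(2) by auto
    have yH: "y \<in> pverts H" using y(1) S'(1) H unfolding splits_def by auto
    define M' where "M' = insert (S, S') M"
    have RS: "R \<inter> S \<times> S' = {}"
    proof (rule ccontr)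
      assume "R \<inter> S \<times> S' \<noteq> {}"
      then obtain u v where "(u, v) \<in> R" "u \<in> S" by auto
      then obtain T T' where "(T, T') \<in> M" "u \<in> T" using M2 by blast
      then show False using splits_unique[OF G S(1), of T u] \<open>u \<in> S\<close> False M by blast
    qed
    have "ef k (restrict_graph G T) (restrict_graph H T') (insert (x, y) R \<inter> T \<times> T')" if T: "(T, T') \<in> M'" for T T'
    proof (cases "(T, T') = (S, S')")
      case True
      then have "insert (x, y) R \<inter> T \<times> T' = {(x, y)}" using RS S(2) y(1) by auto
      then show ?thesis using y(2) True by simp
    next
      case ne: False
      then have TM: "(T, T') \<in> M" using T unfolding M'_def by blast
      then have "T \<noteq> S" using False by auto
      then have "x \<notin> T" using splits_unique[OF G _ S(1)] S(2) TM M by blast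
      then have "insert (x, y) R \<inter> T \<times> T' = R \<inter> T \<times> T'" by auto
      then show ?thesis using ef_Suc_imp[OF M3[OF TM]] by simp
    qed
    moreover have "min k (card {T \<in> \<C> - Domain M'. t T = \<tau>}) = min k (card {T \<in> \<D> - Range M'. t' T = \<tau>})" for \<tau>
    proof (cases "\<tau> = t S")
      case True
      have "{T \<in> \<C> - Domain M'. t T = \<tau>} = {T \<in> \<C> - Domain M. t T = \<tau>} - {S}" by (auto simp: M'_def)
      then have 1: "card {T \<in> \<C> - Domain M'. t T = \<tau>} = card {T \<in> \<C> - Domain M. t T = \<tau>} - 1"
        using S False True by (simp add: card_Diff_singleton)
      have "{T \<in> \<D> - Range M'. t' T = \<tau>} = {T \<in> \<D> - Range M. t' T = \<tau>} - {S'}" by (auto simp: M'_def)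
      then have 2: "card {T \<in> \<D> - Range M'. t' T = \<tau>} = card {T \<in> \<D> - Range M. t' T = \<tau>} - 1"
        using S' True by (simp add: card_Diff_singleton)
      \<comment> \<open>Each side loses one component of this type while the threshold drops from
        \<open>Suc k\<close> to \<open>k\<close>, so the truncated counts still agree.\<close>
      show ?thesis unfolding 1 2 using M4[of \<tau>] by (auto simp: min_def split: if_splits)
    next
      case False
      then have "{T \<in> \<C> - Domain M'. t T = \<tau>} = {T \<in> \<C> - Domain M. t T = \<tau>}"
        "{T \<in> \<D> - Range M'. t' T = \<tau>} = {T \<in> \<D> - Range M. t' T = \<tau>}"
        using S'(3) by (auto simp: M'_def)
      then show ?thesis using min_Suc_eq_imp[OF M4] by simp
    qed
    moreover have "M' \<subseteq> \<C> \<times> \<D>" using M S S' by (auto simp: M'_def)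
    moreover have "U = T \<longleftrightarrow> U' = T'" if "(U, U') \<in> M'" "(T, T') \<in> M'" for U U' T T'
    proof -
      have ne: "U \<noteq> S \<and> U' \<noteq> S'" if "(U, U') \<in> M" for U U' using False S'(2) that by auto
      have "(U = S \<and> U' = S') \<or> (U, U') \<in> M" "(T = S \<and> T' = S') \<or> (T, T') \<in> M"
        using that by (auto simp: M'_def)
      then show ?thesis using ne[of U U'] ne[of T T'] M1[of U U' T T'] by metis
    qed
    moreover have "\<exists>T T'. (T, T') \<in> M' \<and> u \<in> T \<and> v \<in> T'" if "(u, v) \<in> insert (x, y) R" for u v
    proof (cases "(u, v) = (x, y)")
      case True
      then have "(S, S') \<in> M' \<and> u \<in> S \<and> v \<in> S'" using S(2) y(1) by (simp add: M'_def)
      then show ?thesis by metis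
    next
      case False
      then obtain T T' where "(T, T') \<in> M" "u \<in> T" "v \<in> T'" using M2[of u v] \<open>(u, v) \<in> _\<close> by auto
      then have "(T, T') \<in> M' \<and> u \<in> T \<and> v \<in> T'" by (simp add: M'_def)
      then show ?thesis by metis
    qed
    ultimately have "matching k G H \<C> \<D> t t' (insert (x, y) R) M'"
      by (intro matchingI)
    then show ?thesis using yH by blast
  qed
qed

lemma matching_ef:
  assumes G: "splits G \<C>" and H: "splits H \<D>" and m: "matching k G H \<C> \<D> t t' R M"
    and K: "k \<le> K"
    and t: "\<And>S S'. S \<in> \<C> \<Longrightarrow> S' \<in> \<D> \<Longrightarrow> t S = t' S' \<Longrightarrow> ef K (restrict_graph G S) (restrict_graph H S') {}"
  shows "ef k G H R"
  using m K
proof (induction k arbitrary: R M)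
  case 0
  then show ?case using matching_partial_iso[OF G H] by simp
next
  case (Suc k)
  have t': "ef K (restrict_graph H S') (restrict_graph G S) {}" if "S' \<in> \<D>" "S \<in> \<C>" "t' S' = t S" for S S'
    using t[OF that(2,1)] that(3) ef_converse[of K "restrict_graph H S'" "restrict_graph G S" "{}"] by simp
  have "\<exists>y\<in>pverts H. ef k G H (insert (x, y) R)" if "x \<in> pverts G" for x
    using matching_forth[OF G H Suc.prems(1,2) t that] Suc.IH Suc.prems(2) by (meson Suc_leD)
  moreover have "\<exists>x\<in>pverts G. ef k G H (insert (x, y) R)" if yH: "y \<in> pverts H" for y
  proof -
    \<comment> \<open>The answer to a move in \<open>H\<close> is the forth step with the two graphs
      exchanged.\<close>
    obtain x M' where x: "x \<in> pverts G" "matching k H G \<D> \<C> t' t (insert (y, x) (R\<inverse>)) M'"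
      using matching_forth[OF H G matching_converse[OF Suc.prems(1)] Suc.prems(2) t' yH] by blast
    have "(insert (y, x) (R\<inverse>))\<inverse> = insert (x, y) R" by auto
    then have "matching k G H \<C> \<D> t t' (insert (x, y) R) (M'\<inverse>)" using matching_converse[OF x(2)] by simp
    then show ?thesis using Suc.IH Suc.prems(2) x(1) Suc_leD by blast
  qed
  ultimately show ?case using matching_partial_iso[OF G H Suc.prems(1)] by simp
qed

text \<open>\<open>K\<close> plays two roles. Types of depth \<open>K\<close> keep matched
  components equivalent through all rounds, and multiplicities beyond \<open>K\<close> cannot be
  told apart because a round opens at most one new component.\<close>

theorem models_determined_by_component_types:
  assumes G: "splits G \<C>" "finite (pverts G)" and H: "splits H \<D>" "finite (pverts H)"
    and \<phi>: "sentence \<phi>" "quantifier_rank \<phi> \<le> K"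
    and count: "\<And>\<tau>. min K (card {S \<in> \<C>. rank_type K (restrict_graph G S) [] = \<tau>}) =
      min K (card {S \<in> \<D>. rank_type K (restrict_graph H S) [] = \<tau>})"
  shows "models G \<phi> \<longleftrightarrow> models H \<phi>"
proof -
  let ?t = "\<lambda>S. rank_type K (restrict_graph G S) []" and ?t' = "\<lambda>S. rank_type K (restrict_graph H S) []"
  have "matching K G H \<C> \<D> ?t ?t' {} {}"
  proof (rule matchingI)
    show "min K (card {S \<in> \<C> - Domain {}. ?t S = \<tau>}) = min K (card {S \<in> \<D> - Range {}. ?t' S = \<tau>})" for \<tau>
      using count[of \<tau>] by simp
  qed simp_all
  moreover have "ef K (restrict_graph G S) (restrict_graph H S') {}"
    if "S \<in> \<C>" "S' \<in> \<D>" "?t S = ?t' S'" for S S'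
  proof -
    have "S \<subseteq> pverts G" "S' \<subseteq> pverts H" using that(1,2) G(1) H(1) unfolding splits_def by auto
    then have "finite S" "finite S'" using G(2) H(2) by (metis finite_subset)+
    then show ?thesis using rank_type_ef[OF that(3)] by simp
  qed
  ultimately have ef: "ef K G H {}" by (rule matching_ef[OF G(1) H(1) _ order_refl])
  have "sat G e \<phi> \<longleftrightarrow> sat H e' \<phi>" for e e'
    using \<phi> by (intro ef_sat[OF ef]) (auto simp: sentence_def)
  then show ?thesis by (auto simp: models_def)
qed

section \<open>Simple graphs\<close>

definition simple_graph :: "'a pair_pre_digraph \<Rightarrow> bool" where
  "simple_graph G \<longleftrightarrow> finite (pverts G) \<and> parcs G \<subseteq> pverts G \<times> pverts G \<and> sym (parcs G) \<and> irrefl (parcs G)"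

lemma simple_graph_iff: "graph (with_proj G) \<longleftrightarrow> simple_graph G"
proof
  assume "graph (with_proj G)"
  then interpret pair_graph G by (rule pair_graphI_graph)
  have "finite (pverts G)" by (rule pair_finite_verts)
  moreover have "parcs G \<subseteq> pverts G \<times> pverts G" using wellformed' by auto
  moreover have "sym (parcs G)" using arcs_symmetric by (auto intro: symI)
  moreover have "irrefl (parcs G)" using pair_no_loops by (fastforce simp: irrefl_def)
  ultimately show "simple_graph G" by (simp add: simple_graph_def)
next
  assume G: "simple_graph G"
  then have "finite (parcs G)"
    unfolding simple_graph_def by (meson finite_SigmaI finite_subset)
  then interpret pair_graph G
    using G by unfold_locales (auto simp: simple_graph_def symmetric_def irrefl_def)
  show "graph (with_proj G)" by unfold_locales
qed

lemma simple_graph_sym: "simple_graph G \<Longrightarrow> (u, v) \<in> parcs G \<Longrightarrow> (v, u) \<in> parcs G"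
  by (auto simp: simple_graph_def dest: symD)

lemma simple_graph_arc_verts: "simple_graph G \<Longrightarrow> (u, v) \<in> parcs G \<Longrightarrow> u \<in> pverts G \<and> v \<in> pverts G"
  by (auto simp: simple_graph_def)

lemma simple_graph_no_loop: "simple_graph G \<Longrightarrow> (u, u) \<notin> parcs G"
  by (auto simp: simple_graph_def irrefl_def)

text \<open>\<open>reachable\<close> is reflexive on vertices only, whereas the closure of the arc
  relation is reflexive everywhere; starting from a vertex removes the difference.\<close>

lemma simple_graph_reachable_iff:
  assumes "simple_graph G" "u \<in> pverts G"
  shows "u \<rightarrow>\<^sup>*\<^bsub>with_proj G\<^esub> v \<longleftrightarrow> (u, v) \<in> (parcs G)\<^sup>*"
proof
  assume "u \<rightarrow>\<^sup>*\<^bsub>with_proj G\<^esub> v"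
  then have "(u, v) \<in> (arcs_ends (with_proj G))\<^sup>*" by (rule reachable_rtranclI)
  then show "(u, v) \<in> (parcs G)\<^sup>*" by simp
next
  have "graph (with_proj G)" using assms(1) by (simp add: simple_graph_iff)
  then have wf: "wf_digraph (with_proj G)" by (rule graph_imp_wf)
  show "u \<rightarrow>\<^sup>*\<^bsub>with_proj G\<^esub> v" if "(u, v) \<in> (parcs G)\<^sup>*"
    using that
  proof (induction rule: rtrancl_induct)
    case base
    show ?case using assms(2) by (intro wf_digraph.reachable_refl[OF wf]) simp
  next
    case (step y z)
    have "y \<rightarrow>\<^bsub>with_proj G\<^esub> z" using step(2) by simp
    with step(3) show ?case by (rule wf_digraph.reachable_adj_trans[OF wf])
  qed
qed

lemma connected_iff_rtrancl:
  assumes "simple_graph G"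
  shows "Digraph_Component.connected (with_proj G) \<longleftrightarrow>
    pverts G \<noteq> {} \<and> (\<forall>u\<in>pverts G. \<forall>v\<in>pverts G. (u, v) \<in> (parcs G)\<^sup>*)"
proof -
  have "mk_symmetric (with_proj G) = G"
    by (rule pair_pre_digraph.equality) (use simple_graph_sym[OF assms] in \<open>auto simp: mk_symmetric_def\<close>)
  then show ?thesis
    using simple_graph_reachable_iff[OF assms]
    by (simp add: Digraph_Component.connected_def strongly_connected_def)
qed

lemma set_vwalk_arcs: "set (vwalk_arcs p) = {(p ! i, p ! Suc i) | i. Suc i < length p}"
proof (induction p rule: vwalk_arcs.induct)
  case (3 x y xs)
  have "{((x # y # xs) ! i, (x # y # xs) ! Suc i) | i. Suc i < length (x # y # xs)} =
    insert (x, y) {((y # xs) ! i, (y # xs) ! Suc i) | i. Suc i < length (y # xs)}"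
    (is "?L = insert _ ?R")
  proof (intro equalityI subsetI)
    fix e assume "e \<in> ?L"
    then obtain i where i: "e = ((x # y # xs) ! i, (x # y # xs) ! Suc i)" "Suc i < length (x # y # xs)" by blast
    then show "e \<in> insert (x, y) ?R" by (cases i) auto
  next
    fix e assume "e \<in> insert (x, y) ?R"
    then consider "e = (x, y)" | i where "e = ((y # xs) ! i, (y # xs) ! Suc i)" "Suc i < length (y # xs)" by blast
    then show "e \<in> ?L"
    proof cases
      case 1
      then have "e = ((x # y # xs) ! 0, (x # y # xs) ! Suc 0) \<and> Suc 0 < length (x # y # xs)" by simp
      then show ?thesis by blast
    next
      case (2 i)
      then have "e = ((x # y # xs) ! Suc i, (x # y # xs) ! Suc (Suc i)) \<and> Suc (Suc i) < length (x # y # xs)" by simp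
      then show ?thesis by blast
    qed
  qed
  then show ?case using 3 by simp
qed auto

text \<open>This is what makes peeling possible: a vertex with at most one neighbour on the cycle
  cannot lie on it.\<close>

lemma undirected_cycle_two_neighbours:
  assumes G: "simple_graph G" and q: "undirected_cycle (with_proj G) q" and x: "x \<in> set q"
  obtains y z where "y \<in> set q" "z \<in> set q" "y \<noteq> z" "(x, y) \<in> parcs G" "(x, z) \<in> parcs G"
proof -
  have arcs: "\<And>i. Suc i < length q \<Longrightarrow> (q ! i, q ! Suc i) \<in> parcs G"
    and len: "3 \<le> length q" and closing: "(last q, hd q) \<in> parcs G" and d: "distinct q"
    using q unfolding undirected_cycle_def vpath_def vwalk_def set_vwalk_arcs by auto
  have q0: "hd q = q ! 0" "last q = q ! (length q - 1)"
  proof -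
    have "q \<noteq> []" using len by auto
    then show "hd q = q ! 0" "last q = q ! (length q - 1)" by (auto simp: hd_conv_nth last_conv_nth)
  qed
  obtain i where i: "i < length q" "x = q ! i" using x by (auto simp: in_set_conv_nth)
  \<comment> \<open>\<open>j\<close> and \<open>k\<close> are the cyclic successor and predecessor
    of position \<open>i\<close>; they differ because the cycle has at least three vertices.\<close>
  define j where "j = (if Suc i < length q then Suc i else 0)"
  define k where "k = (if i = 0 then length q - 1 else i - 1)"
  have "(x, q ! j) \<in> parcs G"
  proof (cases "Suc i < length q")
    case True
    then show ?thesis using arcs[of i] i by (simp add: j_def)
  next
    case False
    then have "i = length q - 1" using i by simp
    then show ?thesis using closing q0 i False by (simp add: j_def)
  qed
  moreover have "(q ! k, x) \<in> parcs G"
  proof (cases "i = 0")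
    case True
    then show ?thesis using closing q0 i by (simp add: k_def)
  next
    case False
    then show ?thesis using arcs[of "i - 1"] i by (simp add: k_def)
  qed
  moreover have "j < length q" "k < length q" "j \<noteq> k" using i len by (auto simp: j_def k_def)
  moreover from this have "q ! j \<noteq> q ! k" using d by (simp add: nth_eq_iff_index_eq)
  ultimately show thesis
    using that[of "q ! j" "q ! k"] simple_graph_sym[OF G] by simp
qed

section \<open>Caterpillars as lists of blobs\<close>

text \<open>A caterpillar is encoded by the list of the vertices of its path, each with the set of leaves
  attached to it.\<close>

definition blob_set :: "'a \<times> 'a set \<Rightarrow> 'a set" where
  "blob_set b = insert (fst b) (snd b)"

definition blobs_set :: "('a \<times> 'a set) list \<Rightarrow> 'a set" where
  "blobs_set L = (\<Union>b\<in>set L. blob_set b)"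

text \<open>\<open>sorted_wrt\<close> compares positions rather than members, so disjointness also
  forbids a blob, which is never empty, from occurring twice.\<close>

definition wf_blobs :: "('a \<times> 'a set) list \<Rightarrow> bool" where
  "wf_blobs L \<longleftrightarrow> sorted_wrt (\<lambda>b c. blob_set b \<inter> blob_set c = {}) L \<and>
     (\<forall>b\<in>set L. finite (snd b) \<and> fst b \<notin> snd b)"

definition path_arcs :: "'a list \<Rightarrow> 'a rel" where
  "path_arcs p = set (vwalk_arcs p) \<union> (set (vwalk_arcs p))\<inverse>"

definition blob_graph :: "('a \<times> 'a set) list \<Rightarrow> 'a pair_pre_digraph" where
  "blob_graph L = \<lparr>pverts = blobs_set L,
     parcs = path_arcs (map fst L) \<union> (\<Union>b\<in>set L. {fst b} \<times> snd b \<union> snd b \<times> {fst b})\<rparr>"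

lemma blob_set_Pair [simp]: "blob_set (v, A) = insert v A"
  by (simp add: blob_set_def)

lemma blobs_set_simps [simp]: "blobs_set [] = {}" "blobs_set (b # L) = blob_set b \<union> blobs_set L"
  "blobs_set (L @ M) = blobs_set L \<union> blobs_set M" "blobs_set (rev L) = blobs_set L"
  by (auto simp: blobs_set_def)

lemma pverts_blob_graph [simp]: "pverts (blob_graph L) = blobs_set L"
  by (simp add: blob_graph_def)

lemma wf_blobs_Nil [simp]: "wf_blobs []" by (simp add: wf_blobs_def)

lemma wf_blobs_Cons [simp]:
  "wf_blobs ((v, A) # L) \<longleftrightarrow> finite A \<and> v \<notin> A \<and> insert v A \<inter> blobs_set L = {} \<and> wf_blobs L"
  by (auto simp: wf_blobs_def blobs_set_def)

lemma wf_blobs_rev: "wf_blobs (rev L) \<longleftrightarrow> wf_blobs L"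
  by (simp add: wf_blobs_def sorted_wrt_rev Int_commute)

lemma path_arcs_simps [simp]: "path_arcs [] = {}" "path_arcs [x] = {}"
  "path_arcs (x # y # xs) = insert (x, y) (insert (y, x) (path_arcs (y # xs)))"
  by (auto simp: path_arcs_def)

lemma path_arcs_subset: "path_arcs p \<subseteq> set p \<times> set p"
  by (induction p rule: vwalk_arcs.induct) auto

lemma path_arcs_append: "path_arcs (p @ x # y # q) = path_arcs (p @ [x]) \<union> {(x, y), (y, x)} \<union> path_arcs (y # q)"
proof (induction p)
  case (Cons a p)
  then show ?case by (cases p) auto
qed auto

lemma path_arcs_rev: "path_arcs (rev p) = path_arcs p"
proof (induction p rule: vwalk_arcs.induct)
  case (3 x y xs)
  have "path_arcs (rev (x # y # xs)) = path_arcs (rev xs @ y # x # [])" by simp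
  also have "\<dots> = path_arcs (rev (y # xs)) \<union> {(y, x), (x, y)}" unfolding path_arcs_append by simp
  finally show ?case using 3 by auto
qed auto

lemma blob_graph_rev: "blob_graph (rev L) = blob_graph L"
  by (simp add: blob_graph_def rev_map[symmetric] path_arcs_rev)

lemma set_map_fst_subset: "set (map fst L) \<subseteq> blobs_set L"
  by (auto simp: blobs_set_def blob_set_def)

lemma parcs_blob_graph_Nil [simp]: "parcs (blob_graph []) = {}"
  by (simp add: blob_graph_def)

lemma parcs_blob_graph_single [simp]: "parcs (blob_graph [(v, A)]) = {v} \<times> A \<union> A \<times> {v}"
  by (simp add: blob_graph_def)

lemma parcs_blob_graph_Cons [simp]:
  "parcs (blob_graph ((v, A) # b # L)) =
     {v} \<times> A \<union> A \<times> {v} \<union> {(v, fst b), (fst b, v)} \<union> parcs (blob_graph (b # L))"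
  by (auto simp: blob_graph_def)

lemma parcs_blob_graph_subset: "parcs (blob_graph L) \<subseteq> blobs_set L \<times> blobs_set L"
proof (rule subrelI)
  fix u w assume "(u, w) \<in> parcs (blob_graph L)"
  then consider "(u, w) \<in> path_arcs (map fst L)"
    | b where "b \<in> set L" "u = fst b" "w \<in> snd b" | b where "b \<in> set L" "w = fst b" "u \<in> snd b"
    unfolding blob_graph_def by auto
  then show "(u, w) \<in> blobs_set L \<times> blobs_set L"
  proof cases
    case 1
    then have "u \<in> set (map fst L)" "w \<in> set (map fst L)" using path_arcs_subset by blast+
    then show ?thesis using set_map_fst_subset[of L] by blast
  qed (auto simp: blobs_set_def blob_set_def)
qed

lemma finite_blobs_set: "wf_blobs L \<Longrightarrow> finite (blobs_set L)"
  by (auto simp: wf_blobs_def blobs_set_def blob_set_def)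

lemma simple_graph_blob_graph:
  assumes "wf_blobs L"
  shows "simple_graph (blob_graph L)"
proof -
  have "sym (parcs (blob_graph L))"
    by (rule symI) (auto simp: blob_graph_def path_arcs_def)
  moreover have "irrefl (parcs (blob_graph L))"
    using assms
  proof (induction L rule: vwalk_arcs.induct)
    case (2 b)
    then show ?case by (cases b) (auto simp: irrefl_def)
  next
    case (3 b c L)
    then show ?case by (cases b; cases c) (auto simp: irrefl_def)
  qed (auto simp: irrefl_def)
  ultimately show ?thesis
    using finite_blobs_set[OF assms] parcs_blob_graph_subset by (simp add: simple_graph_def)
qed

lemma blob_graph_reachable:
  assumes "x \<in> blobs_set (b # L)"
  shows "(fst b, x) \<in> (parcs (blob_graph (b # L)))\<^sup>*"
  using assms
proof (induction L arbitrary: b)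
  case Nil
  then show ?case by (cases b) auto
next
  case (Cons c L)
  obtain v A where b: "b = (v, A)" by (cases b)
  show ?case
  proof (cases "x \<in> blob_set b")
    case True
    then show ?thesis unfolding b by auto
  next
    case False
    then have "(fst c, x) \<in> (parcs (blob_graph (c # L)))\<^sup>*" using Cons.prems by (intro Cons.IH) auto
    then have "(fst c, x) \<in> (parcs (blob_graph (b # c # L)))\<^sup>*"
      by (rule rtrancl_mono[THEN subsetD, rotated]) (auto simp: b)
    moreover have "(fst b, fst c) \<in> parcs (blob_graph (b # c # L))" by (simp add: b)
    ultimately show ?thesis by (rule converse_rtrancl_into_rtrancl[rotated])
  qed
qed

text \<open>Peeling from the front: a leaf of the first blob has a single neighbour and lies on no
  cycle; then the first spine vertex has only the next spine vertex left as a possible neighbour on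
  the cycle; so the cycle lives in the remaining blobs.\<close>

lemma blob_graph_acyclic:
  assumes "wf_blobs L"
  shows "\<not> undirected_cycle (with_proj (blob_graph L)) q"
  using assms
proof (induction L rule: vwalk_arcs.induct)
  case 1
  show ?case by (auto simp: undirected_cycle_def vpath_def vwalk_def)
next
  case (2 b)
  obtain v A where b: "b = (v, A)" by (cases b)
  show ?case
  proof
    assume q: "undirected_cycle (with_proj (blob_graph [b])) q"
    note two = undirected_cycle_two_neighbours[OF simple_graph_blob_graph[OF 2] q]
    have A: "x \<notin> set q" if "x \<in> A" for x
    proof
      assume "x \<in> set q"
      then obtain y z where "y \<noteq> z" "(x, y) \<in> parcs (blob_graph [b])" "(x, z) \<in> parcs (blob_graph [b])"
        by (rule two)
      then show False using 2 that by (auto simp: b)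
    qed
    have x: "hd q \<in> set q" using q by (intro hd_in_set) (auto simp: undirected_cycle_def)
    then obtain y where "y \<in> set q" "(hd q, y) \<in> parcs (blob_graph [b])" by (rule two)
    then show False using A x by (auto simp: b)
  qed
next
  case (3 b c L)
  obtain v A where b: "b = (v, A)" by (cases b)
  let ?G = "blob_graph (b # c # L)" and ?H = "blob_graph (c # L)"
  have c: "fst c \<in> blobs_set (c # L)" by (simp add: blob_set_def)
  have wf: "finite A" "v \<notin> A" "insert v A \<inter> blobs_set (c # L) = {}" "wf_blobs (c # L)"
    using 3(2)[unfolded b wf_blobs_Cons] by blast+
  have sub: "parcs ?H \<subseteq> blobs_set (c # L) \<times> blobs_set (c # L)" by (rule parcs_blob_graph_subset)
  show ?case
  proof
    assume q: "undirected_cycle (with_proj ?G) q"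
    note two = undirected_cycle_two_neighbours[OF simple_graph_blob_graph[OF 3(2)] q]
    have A: "x \<notin> set q" if "x \<in> A" for x
    proof
      assume "x \<in> set q"
      then obtain y z where "y \<noteq> z" "(x, y) \<in> parcs ?G" "(x, z) \<in> parcs ?G" by (rule two)
      moreover have "y = v" if "(x, y) \<in> parcs ?G" for y
        using that \<open>x \<in> A\<close> wf sub c by (auto simp: b)
      ultimately show False by blast
    qed
    have v: "v \<notin> set q"
    proof
      assume "v \<in> set q"
      then obtain y z where yz: "y \<in> set q" "z \<in> set q" "y \<noteq> z" "(v, y) \<in> parcs ?G" "(v, z) \<in> parcs ?G" by (rule two)
      moreover have "y = fst c" if "(v, y) \<in> parcs ?G" "y \<in> set q" for y
        using that A wf sub c by (auto simp: b)
      ultimately show False by blast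
    qed
    have "set q \<subseteq> blobs_set (b # c # L)" using q by (auto simp: undirected_cycle_def vpath_def vwalk_def)
    then have sq: "set q \<subseteq> blobs_set (c # L)" using A v by (auto simp: b)
    have arc: "(x, y) \<in> parcs ?H" if "(x, y) \<in> parcs ?G" "x \<in> set q" "y \<in> set q" for x y
      using that A v by (auto simp: b)
    have vs: "set (vwalk_arcs q) \<subseteq> set q \<times> set q" by (auto simp: set_vwalk_arcs)
    have "undirected_cycle (with_proj ?H) q"
      unfolding undirected_cycle_def vpath_def vwalk_def
    proof (intro conjI)
      have G: "set (vwalk_arcs q) \<subseteq> parcs ?G" "q \<noteq> []" "distinct q" "3 \<le> length q" "(last q, hd q) \<in> parcs ?G"
        using q by (auto simp: undirected_cycle_def vpath_def vwalk_def)
      show "set q \<subseteq> verts (with_proj ?H)" using sq by simp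
      show "set (vwalk_arcs q) \<subseteq> arcs_ends (with_proj ?H)" using G(1) vs arc by auto
      show "q \<noteq> []" "distinct q" "3 \<le> length q" using G by auto
      show "(last q, hd q) \<in> arcs_ends (with_proj ?H)" using G arc by simp
    qed
    then show False using 3(1)[OF wf(4)] by blast
  qed
qed

lemma blob_graph_leaf:
  assumes "wf_blobs L" "b \<in> set L" "x \<in> snd b" "(x, y) \<in> parcs (blob_graph L)"
  shows "y = fst b"
  using assms
proof (induction L rule: vwalk_arcs.induct)
  case (2 c)
  then show ?case by (cases c) auto
next
  case (3 c d L)
  obtain v A where c: "c = (v, A)" by (cases c)
  have sub: "parcs (blob_graph (d # L)) \<subseteq> blobs_set (d # L) \<times> blobs_set (d # L)" by (rule parcs_blob_graph_subset)
  have d: "fst d \<in> blobs_set (d # L)" by (simp add: blob_set_def)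
  have wf: "finite A" "v \<notin> A" "insert v A \<inter> blobs_set (d # L) = {}" "wf_blobs (d # L)"
    using 3(2)[unfolded c wf_blobs_Cons] by blast+
  show ?case
  proof (cases "b = c")
    case True
    then have "x \<in> A" using 3(4) c by simp
    then show ?thesis using 3(5) wf sub d True by (auto simp: c)
  next
    case False
    then have b: "b \<in> set (d # L)" using 3(3) by simp
    then have x: "x \<in> blobs_set (d # L)" using 3(4) by (auto simp: blobs_set_def blob_set_def)
    have "x \<noteq> fst d"
    proof
      assume "x = fst d"
      obtain w B where dd: "d = (w, B)" by (cases d)
      have "b \<noteq> d" using 3(2,4) \<open>x = fst d\<close> by (auto simp: wf_blobs_def)
      then have "b \<in> set L" using b by simp
      then have "x \<in> blobs_set L" using 3(4) by (auto simp: blobs_set_def blob_set_def)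
      then show False using wf(4) \<open>x = fst d\<close> dd by auto
    qed
    then have "(x, y) \<in> parcs (blob_graph (d # L))" using 3(5) x wf by (auto simp: c)
    then show ?thesis using 3(1)[OF wf(4) b 3(4)] by simp
  qed
qed auto

lemma caterpillar_blob_graph:
  assumes "wf_blobs L" "L \<noteq> []"
  shows "caterpillar (with_proj (blob_graph L))"
proof -
  let ?G = "blob_graph L"
  have G: "simple_graph ?G" by (rule simple_graph_blob_graph[OF assms(1)])
  obtain b M where L: "L = b # M" using assms(2) by (cases L) auto
  have "(u, v) \<in> (parcs ?G)\<^sup>*" if "u \<in> blobs_set L" "v \<in> blobs_set L" for u v
  proof -
    have "sym ((parcs ?G)\<^sup>*)" using G by (simp add: simple_graph_def sym_rtrancl)
    then show ?thesis
      using blob_graph_reachable[of u b M] blob_graph_reachable[of v b M] that unfolding L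
      by (meson rtrancl_trans symD)
  qed
  moreover have "blobs_set L \<noteq> {}" by (simp add: L blob_set_def)
  ultimately have "Digraph_Component.connected (with_proj ?G)"
    using connected_iff_rtrancl[OF G] by simp
  then have "undirected_tree (with_proj ?G)"
    using G blob_graph_acyclic[OF assms(1)] by (simp add: undirected_tree_def simple_graph_iff)
  moreover have "vpath (map fst L) (with_proj ?G)"
    unfolding vpath_def vwalk_def
  proof (intro conjI)
    show "set (map fst L) \<subseteq> verts (with_proj ?G)" using set_map_fst_subset by simp
    show "set (vwalk_arcs (map fst L)) \<subseteq> arcs_ends (with_proj ?G)" by (auto simp: blob_graph_def path_arcs_def)
    show "map fst L \<noteq> []" using assms(2) by simp
    show "distinct (map fst L)" using assms(1)
    proof (induction L)
      case (Cons c L)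
      then show ?case using set_map_fst_subset[of L] by (cases c) auto
    qed simp
  qed
  moreover have "out_degree (with_proj ?G) x = 1 \<and> (\<exists>u\<in>set (map fst L). (u, x) \<in> arcs_ends (with_proj ?G))"
    if "x \<in> verts (with_proj ?G) - set (map fst L)" for x
  proof -
    have "x \<in> blobs_set L" using that by simp
    then obtain c where c: "c \<in> set L" "x \<in> blob_set c" unfolding blobs_set_def by blast
    then have "x \<noteq> fst c" using that by auto
    with c have c: "c \<in> set L" "x \<in> snd c" by (auto simp: blob_set_def)
    have arcs: "(x, fst c) \<in> parcs ?G" "(fst c, x) \<in> parcs ?G" using c by (auto simp: blob_graph_def)
    have "e = (x, fst c)" if "e \<in> out_arcs (with_proj ?G) x" for e
    proof -
      have "(x, snd e) \<in> parcs ?G" "fst e = x" using that by (auto simp: out_arcs_def)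
      then show ?thesis using blob_graph_leaf[OF assms(1) c, of "snd e"] by (simp add: prod_eq_iff)
    qed
    moreover have "(x, fst c) \<in> out_arcs (with_proj ?G) x" using arcs by (simp add: out_arcs_def)
    ultimately have "out_arcs (with_proj ?G) x = {(x, fst c)}" by blast
    then show ?thesis using arcs c by (auto simp: out_degree_def)
  qed
  ultimately show ?thesis unfolding caterpillar_def by blast
qed

text \<open>The path from the definition becomes the spine, each vertex paired with its neighbours
  off the path. The leaf sets are disjoint because such neighbours have degree one, and the path has
  no chords because a chord would close a cycle.\<close>

lemma caterpillar_imp_blob_graph:
  assumes "caterpillar (with_proj G)"
  obtains L where "wf_blobs L" "L \<noteq> []" "G = blob_graph L"
proof -
  have tree: "undirected_tree (with_proj G)" using assms by (simp add: caterpillar_def)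
  then have G: "simple_graph G" and acyc: "\<And>q. \<not> undirected_cycle (with_proj G) q"
    by (auto simp: undirected_tree_def simple_graph_iff)
  obtain p where p: "vpath p (with_proj G)"
    and leaf: "\<And>v. v \<in> pverts G - set p \<Longrightarrow> out_degree (with_proj G) v = 1 \<and> (\<exists>u\<in>set p. (u, v) \<in> parcs G)"
    using assms by (auto simp: caterpillar_def)
  have ps: "set p \<subseteq> pverts G" "p \<noteq> []" "distinct p"
    and parc: "\<And>i. Suc i < length p \<Longrightarrow> (p ! i, p ! Suc i) \<in> parcs G"
    using p by (auto simp: vpath_def vwalk_def set_vwalk_arcs)
  define A where "A = (\<lambda>u. {v \<in> pverts G - set p. (u, v) \<in> parcs G})"
  define L where "L = map (\<lambda>u. (u, A u)) p"
  have fin: "finite (A u)" for u using G by (simp add: A_def simple_graph_def)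
  have uniq: "u = w" if v: "v \<in> pverts G - set p" and "(v, u) \<in> parcs G" "(v, w) \<in> parcs G" for u v w
  proof -
    have "card (out_arcs (with_proj G) v) = 1" using leaf[OF v] by (simp add: out_degree_def)
    then obtain e where "out_arcs (with_proj G) v = {e}" by (auto simp: card_1_singleton_iff)
    moreover have "(v, u) \<in> out_arcs (with_proj G) v" "(v, w) \<in> out_arcs (with_proj G) v"
      using that by (auto simp: out_arcs_def)
    ultimately show ?thesis by auto
  qed
  have chord: "Suc i = j" if "i < j" "j < length p" "(p ! i, p ! j) \<in> parcs G" for i j
  proof (rule ccontr)
    assume "Suc i \<noteq> j"
    then have ij: "Suc i < j" using that by simp
    \<comment> \<open>The segment of the path from \<open>i\<close> to \<open>j\<close>, which the
      chord closes to a cycle; non-consecutive ends give it at least three vertices.\<close>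
    define q where "q = take (Suc j - i) (drop i p)"
    have lq: "length q = Suc j - i" using that by (simp add: q_def)
    have nth: "q ! k = p ! (i + k)" if "k < length q" for k using that lq \<open>j < length p\<close> by (simp add: q_def)
    have "q \<noteq> []" using lq ij by auto
    have sq: "set q \<subseteq> set p" unfolding q_def by (rule order.trans[OF set_take_subset set_drop_subset])
    have "undirected_cycle (with_proj G) q"
      unfolding undirected_cycle_def vpath_def vwalk_def
    proof (intro conjI)
      show "set q \<subseteq> verts (with_proj G)" using sq ps by simp
      have "(q ! k, q ! Suc k) \<in> parcs G" if "Suc k < length q" for k
        using nth[of k] nth[of "Suc k"] that parc[of "i + k"] lq \<open>j < length p\<close> by simp
      then show "set (vwalk_arcs q) \<subseteq> arcs_ends (with_proj G)" unfolding set_vwalk_arcs by auto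
      show "q \<noteq> []" by fact
      show "distinct q" using ps by (simp add: q_def)
      show "3 \<le> length q" using lq ij by simp
      have "hd q = p ! i" using \<open>q \<noteq> []\<close> nth[of 0] by (simp add: hd_conv_nth)
      moreover have "last q = p ! j" using \<open>q \<noteq> []\<close> nth[of "length q - 1"] lq that by (simp add: last_conv_nth)
      ultimately show "(last q, hd q) \<in> arcs_ends (with_proj G)"
        using simple_graph_sym[OF G that(3)] by simp
    qed
    then show False using acyc by blast
  qed
  have path: "(u, w) \<in> path_arcs p" if uw: "u \<in> set p" "w \<in> set p" "(u, w) \<in> parcs G" for u w
  proof -
    obtain i j where ij: "i < length p" "u = p ! i" "j < length p" "w = p ! j"
      using uw(1,2) unfolding in_set_conv_nth by blast
    have "i \<noteq> j" using uw(3) simple_graph_no_loop[OF G] ij by auto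
    then consider "i < j" | "j < i" by linarith
    then show ?thesis
    proof cases
      case 1
      then have "Suc i = j" using chord ij uw by simp
      then show ?thesis using ij by (auto simp: path_arcs_def set_vwalk_arcs)
    next
      case 2
      then have "Suc j = i" using chord ij simple_graph_sym[OF G uw(3)] by simp
      then show ?thesis using ij by (auto simp: path_arcs_def set_vwalk_arcs)
    qed
  qed
  have mf: "map fst L = p" by (simp add: L_def comp_def)
  have "sorted_wrt (\<lambda>b c. blob_set b \<inter> blob_set c = {}) L"
    unfolding L_def sorted_wrt_map
  proof (rule sorted_wrt_mono_rel[of _ "(\<noteq>)"])
    show "sorted_wrt (\<noteq>) p" using ps(3) by (induction p) auto
    fix u w assume uw: "u \<in> set p" "w \<in> set p" "u \<noteq> w"
    have "A u \<inter> A w = {}"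
      using uniq[of _ u w] uw(3) simple_graph_sym[OF G] by (auto simp: A_def)
    then show "blob_set (u, A u) \<inter> blob_set (w, A w) = {}" using uw by (auto simp: A_def)
  qed
  then have wf: "wf_blobs L" using fin by (auto simp: wf_blobs_def L_def A_def)
  have V: "blobs_set L = pverts G"
  proof
    show "blobs_set L \<subseteq> pverts G" using ps by (auto simp: blobs_set_def L_def A_def)
    show "pverts G \<subseteq> blobs_set L"
    proof
      fix x assume "x \<in> pverts G"
      then show "x \<in> blobs_set L"
        using leaf[of x] by (cases "x \<in> set p") (auto simp: blobs_set_def L_def A_def)
    qed
  qed
  have E: "parcs (blob_graph L) = parcs G"
  proof (intro equalityI subrelI)
    fix u w assume "(u, w) \<in> parcs (blob_graph L)"
    then consider "(u, w) \<in> path_arcs p" | "w \<in> A u" | "u \<in> A w"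
      unfolding blob_graph_def mf by (auto simp: L_def)
    then show "(u, w) \<in> parcs G"
    proof cases
      case 1
      then show ?thesis using parc simple_graph_sym[OF G] by (auto simp: path_arcs_def set_vwalk_arcs)
    qed (use simple_graph_sym[OF G] in \<open>auto simp: A_def\<close>)
  next
    fix u w assume uw: "(u, w) \<in> parcs G"
    then have V: "u \<in> pverts G" "w \<in> pverts G" using simple_graph_arc_verts[OF G] by auto
    consider "u \<in> set p" "w \<in> set p" | "u \<in> set p" "w \<notin> set p" | "u \<notin> set p" "w \<in> set p" | "u \<notin> set p" "w \<notin> set p"
      by blast
    then show "(u, w) \<in> parcs (blob_graph L)"
    proof cases
      case 1
      then show ?thesis using path uw by (simp add: blob_graph_def mf)
    next
      case 2
      then show ?thesis using uw V by (auto simp: blob_graph_def L_def A_def)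
    next
      case 3
      then show ?thesis using simple_graph_sym[OF G uw] V by (auto simp: blob_graph_def L_def A_def)
    next
      case 4
      \<comment> \<open>The only neighbour of an off-path vertex is on the path, so two off-path
        vertices are never adjacent.\<close>
      obtain v where v: "v \<in> set p" "(v, u) \<in> parcs G" using leaf[of u] V 4 by auto
      have "v = w" using uniq[of u v w] V 4 uw simple_graph_sym[OF G v(2)] by simp
      then show ?thesis using v 4 by simp
    qed
  qed
  have "G = blob_graph L" using V E by (intro pair_pre_digraph.equality) auto
  then show thesis using that wf ps(2) by (simp add: L_def)
qed

section \<open>Relabelling of vertices\<close>

definition map_graph :: "('a \<Rightarrow> 'b) \<Rightarrow> 'a pair_pre_digraph \<Rightarrow> 'b pair_pre_digraph" where
  "map_graph f G = \<lparr>pverts = f ` pverts G, parcs = map_prod f f ` parcs G\<rparr>"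

lemma map_graph_simps [simp]:
  "pverts (map_graph f G) = f ` pverts G" "parcs (map_graph f G) = map_prod f f ` parcs G"
  by (auto simp: map_graph_def)

lemma map_graph_comp: "map_graph f (map_graph g G) = map_graph (f \<circ> g) G"
  by (simp add: map_graph_def image_image map_prod_def comp_def case_prod_unfold)

lemma map_graph_id: "map_graph (\<lambda>x. x) G = G"
  by (simp add: map_graph_def map_prod_def)

lemma path_arcs_map: "path_arcs (map f p) = map_prod f f ` path_arcs p"
  by (induction p rule: vwalk_arcs.induct) auto

lemma map_graph_blob_graph: "map_graph f (blob_graph L) = blob_graph (map (map_prod f (image f)) L)"
proof (rule pair_pre_digraph.equality)
  show "pverts (map_graph f (blob_graph L)) = pverts (blob_graph (map (map_prod f (image f)) L))"
    by (auto simp: blobs_set_def blob_set_def)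
  have "map fst (map (map_prod f (image f)) L) = map f (map fst L)" by simp
  then show "parcs (map_graph f (blob_graph L)) = parcs (blob_graph (map (map_prod f (image f)) L))"
    unfolding blob_graph_def by (simp add: path_arcs_map image_Un image_UN map_prod_image image_comp map_prod.comp)
qed simp

lemma blob_set_map: "blob_set (map_prod f (image f) b) = f ` blob_set b"
  by (simp add: blob_set_def)

lemma wf_blobs_map: "inj f \<Longrightarrow> wf_blobs L \<Longrightarrow> wf_blobs (map (map_prod f (image f)) L)"
  by (auto simp: wf_blobs_def sorted_wrt_map blob_set_map image_Int[symmetric] inj_image_mem_iff)

lemma caterpillar_map_graph:
  assumes "inj f" "caterpillar (with_proj G)"
  shows "caterpillar (with_proj (map_graph f G))"
proof -
  obtain L where "wf_blobs L" "L \<noteq> []" "G = blob_graph L"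
    using caterpillar_imp_blob_graph[OF assms(2)] .
  then show ?thesis
    using caterpillar_blob_graph[of "map (map_prod f (image f)) L"] wf_blobs_map[OF assms(1)]
    by (simp add: map_graph_blob_graph)
qed

definition blob_lists :: "'a set \<Rightarrow> ('a \<times> 'a set) list set" where
  "blob_lists V = {L. wf_blobs L \<and> blobs_set L = V}"

definition caterpillars :: "'a set \<Rightarrow> 'a pair_pre_digraph set" where
  "caterpillars V = {G. pverts G = V \<and> caterpillar (with_proj G)}"

lemma caterpillar_nonempty: "caterpillar (with_proj G) \<Longrightarrow> pverts G \<noteq> {}"
  by (auto simp: caterpillar_def vpath_def vwalk_def)

lemma blob_graph_mem_caterpillars: "L \<in> blob_lists V \<Longrightarrow> V \<noteq> {} \<Longrightarrow> blob_graph L \<in> caterpillars V"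
  using caterpillar_blob_graph[of L] by (cases "L = []") (auto simp: blob_lists_def caterpillars_def)

lemma caterpillarsE:
  assumes "G \<in> caterpillars V"
  obtains L where "L \<in> blob_lists V" "L \<noteq> []" "G = blob_graph L"
proof -
  have "caterpillar (with_proj G)" "pverts G = V" using assms by (auto simp: caterpillars_def)
  obtain L where L: "wf_blobs L" "L \<noteq> []" "G = blob_graph L"
    using caterpillar_imp_blob_graph[OF \<open>caterpillar (with_proj G)\<close>] .
  show thesis by (rule that[of L]) (use L \<open>pverts G = V\<close> in \<open>auto simp: blob_lists_def\<close>)
qed

section \<open>Uniqueness of the encoding up to reversal\<close>

definition branch_vertices :: "'a pair_pre_digraph \<Rightarrow> 'a set" where
  "branch_vertices G = {v. \<exists>a b. a \<noteq> b \<and> (v, a) \<in> parcs G \<and> (v, b) \<in> parcs G}"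

text \<open>With both index sets \<open>{1..}\<close> each end carries a leaf, which is the normal
  form of an encoding; with \<open>{k}\<close> at both ends one gets the test families for the
  zero-one law. At least two blobs are required, so that the two ends are different blobs.\<close>

definition ended_blob_lists :: "nat set \<Rightarrow> nat set \<Rightarrow> 'a set \<Rightarrow> ('a \<times> 'a set) list set" where
  "ended_blob_lists I J V =
     {L \<in> blob_lists V. 2 \<le> length L \<and> card (snd (hd L)) \<in> I \<and> card (snd (last L)) \<in> J}"

lemma distinct_spine: "wf_blobs L \<Longrightarrow> distinct (map fst L)"
proof (induction L)
  case (Cons c L)
  then show ?case using set_map_fst_subset[of L] by (cases c) auto
qed simp

lemma wf_blobs_disjoint:
  assumes "wf_blobs L" "i < length L" "j < length L" "x \<in> blob_set (L ! i)" "x \<in> blob_set (L ! j)"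
  shows "i = j"
proof -
  have *: "blob_set (L ! i) \<inter> blob_set (L ! j) = {}" if "i < j" "j < length L" for i j
    using assms(1) that by (auto simp: wf_blobs_def sorted_wrt_iff_nth_less)
  consider "i < j" | "j < i" | "i = j" by linarith
  then show ?thesis
  proof cases
    case 1
    then show ?thesis using *[of i j] assms by blast
  next
    case 2
    then show ?thesis using *[of j i] assms by blast
  qed
qed

lemma wf_blobs_disjoint':
  assumes "wf_blobs L" "b \<in> set L" "c \<in> set L" "x \<in> blob_set b" "x \<in> blob_set c"
  shows "b = c"
proof -
  obtain i j where "i < length L" "b = L ! i" "j < length L" "c = L ! j"
    using assms(2,3) unfolding in_set_conv_nth by blast
  then show ?thesis using wf_blobs_disjoint[OF assms(1), of i j x] assms(4,5) by simp
qed

lemma leaf_not_spine: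
  assumes "wf_blobs L" "b \<in> set L" "x \<in> snd b"
  shows "x \<notin> set (map fst L)"
proof
  assume "x \<in> set (map fst L)"
  then obtain c where c: "c \<in> set L" "x = fst c" by auto
  then have "b = c" using wf_blobs_disjoint'[OF assms(1,2) c(1), of x] assms(3) by (simp add: blob_set_def)
  then show False using assms c by (auto simp: wf_blobs_def)
qed

lemma path_arcs_nth: "Suc i < length p \<Longrightarrow> (p ! i, p ! Suc i) \<in> path_arcs p \<and> (p ! Suc i, p ! i) \<in> path_arcs p"
  by (auto simp: path_arcs_def set_vwalk_arcs)

text \<open>An interior spine vertex has two spine neighbours, an end has one spine neighbour and a
  leaf, and a leaf has a single neighbour. The graph alone thus recovers the spine.\<close>

lemma branch_vertices_blob_graph:
  assumes wf: "wf_blobs L" and len: "2 \<le> length L" and ends: "snd (hd L) \<noteq> {}" "snd (last L) \<noteq> {}"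
  shows "branch_vertices (blob_graph L) = set (map fst L)"
proof (intro equalityI subsetI)
  fix x assume "x \<in> branch_vertices (blob_graph L)"
  then obtain a b where ab: "a \<noteq> b" "(x, a) \<in> parcs (blob_graph L)" "(x, b) \<in> parcs (blob_graph L)"
    by (auto simp: branch_vertices_def)
  then have "x \<in> blobs_set L" using parcs_blob_graph_subset by blast
  then obtain c where c: "c \<in> set L" "x \<in> blob_set c" by (auto simp: blobs_set_def)
  have "x \<notin> snd c" using blob_graph_leaf[OF wf c(1)] ab by metis
  then show "x \<in> set (map fst L)" using c by (auto simp: blob_set_def)
next
  fix x assume "x \<in> set (map fst L)"
  then obtain i where i: "i < length L" "x = map fst L ! i" by (auto simp: in_set_conv_nth)
  let ?p = "map fst L"
  have P: "path_arcs ?p \<subseteq> parcs (blob_graph L)" by (auto simp: blob_graph_def)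
  have D: "distinct ?p" by (rule distinct_spine[OF wf])
  have "L \<noteq> []" using len by auto
  have leaf: "\<exists>a b. a \<noteq> b \<and> (x, a) \<in> parcs (blob_graph L) \<and> (x, b) \<in> parcs (blob_graph L)"
    if "snd (L ! i) \<noteq> {}" "y \<in> set ?p" "(x, y) \<in> path_arcs ?p" for y
  proof -
    obtain a where a: "a \<in> snd (L ! i)" using \<open>snd (L ! i) \<noteq> {}\<close> by auto
    then have "a \<noteq> y" using leaf_not_spine[OF wf _ a] i \<open>y \<in> set ?p\<close> by auto
    moreover have "(x, a) \<in> parcs (blob_graph L)"
      using a i nth_mem[OF i(1)] unfolding blob_graph_def by auto
    ultimately show ?thesis using P \<open>(x, y) \<in> path_arcs ?p\<close> by blast
  qed
  consider "i = 0" | "i = length L - 1" "i \<noteq> 0" | "i \<noteq> 0" "Suc i < length L" using i by linarith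
  then show "x \<in> branch_vertices (blob_graph L)" unfolding branch_vertices_def mem_Collect_eq
  proof cases
    case 1
    show "\<exists>a b. a \<noteq> b \<and> (x, a) \<in> parcs (blob_graph L) \<and> (x, b) \<in> parcs (blob_graph L)"
    proof (rule leaf[of "?p ! 1"])
      show "snd (L ! i) \<noteq> {}" using ends 1 \<open>L \<noteq> []\<close> by (simp add: hd_conv_nth)
      show "?p ! 1 \<in> set ?p" using len by (intro nth_mem) simp
      show "(x, ?p ! 1) \<in> path_arcs ?p" using path_arcs_nth[of 0 ?p] len i 1 by simp
    qed
  next
    case 2
    then obtain j where j: "i = Suc j" using not0_implies_Suc by blast
    show "\<exists>a b. a \<noteq> b \<and> (x, a) \<in> parcs (blob_graph L) \<and> (x, b) \<in> parcs (blob_graph L)"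
    proof (rule leaf[of "?p ! j"])
      show "snd (L ! i) \<noteq> {}" using ends 2 \<open>L \<noteq> []\<close> by (simp add: last_conv_nth)
      show "?p ! j \<in> set ?p" using i j by (intro nth_mem) simp
      show "(x, ?p ! j) \<in> path_arcs ?p" using path_arcs_nth[of j ?p] i j by simp
    qed
  next
    case 3
    then obtain j where j: "i = Suc j" using not0_implies_Suc by blast
    have "(x, ?p ! j) \<in> path_arcs ?p" "(x, ?p ! Suc i) \<in> path_arcs ?p"
      using path_arcs_nth[of j ?p] path_arcs_nth[of i ?p] i j 3 by auto
    moreover have "?p ! j \<noteq> ?p ! Suc i" using D i j 3 by (subst nth_eq_iff_index_eq) auto
    ultimately show "\<exists>a b. a \<noteq> b \<and> (x, a) \<in> parcs (blob_graph L) \<and> (x, b) \<in> parcs (blob_graph L)"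
      using P by blast
  qed
qed

lemma blob_leaves_eq:
  assumes wf: "wf_blobs L" and b: "b \<in> set L"
  shows "snd b = {x. (fst b, x) \<in> parcs (blob_graph L)} - set (map fst L)"
proof (intro equalityI subsetI)
  fix x assume "x \<in> snd b"
  then show "x \<in> {x. (fst b, x) \<in> parcs (blob_graph L)} - set (map fst L)"
    using leaf_not_spine[OF wf b] b by (auto simp: blob_graph_def)
next
  fix x assume "x \<in> {x. (fst b, x) \<in> parcs (blob_graph L)} - set (map fst L)"
  then have x: "(fst b, x) \<in> parcs (blob_graph L)" "x \<notin> set (map fst L)" by auto
  have "(fst b, x) \<notin> path_arcs (map fst L)" using path_arcs_subset[of "map fst L"] x(2) by blast
  then obtain c where c: "c \<in> set L" "fst b = fst c \<and> x \<in> snd c \<or> fst b \<in> snd c \<and> x = fst c"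
    using x(1) by (auto simp: blob_graph_def)
  have "x \<noteq> fst c" using x(2) c(1) by auto
  then have "fst b = fst c" "x \<in> snd c" using c(2) by auto
  then have "b = c" using wf_blobs_disjoint'[OF wf b c(1), of "fst b"] by (simp add: blob_set_def)
  then show "x \<in> snd b" using \<open>x \<in> snd c\<close> by simp
qed

text \<open>The first vertex has only one neighbour on a path, so the second vertices agree;
  deleting this edge leaves paths with the same arcs.\<close>

lemma path_arcs_unique_hd:
  assumes "distinct p" "distinct q" "p \<noteq> []" "q \<noteq> []" "hd p = hd q" "set p = set q" "path_arcs p = path_arcs q"
  shows "p = q"
  using assms
proof (induction p arbitrary: q)
  case (Cons a p)
  then obtain q' where q: "q = a # q'" by (cases q) auto
  have sets: "set p = set q'" using Cons.prems unfolding q by auto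
  show ?case
  proof (cases p)
    case Nil
    then show ?thesis using sets q by simp
  next
    case (Cons b r)
    then obtain c r' where q': "q' = c # r'" using sets by (cases q') auto
    have ap: "a \<notin> set p" and aq: "a \<notin> set q'" using Cons.prems q by auto
    have "(a, b) \<in> path_arcs q" using Cons.prems(7) Cons by auto
    then have "b = c" using path_arcs_subset[of q'] aq unfolding q q' by auto
    have "path_arcs p = path_arcs (a # p) - {(a, b), (b, a)}"
      using path_arcs_subset[of p] ap unfolding Cons by auto
    moreover have "path_arcs q' = path_arcs q - {(a, b), (b, a)}"
      using path_arcs_subset[of q'] aq unfolding q q' \<open>b = c\<close> by auto
    ultimately have "path_arcs p = path_arcs q'" using Cons.prems(7) by simp
    then have "p = q'" using Cons.prems sets q q' Cons \<open>b = c\<close> by (intro Cons.IH) auto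
    then show ?thesis using q by simp
  qed
qed simp

text \<open>The first vertex of \<open>q\<close> has one neighbour along the path, whereas an
  interior vertex of \<open>p\<close> has two; so it is one of the ends of \<open>p\<close>.\<close>

lemma path_arcs_unique:
  assumes p: "distinct p" and q: "distinct q" and ne: "p \<noteq> []" and sets: "set p = set q"
    and arcs: "path_arcs p = path_arcs q"
  shows "q = p \<or> q = rev p"
proof -
  have "q \<noteq> []" using ne sets by auto
  have "hd q \<in> set p" using sets \<open>q \<noteq> []\<close> by simp
  then obtain i where i: "i < length p" "hd q = p ! i" by (auto simp: in_set_conv_nth)
  have "i = 0 \<or> i = length p - 1"
  proof (rule ccontr)
    assume "\<not> (i = 0 \<or> i = length p - 1)"
    then obtain j where j: "i = Suc j" "Suc i < length p" using i not0_implies_Suc by (metis Suc_lessI diff_Suc_1)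
    have "(hd q, p ! j) \<in> path_arcs q" "(hd q, p ! Suc i) \<in> path_arcs q"
      using path_arcs_nth[of j p] path_arcs_nth[of i p] i j arcs by auto
    moreover have "x = hd (tl q)" if "(hd q, x) \<in> path_arcs q" for x
      using that q path_arcs_subset[of "tl q"] by (cases q rule: vwalk_arcs.cases) auto
    ultimately have "p ! j = hd (tl q)" "p ! Suc i = hd (tl q)" by blast+
    then have "p ! j = p ! Suc i" by simp
    then show False using p i j by (subst (asm) nth_eq_iff_index_eq) auto
  qed
  then show ?thesis
  proof
    assume "i = 0"
    then have "hd p = hd q" using i ne by (simp add: hd_conv_nth)
    then show ?thesis using path_arcs_unique_hd[OF p q ne \<open>q \<noteq> []\<close> _ sets arcs] by simp
  next
    assume "i = length p - 1"
    then have "hd (rev p) = hd q" using i ne by (simp add: hd_rev last_conv_nth)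
    then have "rev p = q"
      using path_arcs_unique_hd[of "rev p" q] p q ne \<open>q \<noteq> []\<close> sets arcs by (simp add: path_arcs_rev)
    then show ?thesis by simp
  qed
qed

text \<open>The graph determines the set of spine vertices, then the adjacency among them and hence
  their order up to reversal, and finally each leaf set as the neighbours off the spine.\<close>

lemma blob_graph_eq_imp:
  assumes L: "L \<in> ended_blob_lists {1..} {1..} V" and M: "M \<in> ended_blob_lists {1..} {1..} V"
    and eq: "blob_graph L = blob_graph M"
  shows "M = L \<or> M = rev L"
proof -
  have spine: "branch_vertices (blob_graph N) = set (map fst N)" "N \<noteq> []" "wf_blobs N"
    if "N \<in> ended_blob_lists {1..} {1..} V" for N
  proof -
    have N: "wf_blobs N" "2 \<le> length N" "1 \<le> card (snd (hd N))" "1 \<le> card (snd (last N))"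
      using that by (auto simp: ended_blob_lists_def blob_lists_def)
    have "snd (hd N) \<noteq> {}" "snd (last N) \<noteq> {}" using N(3,4) by fastforce+
    then show "branch_vertices (blob_graph N) = set (map fst N)"
      using branch_vertices_blob_graph[OF N(1,2)] by simp
    show "N \<noteq> []" using N by auto
    show "wf_blobs N" by fact
  qed
  have leaves: "N = map (\<lambda>v. (v, {x. (v, x) \<in> parcs (blob_graph N)} - set (map fst N))) (map fst N)"
    if "wf_blobs N" for N :: "('a \<times> 'a set) list"
  proof (rule nth_equalityI)
    fix i assume "i < length N"
    then show "N ! i = map (\<lambda>v. (v, {x. (v, x) \<in> parcs (blob_graph N)} - set (map fst N))) (map fst N) ! i"
      using blob_leaves_eq[OF that nth_mem[of i N]] by (simp add: prod_eq_iff)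
  qed simp
  have arcs: "path_arcs (map fst N) = {(u, w) \<in> parcs (blob_graph N). u \<in> set (map fst N) \<and> w \<in> set (map fst N)}"
    if "wf_blobs N" for N :: "('a \<times> 'a set) list"
  proof (intro equalityI subrelI)
    fix u w assume "(u, w) \<in> path_arcs (map fst N)"
    then show "(u, w) \<in> {(u, w) \<in> parcs (blob_graph N). u \<in> set (map fst N) \<and> w \<in> set (map fst N)}"
      using path_arcs_subset[of "map fst N"] by (auto simp: blob_graph_def)
  next
    fix u w assume "(u, w) \<in> {(u, w) \<in> parcs (blob_graph N). u \<in> set (map fst N) \<and> w \<in> set (map fst N)}"
    then have uw: "(u, w) \<in> parcs (blob_graph N)" "u \<in> set (map fst N)" "w \<in> set (map fst N)" by auto
    show "(u, w) \<in> path_arcs (map fst N)"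
    proof (rule ccontr)
      assume "(u, w) \<notin> path_arcs (map fst N)"
      then obtain c where c: "c \<in> set N" "w \<in> snd c \<or> u \<in> snd c" using uw(1) by (auto simp: blob_graph_def)
      then show False using leaf_not_spine[OF that c(1)] uw by blast
    qed
  qed
  have sets: "set (map fst L) = set (map fst M)"
    using spine(1)[OF L] spine(1)[OF M] eq by simp
  have "map fst M = map fst L \<or> map fst M = rev (map fst L)"
  proof (rule path_arcs_unique)
    show "distinct (map fst L)" "distinct (map fst M)" using spine(3) L M by (auto intro!: distinct_spine)
    show "map fst L \<noteq> []" using spine(2)[OF L] by simp
    show "set (map fst L) = set (map fst M)" by fact
    show "path_arcs (map fst L) = path_arcs (map fst M)"
      unfolding arcs[OF spine(3)[OF L]] arcs[OF spine(3)[OF M]] sets eq ..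
  qed
  then show ?thesis
  proof
    assume h: "map fst M = map fst L"
    have "M = L" by (subst leaves[OF spine(3)[OF M]], subst leaves[OF spine(3)[OF L]]) (simp only: h eq)
    then show ?thesis ..
  next
    assume h: "map fst M = rev (map fst L)"
    then have h': "map fst M = map fst (rev L)" by (simp add: rev_map)
    have wr: "wf_blobs (rev L)" using spine(3)[OF L] by (simp add: wf_blobs_rev)
    have "M = rev L"
      by (subst leaves[OF spine(3)[OF M]], subst leaves[OF wr]) (simp only: h' eq[symmetric] blob_graph_rev)
    then show ?thesis ..
  qed
qed

lemma rev_mem_ended_blob_lists:
  assumes "L \<in> ended_blob_lists I J V"
  shows "rev L \<in> ended_blob_lists J I V"
proof -
  have "L \<noteq> []" using assms by (auto simp: ended_blob_lists_def)
  then show ?thesis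
    using assms by (simp add: ended_blob_lists_def blob_lists_def wf_blobs_rev hd_rev last_rev)
qed

text \<open>An end of the spine without leaves is itself a leaf of its neighbour. Such ends are the
  ambiguity that the normal form excludes.\<close>

lemma blob_graph_shorten:
  assumes "wf_blobs ((v, {}) # (w, B) # M)"
  shows "wf_blobs ((w, insert v B) # M)" "blob_graph ((w, insert v B) # M) = blob_graph ((v, {}) # (w, B) # M)"
proof -
  show "wf_blobs ((w, insert v B) # M)" using assms by auto
  show "blob_graph ((w, insert v B) # M) = blob_graph ((v, {}) # (w, B) # M)"
    by (rule pair_pre_digraph.equality) (cases M; auto)+
qed

text \<open>A shortest encoding has leaves at both ends, since otherwise it could be shortened
  there, after reversal if necessary. If it has a single blob, the caterpillar is a star, determined
  by its centre.\<close>

lemma caterpillars_subset: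
  assumes "finite V"
  shows "caterpillars V \<subseteq> blob_graph ` ended_blob_lists {1..} {1..} V \<union> (\<lambda>v. blob_graph [(v, V - {v})]) ` V"
proof
  fix G assume G: "G \<in> caterpillars V"
  define P where "P = (\<lambda>L. L \<in> blob_lists V \<and> L \<noteq> [] \<and> blob_graph L = G)"
  obtain L0 where "P L0" using caterpillarsE[OF G] unfolding P_def by metis
  then obtain L where L: "P L" and min: "\<And>M. P M \<Longrightarrow> length L \<le> length M"
    using ex_has_least_nat[of P L0 length] by blast
  have "P (rev L)" using L by (simp add: P_def blob_lists_def wf_blobs_rev blob_graph_rev)
  have first: "snd (hd M) \<noteq> {}" if M: "P M" "length M = length L" "2 \<le> length M" for M
  proof
    assume e: "snd (hd M) = {}"
    obtain b c N where bc: "M = b # c # N" using M(3) by (cases M rule: vwalk_arcs.cases) auto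
    obtain v where v: "b = (v, {})" using e bc by (cases b) auto
    obtain w B where w: "c = (w, B)" by (cases c) auto
    have N: "M = (v, {}) # (w, B) # N" using bc v w by simp
    have "P ((w, insert v B) # N)"
      using M(1) blob_graph_shorten[of v w B N] unfolding P_def blob_lists_def N by auto
    then show False using min M(2) N by fastforce
  qed
  show "G \<in> blob_graph ` ended_blob_lists {1..} {1..} V \<union> (\<lambda>v. blob_graph [(v, V - {v})]) ` V"
  proof (cases "2 \<le> length L")
    case True
    have "snd (hd L) \<noteq> {}" using first[OF L] True by simp
    moreover have "snd (last L) \<noteq> {}" using first[OF \<open>P (rev L)\<close>] True L by (simp add: hd_rev P_def)
    moreover have "finite (snd (hd L))" "finite (snd (last L))"
      using L by (auto simp: P_def blob_lists_def wf_blobs_def)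
    ultimately have "L \<in> ended_blob_lists {1..} {1..} V"
      using True L by (auto simp: ended_blob_lists_def P_def Suc_le_eq card_gt_0_iff)
    then show ?thesis using L by (auto simp: P_def)
  next
    case False
    then obtain b where "L = [b]" using L by (cases L rule: vwalk_arcs.cases) (auto simp: P_def)
    then obtain v A where vA: "L = [(v, A)]" by (cases b) auto
    then have "A = V - {v}" "v \<in> V" using L by (auto simp: P_def blob_lists_def)
    then show ?thesis using L vA by (auto simp: P_def)
  qed
qed

section \<open>Counting caterpillars\<close>

definition cons_blobs :: "nat set \<Rightarrow> ('a set \<Rightarrow> ('a \<times> 'a set) list set) \<Rightarrow> 'a set \<Rightarrow> ('a \<times> 'a set) list set" where
  "cons_blobs I X V = {(v, A) # L | v A L. v \<in> V \<and> A \<subseteq> V - {v} \<and> card A \<in> I \<and> L \<in> X (V - insert v A)}"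

lemma sum_card_Pow:
  fixes g :: "nat \<Rightarrow> nat"
  assumes "finite W"
  shows "(\<Sum>A\<in>{A. A \<subseteq> W \<and> card A \<in> I}. g (card A)) = (\<Sum>i\<in>{i. i \<le> card W \<and> i \<in> I}. (card W choose i) * g i)"
proof -
  let ?S = "{A. A \<subseteq> W \<and> card A \<in> I}" and ?T = "{i. i \<le> card W \<and> i \<in> I}"
  have fin: "finite ?S" by (rule finite_subset[of _ "Pow W"]) (use assms in auto)
  have "(\<Sum>i\<in>?T. \<Sum>A\<in>{A \<in> ?S. card A = i}. g (card A)) = (\<Sum>A\<in>?S. g (card A))"
    by (rule sum.group[OF fin]) (auto simp: card_mono assms)
  also have "(\<Sum>A\<in>{A \<in> ?S. card A = i}. g (card A)) = (card W choose i) * g i" if "i \<in> ?T" for i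
  proof -
    have "{A \<in> ?S. card A = i} = {A. A \<subseteq> W \<and> card A = i}" using that by auto
    then show ?thesis using n_subsets[OF assms, of i] by simp
  qed
  then have "(\<Sum>i\<in>?T. \<Sum>A\<in>{A \<in> ?S. card A = i}. g (card A)) = (\<Sum>i\<in>?T. (card W choose i) * g i)"
    by (intro sum.cong) auto
  finally show ?thesis by simp
qed

text \<open>The hypothesis on \<open>X\<close> concerns proper subsets only, so the count can be
  used inside the induction in which \<open>X\<close> is the set of blob lists being
  counted.\<close>

lemma card_cons_blobs:
  assumes V: "finite V" and X: "\<And>W. W \<subset> V \<Longrightarrow> finite (X W) \<and> card (X W) = x (card W)"
  shows "finite (cons_blobs I X V)"
    "card (cons_blobs I X V) =
      (\<Sum>i\<in>{i. i < card V \<and> i \<in> I}. card V * ((card V - 1) choose i) * x (card V - 1 - i))"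
proof -
  let ?A = "\<lambda>v. {A. A \<subseteq> V - {v} \<and> card A \<in> I}"
  define S where "S = (SIGMA v:V. SIGMA A:?A v. X (V - insert v A))"
  have eq: "cons_blobs I X V = (\<lambda>(v, A, L). (v, A) # L) ` S"
    unfolding cons_blobs_def S_def by (auto simp: image_iff)
  have inj: "inj_on (\<lambda>(v, A, L). (v, A) # L) S" by (auto simp: inj_on_def)
  have finA: "finite (?A v)" for v
    by (rule finite_subset[of _ "Pow V"]) (use V in auto)
  have sub: "V - insert v A \<subset> V" if "v \<in> V" for v A using that by auto
  have finS: "finite S" unfolding S_def
    using V finA X[OF sub] by (intro finite_SigmaI) auto
  show "finite (cons_blobs I X V)" unfolding eq using finS by simp
  have cV: "card (V - {v}) = card V - 1" if "v \<in> V" for v using that V by simp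
  have "card (cons_blobs I X V) = card S" unfolding eq by (rule card_image[OF inj])
  also have "\<dots> = (\<Sum>v\<in>V. card (SIGMA A:?A v. X (V - insert v A)))"
    unfolding S_def using V finA X[OF sub] by (intro card_SigmaI ballI finite_SigmaI) auto
  also have "\<dots> = (\<Sum>v\<in>V. \<Sum>i\<in>{i. i < card V \<and> i \<in> I}. ((card V - 1) choose i) * x (card V - 1 - i))"
  proof (rule sum.cong[OF refl])
    fix v assume v: "v \<in> V"
    have "card V > 0" using v V by (auto simp: card_gt_0_iff)
    have "card (SIGMA A:?A v. X (V - insert v A)) = (\<Sum>A\<in>?A v. card (X (V - insert v A)))"
      using finA X[OF sub[OF v]] by (intro card_SigmaI) auto
    also have "\<dots> = (\<Sum>A\<in>?A v. x (card V - 1 - card A))"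
    proof (rule sum.cong[OF refl])
      fix A assume A: "A \<in> ?A v"
      have "V - insert v A = (V - {v}) - A" by auto
      then have "card (V - insert v A) = card (V - {v}) - card A"
        using A V by (metis card_Diff_subset finite_Diff finite_subset mem_Collect_eq)
      then show "card (X (V - insert v A)) = x (card V - 1 - card A)"
        using X[OF sub[OF v]] cV[OF v] by simp
    qed
    also have "\<dots> = (\<Sum>i\<in>{i. i \<le> card (V - {v}) \<and> i \<in> I}. (card (V - {v}) choose i) * x (card V - 1 - i))"
      using V by (intro sum_card_Pow) simp
    also have "{i. i \<le> card (V - {v}) \<and> i \<in> I} = {i. i < card V \<and> i \<in> I}"
      using cV[OF v] \<open>card V > 0\<close> by auto
    finally show "card (SIGMA A:?A v. X (V - insert v A)) =
        (\<Sum>i\<in>{i. i < card V \<and> i \<in> I}. ((card V - 1) choose i) * x (card V - 1 - i))"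
      unfolding cV[OF v] .
  qed
  also have "\<dots> = (\<Sum>i\<in>{i. i < card V \<and> i \<in> I}. card V * ((card V - 1) choose i) * x (card V - 1 - i))"
    by (simp add: sum_distrib_left mult.assoc)
  finally show "card (cons_blobs I X V) =
      (\<Sum>i\<in>{i. i < card V \<and> i \<in> I}. card V * ((card V - 1) choose i) * x (card V - 1 - i))" .
qed

text \<open>Exponential generating functions are rescaled to have radius of convergence 1.\<close>

definition egf :: "(nat \<Rightarrow> nat) \<Rightarrow> real fps" where
  "egf x = Abs_fps (\<lambda>n. real (x n) * rho ^ n / fact n)"

definition blob_gf_on :: "nat set \<Rightarrow> real fps" where
  "blob_gf_on I = Abs_fps (\<lambda>n. if n \<noteq> 0 \<and> n - 1 \<in> I then rho ^ n / fact (n - 1) else 0)"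

definition cons_count :: "nat set \<Rightarrow> (nat \<Rightarrow> nat) \<Rightarrow> nat \<Rightarrow> nat" where
  "cons_count I x n = (\<Sum>i\<in>{i. i < n \<and> i \<in> I}. n * ((n - 1) choose i) * x (n - 1 - i))"

text \<open>The product rule for labelled structures: n * binomial (n - 1, i) / n! = 1 / (i! * (n -
  1 - i)!).\<close>

lemma egf_cons_count: "egf (cons_count I x) = blob_gf_on I * egf x"
proof (rule fps_ext)
  fix n
  have summand: "real (n * ((n - 1) choose i) * x (n - 1 - i)) * rho ^ n / fact n =
      rho ^ Suc i / fact i * (real (x (n - Suc i)) * rho ^ (n - Suc i) / fact (n - Suc i))" if "i < n" for i
  proof -
    obtain m where m: "n = Suc m" "i \<le> m" using \<open>i < n\<close> by (cases n) auto
    have b: "real (m choose i) = fact m / (fact i * fact (m - i))" by (rule binomial_fact[OF m(2)])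
    have p: "rho ^ n = rho ^ Suc i * rho ^ (m - i)" using m by (simp flip: power_add)
    have "real (n * ((n - 1) choose i) * x (n - 1 - i)) * rho ^ n / fact n =
        real (m choose i) * real (x (m - i)) * rho ^ n / fact m"
    proof -
      have "(fact n :: real) = real n * fact m" using m(1) by (simp del: of_nat_Suc)
      moreover have "real n \<noteq> 0" "n - 1 = m" using m(1) by auto
      ultimately show ?thesis by simp
    qed
    also have "\<dots> = rho ^ Suc i / fact i * (real (x (m - i)) * rho ^ (m - i) / fact (m - i))"
      unfolding b p by simp
    finally show ?thesis using m by simp
  qed
  have "fps_nth (blob_gf_on I * egf x) n =
      (\<Sum>k\<in>{k. k \<le> n \<and> k \<noteq> 0 \<and> k - 1 \<in> I}. rho ^ k / fact (k - 1) * (real (x (n - k)) * rho ^ (n - k) / fact (n - k)))"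
    unfolding fps_mult_nth_atMost
    by (rule sum.mono_neutral_cong_right) (auto simp: blob_gf_on_def egf_def)
  also have "\<dots> = (\<Sum>i\<in>{i. i < n \<and> i \<in> I}. rho ^ Suc i / fact i * (real (x (n - Suc i)) * rho ^ (n - Suc i) / fact (n - Suc i)))"
    by (rule sum.reindex_bij_witness[of _ Suc "\<lambda>k. k - 1"]) auto
  also have "\<dots> = (\<Sum>i\<in>{i. i < n \<and> i \<in> I}. real (n * ((n - 1) choose i) * x (n - 1 - i)) * rho ^ n / fact n)"
    by (rule sum.cong[OF refl]) (use summand in auto)
  also have "\<dots> = fps_nth (egf (cons_count I x)) n"
    by (simp add: egf_def cons_count_def sum_distrib_right sum_divide_distrib)
  finally show "fps_nth (egf (cons_count I x)) n = fps_nth (blob_gf_on I * egf x) n" by simp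
qed

fun num_blob_lists :: "nat \<Rightarrow> nat" where
  "num_blob_lists 0 = 1"
| "num_blob_lists (Suc n) = (\<Sum>i\<le>n. Suc n * (n choose i) * num_blob_lists (n - i))"

lemma num_blob_lists_rec: "n > 0 \<Longrightarrow> num_blob_lists n = cons_count UNIV num_blob_lists n"
proof -
  assume "n > 0"
  then obtain m where m: "n = Suc m" by (cases n) auto
  have "{i. i < n \<and> i \<in> UNIV} = {..m}" using m by auto
  then show ?thesis unfolding cons_count_def m by simp
qed

lemma egf_num_blob_lists: "egf num_blob_lists = 1 + blob_gf * egf num_blob_lists"
proof -
  have "blob_gf_on UNIV = blob_gf" by (simp add: blob_gf_on_def blob_gf_def fps_eq_iff)
  then have *: "egf (cons_count UNIV num_blob_lists) = blob_gf * egf num_blob_lists"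
    by (simp add: egf_cons_count)
  show ?thesis
  proof (rule fps_ext)
    fix n show "fps_nth (egf num_blob_lists) n = fps_nth (1 + blob_gf * egf num_blob_lists) n"
    proof (cases "n = 0")
      case True
      then show ?thesis by (simp add: egf_def blob_gf_def)
    next
      case False
      then show ?thesis unfolding *[symmetric] using num_blob_lists_rec[of n]
        by (simp add: egf_def del: num_blob_lists.simps)
    qed
  qed
qed

lemma blob_lists_eq_cons:
  assumes "finite V" "V \<noteq> {}"
  shows "blob_lists V = cons_blobs UNIV blob_lists V"
proof (intro equalityI subsetI)
  fix L assume L: "L \<in> blob_lists V"
  then obtain v A M where vA: "L = (v, A) # M" using assms(2) by (cases L) (auto simp: blob_lists_def)
  have wf: "finite A" "v \<notin> A" "insert v A \<inter> blobs_set M = {}" "wf_blobs M" and V: "V = insert v A \<union> blobs_set M"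
    using L unfolding blob_lists_def vA by auto
  have "blobs_set M = V - insert v A" using wf V by auto
  then show "L \<in> cons_blobs UNIV blob_lists V"
    unfolding cons_blobs_def vA using wf V by (auto simp: blob_lists_def)
next
  fix L assume "L \<in> cons_blobs UNIV blob_lists V"
  then obtain v A M where L: "L = (v, A) # M" "v \<in> V" "A \<subseteq> V - {v}" "wf_blobs M" "blobs_set M = V - insert v A"
    by (auto simp: cons_blobs_def blob_lists_def)
  have "finite A" using L(3) assms(1) finite_subset by blast
  then show "L \<in> blob_lists V" using L by (auto simp: blob_lists_def)
qed

lemma blob_lists_empty: "blob_lists {} = {[]}"
proof -
  have "L = []" if "blobs_set L = {}" for L :: "('a \<times> 'a set) list"
    using that by (cases L) (auto simp: blob_set_def)
  then show ?thesis by (auto simp: blob_lists_def)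
qed

lemma card_blob_lists:
  assumes "finite V"
  shows "finite (blob_lists V) \<and> card (blob_lists V) = num_blob_lists (card V)"
  using assms
proof (induction V rule: finite_psubset_induct)
  case (psubset V)
  show ?case
  proof (cases "V = {}")
    case False
    then have "num_blob_lists (card V) = cons_count UNIV num_blob_lists (card V)"
      using psubset.hyps by (intro num_blob_lists_rec) (simp add: card_gt_0_iff)
    then show ?thesis
      unfolding blob_lists_eq_cons[OF psubset.hyps False]
      using card_cons_blobs[where X = blob_lists and x = num_blob_lists and I = UNIV, OF psubset.hyps psubset.IH] by (simp add: cons_count_def)
  qed (simp add: blob_lists_empty)
qed

text \<open>Reversing what remains after the first blob brings the last blob to the front, so the
  condition on either end becomes a condition on a first blob.\<close>

lemma ended_blob_lists_eq:
  assumes "finite V"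
  shows "ended_blob_lists I J V = cons_blobs I (\<lambda>W. rev ` cons_blobs J blob_lists W) V"
proof (intro equalityI subsetI)
  fix L assume "L \<in> ended_blob_lists I J V"
  then have L: "wf_blobs L" "blobs_set L = V" "2 \<le> length L" "card (snd (hd L)) \<in> I" "card (snd (last L)) \<in> J"
    by (auto simp: ended_blob_lists_def blob_lists_def)
  obtain v A M where vA: "L = (v, A) # M" using L(3) by (cases L) auto
  then have "M \<noteq> []" using L(3) by auto
  then obtain N w B where N: "M = N @ [(w, B)]" by (cases M rule: rev_cases) auto
  define W where "W = V - insert v A"
  have wf: "finite A" "v \<notin> A" "insert v A \<inter> blobs_set M = {}" "wf_blobs M" and V: "V = insert v A \<union> blobs_set M"
    using L unfolding vA by auto
  have W: "W = blobs_set M" using wf V by (auto simp: W_def)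
  have revM: "rev M = (w, B) # rev N" by (simp add: N)
  have "rev M \<in> blob_lists W" using wf W by (simp add: blob_lists_def wf_blobs_rev)
  moreover have "finite W" using assms by (simp add: W_def)
  moreover have "W \<noteq> {}" unfolding W N by (simp add: blob_set_def)
  ultimately have "rev M \<in> cons_blobs UNIV blob_lists W" using blob_lists_eq_cons by blast
  moreover have "card B \<in> J" using L(5) vA N by simp
  ultimately have "rev M \<in> cons_blobs J blob_lists W"
    unfolding cons_blobs_def revM by auto
  then have "M \<in> rev ` cons_blobs J blob_lists W" by (metis image_eqI rev_rev_ident)
  then show "L \<in> cons_blobs I (\<lambda>W. rev ` cons_blobs J blob_lists W) V"
    unfolding cons_blobs_def[of I] W_def vA using L(4) wf V vA by auto
next
  fix L assume "L \<in> cons_blobs I (\<lambda>W. rev ` cons_blobs J blob_lists W) V"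
  then obtain v A M where L: "L = (v, A) # rev M" "v \<in> V" "A \<subseteq> V - {v}" "card A \<in> I"
      "M \<in> cons_blobs J blob_lists (V - insert v A)"
    by (auto simp: cons_blobs_def[of I])
  obtain w B N where M: "M = (w, B) # N" "card B \<in> J" using L(5) by (auto simp: cons_blobs_def)
  have "M \<in> cons_blobs UNIV blob_lists (V - insert v A)" using L(5) by (auto simp: cons_blobs_def)
  moreover have "V - insert v A \<noteq> {}" using L(5) by (auto simp: cons_blobs_def)
  then have "blob_lists (V - insert v A) = cons_blobs UNIV blob_lists (V - insert v A)"
    using assms by (intro blob_lists_eq_cons) auto
  ultimately have "M \<in> blob_lists (V - insert v A)" by simp
  then have wf: "wf_blobs M" "blobs_set M = V - insert v A" by (auto simp: blob_lists_def)
  have "finite A" using L(3) assms finite_subset by blast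
  have "v \<notin> A" using L(3) by auto
  moreover have "insert v A \<inter> blobs_set (rev M) = {}" unfolding blobs_set_simps(4) wf(2) by blast
  ultimately have "wf_blobs L" unfolding L(1) wf_blobs_Cons using wf(1) \<open>finite A\<close> by (simp add: wf_blobs_rev)
  moreover have "blobs_set L = V"
    unfolding L(1) blobs_set_simps blob_set_Pair wf(2) using L(2,3) by blast
  ultimately show "L \<in> ended_blob_lists I J V"
    using L M by (simp add: ended_blob_lists_def blob_lists_def)
qed

lemma card_ended_blob_lists:
  assumes "finite V"
  shows "finite (ended_blob_lists I J V)"
    "card (ended_blob_lists I J V) = cons_count I (cons_count J num_blob_lists) (card V)"
proof -
  have X: "finite (rev ` cons_blobs J blob_lists W) \<and>
      card (rev ` cons_blobs J blob_lists W) = cons_count J num_blob_lists (card W)" if "W \<subset> V" for W :: "'a set"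
  proof -
    have W: "finite W" using that assms finite_subset by blast
    have "finite (blob_lists U) \<and> card (blob_lists U) = num_blob_lists (card U)" if "U \<subset> W" for U
      using card_blob_lists that W finite_subset by blast
    note c = card_cons_blobs[where X = blob_lists and x = num_blob_lists and I = J, OF W this]
    show ?thesis using c card_image[OF inj_on_rev, of "cons_blobs J blob_lists W"] by (simp add: cons_count_def)
  qed
  note c = card_cons_blobs[where X = "\<lambda>W. rev ` cons_blobs J blob_lists W" and x = "cons_count J num_blob_lists" and I = I, OF assms X]
  show "finite (ended_blob_lists I J V)"
    "card (ended_blob_lists I J V) = cons_count I (cons_count J num_blob_lists) (card V)"
    using c by (auto simp: ended_blob_lists_eq[OF assms] cons_count_def[of I])
qed

lemma egf_ended: "egf (cons_count I (cons_count J num_blob_lists)) = blob_gf_on I * blob_gf_on J * egf num_blob_lists"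
  by (simp add: egf_cons_count mult.assoc)

lemma blob_graph_image_subset:
  assumes "V \<noteq> {}"
  shows "blob_graph ` ended_blob_lists I J V \<subseteq> caterpillars V"
  using blob_graph_mem_caterpillars assms by (auto simp: ended_blob_lists_def)

lemma rev_ne_ended:
  assumes "L \<in> ended_blob_lists I J V"
  shows "rev L \<noteq> L"
proof
  assume eq: "rev L = L"
  have L: "wf_blobs L" "2 \<le> length L" using assms by (auto simp: ended_blob_lists_def blob_lists_def)
  then have "L \<noteq> []" by auto
  have "rev L ! 0 = L ! (length L - 1)" using L(2) by (subst rev_nth) auto
  then have "L ! 0 = L ! (length L - 1)" using eq by simp
  then have "0 = length L - 1"
    using L(2) \<open>L \<noteq> []\<close> by (intro wf_blobs_disjoint[OF L(1), of 0 "length L - 1" "fst (L ! 0)"]) (auto simp: blob_set_def)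
  then show False using L(2) by simp
qed

lemma fibre_subset:
  assumes "L \<in> ended_blob_lists {1..} {1..} V" "T \<subseteq> ended_blob_lists {1..} {1..} V"
  shows "{M \<in> T. blob_graph M = blob_graph L} \<subseteq> {L, rev L}"
  using blob_graph_eq_imp[OF assms(1)] assms(2) by (auto dest: sym)

text \<open>A fibre of \<open>blob_graph\<close> contains at most a list and its reversal. The
  inequality holds for every subfamily and gives lower bounds for numbers of caterpillars.\<close>

lemma card_le_fibres:
  assumes "finite V" "T \<subseteq> ended_blob_lists {1..} {1..} V"
  shows "card T \<le> 2 * card (blob_graph ` T)"
proof -
  have fin: "finite T" using card_ended_blob_lists(1)[OF assms(1)] assms(2) finite_subset by blast
  have "card T = (\<Sum>G\<in>blob_graph ` T. card {M \<in> T. blob_graph M = G})"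
    using sum.image_gen[OF fin, of "\<lambda>_. 1 :: nat" blob_graph] by simp
  also have "\<dots> \<le> (\<Sum>G\<in>blob_graph ` T. 2)"
  proof (rule sum_mono)
    fix G assume "G \<in> blob_graph ` T"
    then obtain L where L: "L \<in> T" "G = blob_graph L" by auto
    have "card {M \<in> T. blob_graph M = G} \<le> card {L, rev L}"
      unfolding L(2) using L(1) assms(2) by (intro card_mono fibre_subset) auto
    also have "\<dots> \<le> 2" by (simp add: card_insert_if)
    finally show "card {M \<in> T. blob_graph M = G} \<le> 2" .
  qed
  finally show ?thesis by simp
qed

text \<open>Here the fibres have exactly two elements: the family is closed under reversal, and a
  list of at least two disjoint blobs is no palindrome.\<close>

lemma card_fibres:
  assumes "finite V"
  defines "T \<equiv> ended_blob_lists {1..} {1..} V"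
  shows "card T = 2 * card (blob_graph ` T)"
proof -
  have fin: "finite T" unfolding T_def by (rule card_ended_blob_lists(1)[OF assms(1)])
  have "card T = (\<Sum>G\<in>blob_graph ` T. card {M \<in> T. blob_graph M = G})"
    using sum.image_gen[OF fin, of "\<lambda>_. 1 :: nat" blob_graph] by simp
  also have "\<dots> = (\<Sum>G\<in>blob_graph ` T. 2)"
  proof (rule sum.cong[OF refl])
    fix G assume "G \<in> blob_graph ` T"
    then obtain L where L: "L \<in> T" "G = blob_graph L" by auto
    have "{M \<in> T. blob_graph M = G} = {L, rev L}"
    proof
      show "{M \<in> T. blob_graph M = G} \<subseteq> {L, rev L}"
        unfolding L(2) using L(1) by (intro fibre_subset[where V = V]) (auto simp: T_def)
      show "{L, rev L} \<subseteq> {M \<in> T. blob_graph M = G}"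
        using L rev_mem_ended_blob_lists[of L] by (auto simp: T_def blob_graph_rev)
    qed
    show "card {M \<in> T. blob_graph M = G} = 2"
    proof -
      have "L \<noteq> rev L" using rev_ne_ended[of L "{1..}" "{1..}" V] L(1) unfolding T_def by metis
      then show ?thesis unfolding \<open>{M \<in> T. blob_graph M = G} = {L, rev L}\<close> by simp
    qed
  qed
  finally show ?thesis by simp
qed

lemma finite_caterpillars:
  assumes "finite V"
  shows "finite (caterpillars V)" "card (caterpillars V) \<le> num_blob_lists (card V)"
proof -
  have sub: "caterpillars V \<subseteq> blob_graph ` blob_lists V"
    by (auto elim: caterpillarsE)
  have fin: "finite (blob_lists V)" "card (blob_lists V) = num_blob_lists (card V)"
    using card_blob_lists[OF assms] by auto
  show "finite (caterpillars V)" using sub fin finite_surj by blast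
  show "card (caterpillars V) \<le> num_blob_lists (card V)"
    using surj_card_le[OF fin(1) sub] fin(2) by simp
qed

lemma caterpillars_empty: "caterpillars {} = {}"
  using caterpillar_nonempty by (auto simp: caterpillars_def)

text \<open>The error \<open>r\<close> counts caterpillars without an encoding in normal form. They
  are stars, one for each centre at most, and hence negligible after division by the
  factorial.\<close>

lemma card_caterpillars:
  assumes "finite V"
  shows "\<exists>r\<le>card V. 2 * card (caterpillars V) =
    cons_count {1..} (cons_count {1..} num_blob_lists) (card V) + 2 * r"
proof (cases "V = {}")
  case True
  then show ?thesis by (simp add: caterpillars_empty cons_count_def)
next
  case False
  let ?S = "ended_blob_lists {1..} {1..} V"
  define R where "R = caterpillars V - blob_graph ` ?S"
  have "R \<subseteq> (\<lambda>v. blob_graph [(v, V - {v})]) ` V"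
    using caterpillars_subset[OF assms] by (auto simp: R_def)
  then have "card R \<le> card V" by (rule surj_card_le[OF assms])
  moreover have "card (caterpillars V) = card (blob_graph ` ?S) + card R"
    unfolding R_def using blob_graph_image_subset[OF False, of "{1..}" "{1..}"] finite_caterpillars(1)[OF assms]
    by (metis card_Diff_subset card_mono finite_subset le_add_diff_inverse)
  ultimately show ?thesis
    using card_fibres[OF assms] card_ended_blob_lists(2)[OF assms, of "{1..}" "{1..}"] by (intro exI[of _ "card R"]) simp
qed

section \<open>The pole of the caterpillar series\<close>

definition num_caterpillars :: "nat \<Rightarrow> nat" where
  "num_caterpillars n = card (caterpillars {1..n})"

lemma num_caterpillars_0: "num_caterpillars 0 = 0"
  by (simp add: num_caterpillars_def caterpillars_empty)

lemma rapid_finite: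
  assumes "\<And>n. n \<ge> N \<Longrightarrow> fps_nth F n = 0"
  shows "rapid F"
proof -
  have "\<bar>fps_nth F n\<bar> \<le> (\<Sum>i<N. \<bar>fps_nth F i\<bar> * 2 ^ i) * (1/2) ^ n" for n
  proof (cases "n < N")
    case True
    then have "\<bar>fps_nth F n\<bar> * 2 ^ n \<le> (\<Sum>i<N. \<bar>fps_nth F i\<bar> * 2 ^ i)"
      by (intro member_le_sum) auto
    then show ?thesis by (simp add: field_simps power_one_over)
  next
    case False
    then show ?thesis using assms[of n] by (auto intro!: mult_nonneg_nonneg sum_nonneg)
  qed
  then show ?thesis by (auto simp: rapid_def)
qed

text \<open>Write P for \<open>blob_gf\<close>, y for rho * x and U = 1 / (1 - P). Encodings with
  leaves at both ends have the series (P - y)^2 * U, since y is the blob without leaves. As P * U =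
  U - 1, this is (1 - y)^2 * U up to absolutely summable terms, and (1 - y)^2 multiplies the residue
  of U by (1 - rho)^2.\<close>

lemma egf_num_caterpillars:
  obtains c A where "c > 0" "abs_summable_fps A" "egf num_caterpillars = fps_const c * fps_ones + A"
proof -
  define E where "E = cons_count {1..} (cons_count {1..} num_blob_lists)"
  define U where "U = egf num_blob_lists"
  obtain r where r: "\<And>n. r n \<le> n" "\<And>n. 2 * num_caterpillars n = E n + 2 * r n"
    using card_caterpillars[of "{1..n :: nat}" for n] unfolding num_caterpillars_def E_def
    by (metis card_atLeastAtMost diff_Suc_1 finite_atLeastAtMost)
  have split: "egf num_caterpillars = fps_const (1/2) * egf E + egf r"
  proof (rule fps_ext)
    fix n
    have "real (num_caterpillars n) = real (E n) / 2 + real (r n)"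
      using r(2)[of n] by linarith
    then show "fps_nth (egf num_caterpillars) n = fps_nth (fps_const (1/2) * egf E + egf r) n"
      by (simp add: egf_def add_divide_distrib distrib_right)
  qed
  \<comment> \<open>As r n <= n, this is dominated by \<open>blob_gf\<close>, whose coefficients are
    those of the sequence n.\<close>
  have "abs_summable_fps (egf r)"
    unfolding abs_summable_fps_def
  proof (rule summable_comparison_test'[where N = 0])
    show "summable (fps_nth blob_gf)" by (rule abs_summable_fps_imp_summable[OF abs_summable_blob_gf])
    fix n :: nat
    show "norm \<bar>fps_nth (egf r) n\<bar> \<le> fps_nth blob_gf n"
    proof (cases n)
      case 0
      then show ?thesis using r(1)[of 0] by (simp add: egf_def blob_gf_def)
    next
      case (Suc m)
      have "real (r n) * rho ^ n / fact n \<le> real n * rho ^ n / fact n"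
        using r(1)[of n] rho by (intro divide_right_mono mult_right_mono) auto
      also have "\<dots> = rho ^ n / fact m" by (simp add: Suc del: of_nat_Suc)
      finally show ?thesis using rho by (simp add: egf_def blob_gf_def Suc)
    qed
  qed
  moreover have ends: "blob_gf_on {1..} = blob_gf - fps_const rho * fps_X"
    by (rule fps_ext) (auto simp: blob_gf_on_def blob_gf_def fps_X_def)
  define N where "N = (1 - fps_const rho * fps_X) ^ 2"
  have "blob_gf * U = U - 1" using egf_num_blob_lists unfolding U_def by (metis add_diff_cancel_left')
  then have "egf E = N * U - (1 - fps_const rho * fps_X) - (blob_gf - fps_const rho * fps_X)"
  proof -
    assume PU: "blob_gf * U = U - 1"
    let ?x = "fps_const rho * fps_X"
    have "egf E = (blob_gf - ?x) * ((blob_gf - ?x) * U)"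
      by (simp only: E_def egf_ended ends U_def mult.assoc)
    also have "(blob_gf - ?x) * U = (1 - ?x) * U - 1"
      using PU by (simp add: algebra_simps)
    also have "(blob_gf - ?x) * ((1 - ?x) * U - 1) = (1 - ?x) * ((blob_gf - ?x) * U) - (blob_gf - ?x)"
      by (simp add: algebra_simps)
    also have "(blob_gf - ?x) * U = (1 - ?x) * U - 1"
      using PU by (simp add: algebra_simps)
    also have "(1 - ?x) * ((1 - ?x) * U - 1) = N * U - (1 - ?x)"
      unfolding N_def by (simp add: power2_eq_square algebra_simps)
    finally show ?thesis .
  qed
  moreover obtain W where W: "abs_summable_fps W" "U = fps_const (1 / (1 + rho)) * fps_ones + W"
    using inverse_1_minus_blob_gf[OF egf_num_blob_lists] unfolding U_def by blast
  note sums = abs_summable_fps_mult abs_summable_fps_add abs_summable_fps_diff abs_summable_fps_const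
    abs_summable_fps_X abs_summable_fps_1 abs_summable_fps_power abs_summable_blob_gf
  have N: "abs_summable_fps N" "fps_sum N = (1 - rho) ^ 2"
    unfolding N_def by (simp_all add: sums)
  \<comment> \<open>A polynomial decays rapidly for trivial reasons, which makes its tail absolutely
    summable.\<close>
  have "fps_nth N n = 0" if "n \<ge> 3" for n
  proof -
    have eq: "N = (1 - fps_const rho * fps_X) - fps_const rho * (fps_X * (1 - fps_const rho * fps_X))"
      unfolding N_def power2_eq_square by (simp add: algebra_simps)
    show ?thesis unfolding eq using that by auto
  qed
  then have tN: "abs_summable_fps (fps_tail N)"
    by (intro rapid_abs_summable rapid_tail rapid_finite)
  define c where "c = 1 / 2 * (1 / (1 + rho) * (1 - rho) ^ 2)"
  define A where "A = fps_const (1/2) * ((N * W - fps_const (1 / (1 + rho)) * fps_tail N)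
     - (1 - fps_const rho * fps_X) - (blob_gf - fps_const rho * fps_X)) + egf r"
  have NU: "N * U = fps_const (1 / (1 + rho) * (1 - rho) ^ 2) * fps_ones
      + (N * W - fps_const (1 / (1 + rho)) * fps_tail N)"
  proof -
    have "N * U = fps_const (1 / (1 + rho)) * (fps_ones * N) + N * W"
      unfolding W(2) by (simp add: algebra_simps)
    also have "fps_ones * N = fps_const ((1 - rho) ^ 2) * fps_ones - fps_tail N"
      using fps_ones_mult_eq[OF N(1)] N(2) by simp
    finally show ?thesis by (simp add: right_diff_distrib mult.assoc[symmetric])
  qed
  have "egf num_caterpillars = fps_const c * fps_ones + A"
    unfolding split \<open>egf E = _\<close> NU A_def c_def
    by (simp only: distrib_left right_diff_distrib mult.assoc[symmetric] fps_const_mult[symmetric]) (simp add: algebra_simps)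
  moreover have "abs_summable_fps A"
    unfolding A_def using \<open>abs_summable_fps (egf r)\<close> by (intro sums N W tN)
  moreover have "c > 0" using rho rho_less_1 by (simp add: c_def)
  ultimately show thesis using that by blast
qed

lemma egf_num_blob_lists_tendsto: "fps_nth (egf num_blob_lists) \<longlonglongrightarrow> 1 / (1 + rho)"
proof -
  obtain W where W: "abs_summable_fps W" "egf num_blob_lists = fps_const (1 / (1 + rho)) * fps_ones + W"
    using inverse_1_minus_blob_gf[OF egf_num_blob_lists] by blast
  have "(\<lambda>n. 1 / (1 + rho) + fps_nth W n) \<longlonglongrightarrow> 1 / (1 + rho) + 0"
    by (intro tendsto_add tendsto_const summable_LIMSEQ_zero abs_summable_fps_imp_summable W(1))
  moreover have "fps_nth (egf num_blob_lists) = (\<lambda>n. 1 / (1 + rho) + fps_nth W n)"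
    unfolding W(2) by (rule ext) (simp add: fps_ones_def)
  ultimately show ?thesis by simp
qed

lemma egf_ratio: "fps_nth (egf x) n / fps_nth (egf y) n = real (x n) / real (y n)"
  using rho(1) by (simp add: egf_def)

text \<open>Prescribing k leaves at both ends multiplies the series by the square of a monomial of
  degree k + 1, that is, by a shift and a constant. The shift is harmless because the coefficients
  of the series of all blob lists converge to 1 / (1 + rho), which is not 0.\<close>

lemma ended_ratio_tendsto:
  "(\<lambda>n. real (cons_count {k} (cons_count {k} num_blob_lists) n) / real (num_blob_lists n))
    \<longlonglongrightarrow> (rho ^ Suc k / fact k) ^ 2"
proof -
  define U where "U = egf num_blob_lists"
  define a where "a = (rho ^ Suc k / fact k) ^ 2"
  have "blob_gf_on {k} = fps_const (rho ^ Suc k / fact k) * fps_X ^ Suc k"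
  proof (rule fps_ext)
    fix n show "fps_nth (blob_gf_on {k}) n = fps_nth (fps_const (rho ^ Suc k / fact k) * fps_X ^ Suc k) n"
      by (cases n) (auto simp: blob_gf_on_def fps_X_power_nth simp del: power_Suc)
  qed
  then have E: "egf (cons_count {k} (cons_count {k} num_blob_lists)) = fps_const a * (fps_X ^ (2 * Suc k) * U)"
    unfolding egf_ended U_def a_def
    by (simp only: power2_eq_square fps_const_mult[symmetric] mult_2 power_add) (simp only: ac_simps)
  have nth: "fps_nth (egf (cons_count {k} (cons_count {k} num_blob_lists))) (n + 2 * Suc k) = a * fps_nth U n" for n
    unfolding E by (simp add: fps_X_power_mult_nth del: power_Suc)
  have lim: "fps_nth U \<longlonglongrightarrow> 1 / (1 + rho)" unfolding U_def by (rule egf_num_blob_lists_tendsto)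
  have nz: "1 / (1 + rho) \<noteq> 0" using rho by simp
  have "(\<lambda>n. a * fps_nth U n / fps_nth U (n + 2 * Suc k)) \<longlonglongrightarrow> a * (1 / (1 + rho)) / (1 / (1 + rho))"
    by (intro tendsto_intros lim LIMSEQ_ignore_initial_segment nz)
  moreover have "a * fps_nth U n / fps_nth U (n + 2 * Suc k) =
      real (cons_count {k} (cons_count {k} num_blob_lists) (n + 2 * Suc k)) / real (num_blob_lists (n + 2 * Suc k))" for n
    by (subst nth[symmetric], unfold U_def, rule egf_ratio)
  ultimately have "(\<lambda>n. real (cons_count {k} (cons_count {k} num_blob_lists) (n + 2 * Suc k)) / real (num_blob_lists (n + 2 * Suc k)))
    \<longlonglongrightarrow> a" using nz by simp
  then show ?thesis unfolding a_def by (rule LIMSEQ_offset)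
qed

section \<open>Components of caterpillar forests\<close>

definition graph_components :: "'a pair_pre_digraph \<Rightarrow> 'a set set" where
  "graph_components G = (\<lambda>v. (parcs G)\<^sup>* `` {v}) ` pverts G"

definition graph_union :: "'a pair_pre_digraph \<Rightarrow> 'a pair_pre_digraph \<Rightarrow> 'a pair_pre_digraph" where
  "graph_union G H = \<lparr>pverts = pverts G \<union> pverts H, parcs = parcs G \<union> parcs H\<rparr>"

lemma graph_union_simps [simp]:
  "pverts (graph_union G H) = pverts G \<union> pverts H" "parcs (graph_union G H) = parcs G \<union> parcs H"
  by (auto simp: graph_union_def)

lemma rtrancl_in_verts:
  assumes "simple_graph G" "v \<in> pverts G" "(v, u) \<in> (parcs G)\<^sup>*"
  shows "u \<in> pverts G"
  using assms(3,2) by (induction rule: rtrancl_induct) (use simple_graph_arc_verts[OF assms(1)] in auto)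

lemma rtrancl_sym:
  assumes "simple_graph G" "(v, u) \<in> (parcs G)\<^sup>*"
  shows "(u, v) \<in> (parcs G)\<^sup>*"
proof -
  have "sym ((parcs G)\<^sup>*)" using assms(1) by (simp add: simple_graph_def sym_rtrancl)
  then show ?thesis using assms(2) by (rule symD)
qed

lemma component_eq:
  assumes G: "simple_graph G" and S: "S \<in> graph_components G" and v: "v \<in> S"
  shows "S = (parcs G)\<^sup>* `` {v}"
proof -
  obtain w where w: "S = (parcs G)\<^sup>* `` {w}" using S by (auto simp: graph_components_def)
  have "(w, v) \<in> (parcs G)\<^sup>*" "(v, w) \<in> (parcs G)\<^sup>*" using v w rtrancl_sym[OF G] by auto
  then show ?thesis unfolding w by (auto intro: rtrancl_trans)
qed

lemma component_subset:
  assumes "simple_graph G" "S \<in> graph_components G"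
  shows "S \<subseteq> pverts G" "S \<noteq> {}"
proof -
  obtain w where w: "S = (parcs G)\<^sup>* `` {w}" "w \<in> pverts G" using assms(2) by (auto simp: graph_components_def)
  then show "S \<subseteq> pverts G" "S \<noteq> {}" using rtrancl_in_verts[OF assms(1)] by auto
qed

lemma component_closed:
  assumes "simple_graph G" "S \<in> graph_components G" "(u, v) \<in> parcs G" "u \<in> S"
  shows "v \<in> S"
  using component_eq[OF assms(1,2,4)] assms(3) by auto

lemma components_unique:
  assumes "simple_graph G" "S \<in> graph_components G" "T \<in> graph_components G" "v \<in> S" "v \<in> T"
  shows "S = T"
  using component_eq[OF assms(1,2,4)] component_eq[OF assms(1,3,5)] by simp

lemma component_of: "simple_graph G \<Longrightarrow> v \<in> pverts G \<Longrightarrow> (parcs G)\<^sup>* `` {v} \<in> graph_components G \<and> v \<in> (parcs G)\<^sup>* `` {v}"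
  by (auto simp: graph_components_def)

lemma Union_components: "simple_graph G \<Longrightarrow> \<Union> (graph_components G) = pverts G"
proof (intro equalityI subsetI)
  assume G: "simple_graph G"
  fix v
  show "v \<in> pverts G" if "v \<in> \<Union> (graph_components G)" using that component_subset(1)[OF G] by auto
  show "v \<in> \<Union> (graph_components G)" if "v \<in> pverts G" using component_of[OF G that] by (intro UnionI) auto
qed

lemma finite_components: "simple_graph G \<Longrightarrow> finite (graph_components G)"
  by (simp add: graph_components_def simple_graph_def)

lemma components_splits:
  assumes G: "simple_graph G"
  shows "splits G (graph_components G)"
  unfolding splits_def
proof (intro conjI)
  show "finite (graph_components G)" by (rule finite_components[OF G])
  show "\<Union> (graph_components G) = pverts G" by (rule Union_components[OF G])
  show "disjoint (graph_components G)"
    using components_unique[OF G] by (intro disjointI) blast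
  show "\<forall>(u, v)\<in>parcs G. \<exists>S\<in>graph_components G. u \<in> S \<and> v \<in> S"
  proof clarify
    fix u v assume uv: "(u, v) \<in> parcs G"
    then have "u \<in> pverts G" using simple_graph_arc_verts[OF G] by auto
    then show "\<exists>S\<in>graph_components G. u \<in> S \<and> v \<in> S"
      using component_of[OF G, of u] uv by auto
  qed
qed

lemma simple_graph_restrict:
  assumes "simple_graph G" "S \<subseteq> pverts G"
  shows "simple_graph (restrict_graph G S)"
  using assms by (auto simp: simple_graph_def sym_def irrefl_def finite_subset)

lemma rtrancl_restrict:
  assumes closed: "\<And>u w. (u, w) \<in> E \<Longrightarrow> u \<in> T \<Longrightarrow> w \<in> T" and v: "v \<in> T"
  shows "(E \<inter> T \<times> T)\<^sup>* `` {v} = E\<^sup>* `` {v}"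
proof
  show "(E \<inter> T \<times> T)\<^sup>* `` {v} \<subseteq> E\<^sup>* `` {v}" using rtrancl_mono[of "E \<inter> T \<times> T" E] by auto
  have "(v, u) \<in> (E \<inter> T \<times> T)\<^sup>* \<and> u \<in> T" if "(v, u) \<in> E\<^sup>*" for u
    using that
  proof (induction rule: rtrancl_induct)
    case (step y z)
    have "z \<in> T" using closed step by blast
    moreover have "(y, z) \<in> E \<inter> T \<times> T" using step \<open>z \<in> T\<close> by blast
    ultimately show ?case using step.IH by (meson rtrancl.rtrancl_into_rtrancl)
  qed (use v in simp)
  then show "E\<^sup>* `` {v} \<subseteq> (E \<inter> T \<times> T)\<^sup>* `` {v}" by auto
qed

lemma components_restrict:
  assumes closed: "\<And>u w. (u, w) \<in> parcs G \<Longrightarrow> u \<in> T \<Longrightarrow> w \<in> T"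
  shows "graph_components (restrict_graph G T) = (\<lambda>v. (parcs G)\<^sup>* `` {v}) ` T"
  unfolding graph_components_def using rtrancl_restrict[OF closed] by (intro image_cong) auto

lemma components_remove:
  assumes G: "simple_graph G" and S: "S \<in> graph_components G"
  shows "graph_components (restrict_graph G (pverts G - S)) = graph_components G - {S}"
    "\<And>u w. (u, w) \<in> parcs G \<Longrightarrow> u \<in> pverts G - S \<Longrightarrow> w \<in> pverts G - S"
proof -
  show closed: "\<And>u w. (u, w) \<in> parcs G \<Longrightarrow> u \<in> pverts G - S \<Longrightarrow> w \<in> pverts G - S"
    using component_closed[OF G S] simple_graph_arc_verts[OF G] simple_graph_sym[OF G] by blast
  have eq: "graph_components (restrict_graph G (pverts G - S)) = (\<lambda>v. (parcs G)\<^sup>* `` {v}) ` (pverts G - S)"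
    by (rule components_restrict[OF closed])
  show "graph_components (restrict_graph G (pverts G - S)) = graph_components G - {S}"
    unfolding eq
  proof (intro equalityI subsetI)
    fix T assume "T \<in> (\<lambda>v. (parcs G)\<^sup>* `` {v}) ` (pverts G - S)"
    then obtain v where v: "v \<in> pverts G" "v \<notin> S" "T = (parcs G)\<^sup>* `` {v}" by auto
    then have "T \<noteq> S" by auto
    then show "T \<in> graph_components G - {S}" using v by (auto simp: graph_components_def)
  next
    fix T assume T: "T \<in> graph_components G - {S}"
    then obtain v where v: "v \<in> pverts G" "T = (parcs G)\<^sup>* `` {v}" by (auto simp: graph_components_def)
    have "v \<notin> S" using component_eq[OF G S, of v] T v by auto
    then show "T \<in> (\<lambda>v. (parcs G)\<^sup>* `` {v}) ` (pverts G - S)" using v by auto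
  qed
qed

lemma restrict_restrict: "S \<subseteq> T \<Longrightarrow> restrict_graph (restrict_graph G T) S = restrict_graph G S"
  by (auto simp: restrict_graph_def)

lemma sccs_eq_components:
  assumes G: "simple_graph G"
  shows "pre_digraph.sccs (with_proj G) = (\<lambda>S. with_proj (restrict_graph G S)) ` graph_components G"
proof -
  have "graph (with_proj G)" using G by (simp add: simple_graph_iff)
  then interpret W: graph "with_proj G" .
  have scc: "W.scc_of u = (parcs G)\<^sup>* `` {u}" if u: "u \<in> pverts G" for u
  proof (intro equalityI subsetI)
    fix v assume "v \<in> W.scc_of u"
    then show "v \<in> (parcs G)\<^sup>* `` {u}"
      using simple_graph_reachable_iff[OF G u] by (simp add: W.scc_of_def)
  next
    fix v assume v: "v \<in> (parcs G)\<^sup>* `` {u}"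
    then have "v \<in> pverts G" using rtrancl_in_verts[OF G u] by simp
    then show "v \<in> W.scc_of u"
      using simple_graph_reachable_iff[OF G u, of v] simple_graph_reachable_iff[OF G, of v u] rtrancl_sym[OF G, of u v] v
      by (simp add: W.scc_of_def)
  qed
  have "W.sccs_verts = W.scc_of ` pverts G" using W.sccs_verts_conv_scc_of by simp
  also have "\<dots> = graph_components G" unfolding graph_components_def using scc by (intro image_cong) auto
  finally have v: "W.sccs_verts = graph_components G" .
  have "induce_subgraph (with_proj G) S = with_proj (restrict_graph G S)" for S
    by (rule pre_digraph.equality) auto
  then show ?thesis unfolding W.sccs_conv_sccs_verts v by simp
qed

lemma caterpillar_forest_iff:
  "caterpillar_forest (with_proj G) \<longleftrightarrow>
     simple_graph G \<and> (\<forall>S\<in>graph_components G. caterpillar (with_proj (restrict_graph G S)))"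
  unfolding caterpillar_forest_def simple_graph_iff using sccs_eq_components[of G] by auto

definition forests :: "'a set \<Rightarrow> 'a pair_pre_digraph set" where
  "forests V = {G. pverts G = V \<and> caterpillar_forest (with_proj G)}"

lemma forestsD:
  assumes "G \<in> forests V"
  shows "simple_graph G" "pverts G = V" "\<And>S. S \<in> graph_components G \<Longrightarrow> restrict_graph G S \<in> caterpillars S"
  using assms by (auto simp: forests_def caterpillar_forest_iff caterpillars_def)

lemma caterpillarsD:
  assumes "A \<in> caterpillars S"
  shows "simple_graph A" "pverts A = S" "\<And>u v. u \<in> S \<Longrightarrow> v \<in> S \<Longrightarrow> (u, v) \<in> (parcs A)\<^sup>*" "S \<noteq> {}"
proof -
  have tree: "undirected_tree (with_proj A)" using assms by (simp add: caterpillars_def caterpillar_def)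
  then show A: "simple_graph A" by (simp add: undirected_tree_def simple_graph_iff)
  show "pverts A = S" using assms by (simp add: caterpillars_def)
  then show "\<And>u v. u \<in> S \<Longrightarrow> v \<in> S \<Longrightarrow> (u, v) \<in> (parcs A)\<^sup>*" "S \<noteq> {}"
    using tree connected_iff_rtrancl[OF A] by (auto simp: undirected_tree_def)
qed

lemma forest_remove:
  assumes "G \<in> forests V" "S \<in> graph_components G"
  shows "restrict_graph G (V - S) \<in> forests (V - S)"
proof -
  note G = forestsD[OF assms(1)]
  have "simple_graph (restrict_graph G (V - S))" using G by (intro simple_graph_restrict) auto
  moreover have "caterpillar (with_proj (restrict_graph (restrict_graph G (V - S)) T))"
    if T: "T \<in> graph_components (restrict_graph G (V - S))" for T
  proof -
    have "T \<subseteq> V - S" using component_subset(1)[OF \<open>simple_graph (restrict_graph G (V - S))\<close> T] by simp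
    moreover have "T \<in> graph_components G" using T components_remove(1)[OF G(1) assms(2)] G(2) by auto
    ultimately show ?thesis using G(3)[of T] by (simp add: restrict_restrict caterpillars_def)
  qed
  ultimately show ?thesis by (simp add: forests_def caterpillar_forest_iff)
qed

lemma graph_union_restrict:
  assumes G: "simple_graph G" and S: "S \<in> graph_components G"
  shows "graph_union (restrict_graph G S) (restrict_graph G (pverts G - S)) = G"
proof (rule pair_pre_digraph.equality)
  show "pverts (graph_union (restrict_graph G S) (restrict_graph G (pverts G - S))) = pverts G"
    using component_subset(1)[OF G S] by auto
  have "(u, v) \<in> S \<times> S \<or> (u, v) \<in> (pverts G - S) \<times> (pverts G - S)" if "(u, v) \<in> parcs G" for u v
    using component_closed[OF G S that] components_remove(2)[OF G S that] simple_graph_arc_verts[OF G that] by blast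
  then show "parcs (graph_union (restrict_graph G S) (restrict_graph G (pverts G - S))) = parcs G"
    by auto
qed simp

text \<open>The inverse of removing a component: \<open>S\<close> is again a component, and both
  parts are recovered by restriction.\<close>

lemma graph_union_forest:
  assumes A: "A \<in> caterpillars S" and B: "B \<in> forests (V - S)" and S: "S \<subseteq> V"
  shows "graph_union A B \<in> forests V" "S \<in> graph_components (graph_union A B)"
    "restrict_graph (graph_union A B) S = A" "restrict_graph (graph_union A B) (V - S) = B"
proof -
  let ?G = "graph_union A B"
  note A' = caterpillarsD[OF A] and B' = forestsD[OF B]
  have EA: "parcs A \<subseteq> S \<times> S" and EB: "parcs B \<subseteq> (V - S) \<times> (V - S)"
    using A'(1,2) B'(1,2) by (auto simp: simple_graph_def)
  have V: "pverts ?G = V" using A'(2) B'(2) S by auto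
  have G: "simple_graph ?G"
    using A'(1) B'(1) by (auto simp: simple_graph_def irrefl_def sym_Un)
  show RA: "restrict_graph ?G S = A"
    using EA EB A'(2) by (intro pair_pre_digraph.equality) auto
  show RB: "restrict_graph ?G (V - S) = B"
    using EA EB B'(2) by (intro pair_pre_digraph.equality) auto
  obtain s where s: "s \<in> S" using A'(4) by auto
  have "(parcs ?G \<inter> S \<times> S)\<^sup>* `` {s} = (parcs ?G)\<^sup>* `` {s}"
    using EA EB s by (intro rtrancl_restrict) auto
  moreover have "parcs ?G \<inter> S \<times> S = parcs A" using EA EB by auto
  moreover have "(parcs A)\<^sup>* `` {s} = S"
    using A'(3)[OF s] rtrancl_in_verts[OF A'(1)] A'(2) s by auto
  ultimately have Ss: "(parcs ?G)\<^sup>* `` {s} = S" by simp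
  then show SC: "S \<in> graph_components ?G" using component_of[OF G, of s] V s S by auto
  have "caterpillar (with_proj (restrict_graph ?G T))" if T: "T \<in> graph_components ?G" for T
  proof (cases "T = S")
    case True
    then show ?thesis using RA A by (simp add: caterpillars_def)
  next
    case False
    then have TB: "T \<in> graph_components B" using components_remove(1)[OF G SC] T V RB by auto
    then have "T \<subseteq> V - S" using component_subset(1)[OF B'(1)] B'(2) by auto
    then have "restrict_graph ?G T = restrict_graph B T"
      using restrict_restrict[of T "V - S" ?G] RB by simp
    then show ?thesis using B'(3)[OF TB] by (simp add: caterpillars_def)
  qed
  then show "?G \<in> forests V" using G V by (simp add: forests_def caterpillar_forest_iff)
qed

lemma finite_forests:
  assumes "finite V"
  shows "finite (forests V)"
proof (rule finite_subset)
  show "forests V \<subseteq> (\<lambda>E. \<lparr>pverts = V, parcs = E\<rparr>) ` Pow (V \<times> V)"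
  proof
    fix G assume G: "G \<in> forests V"
    then have "parcs G \<in> Pow (V \<times> V)" using forestsD(1,2)[OF G] by (auto simp: simple_graph_def)
    moreover have "G = \<lparr>pverts = V, parcs = parcs G\<rparr>" using forestsD(2)[OF G] by (cases G) simp
    ultimately show "G \<in> (\<lambda>E. \<lparr>pverts = V, parcs = E\<rparr>) ` Pow (V \<times> V)" by blast
  qed
qed (use assms in auto)

text \<open>Removing a marked component from a forest is a bijection; the weights \<open>w\<close> and \<open>z\<close> select
  which components are marked and which remainders are allowed.\<close>

lemma sum_forests_components:
  fixes w z :: "'a pair_pre_digraph \<Rightarrow> nat"
  assumes V: "finite V"
  shows "(\<Sum>G\<in>forests V. \<Sum>S\<in>graph_components G. w (restrict_graph G S) * z (restrict_graph G (V - S))) =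
    (\<Sum>S\<in>Pow V. (\<Sum>A\<in>caterpillars S. w A) * (\<Sum>B\<in>forests (V - S). z B))"
proof -
  define D where "D = (SIGMA G:forests V. graph_components G)"
  define P where "P = (SIGMA S:Pow V. caterpillars S \<times> forests (V - S))"
  have finC: "finite (graph_components G)" if "G \<in> forests V" for G
    using finite_components forestsD(1)[OF that] by blast
  have finP: "finite (caterpillars S \<times> forests (V - S))" if "S \<in> Pow V" for S
  proof -
    have "finite S" using that V finite_subset by auto
    then have "finite (caterpillars S)" using card_blob_lists[of S] finite_subset[of "caterpillars S" "blob_graph ` blob_lists S"]
      by (auto elim!: caterpillarsE)
    then show ?thesis using finite_forests[of "V - S"] V by simp
  qed
  have "(\<Sum>G\<in>forests V. \<Sum>S\<in>graph_components G. w (restrict_graph G S) * z (restrict_graph G (V - S))) =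
      (\<Sum>(G, S)\<in>D. w (restrict_graph G S) * z (restrict_graph G (V - S)))"
    unfolding D_def using finite_forests[OF V] finC by (intro sum.Sigma) auto
  also have "\<dots> = (\<Sum>(S, A, B)\<in>P. w A * z B)"
  proof (rule sum.reindex_bij_witness[of _ "\<lambda>(S, A, B). (graph_union A B, S)"
        "\<lambda>(G, S). (S, restrict_graph G S, restrict_graph G (V - S))"])
    fix x assume "x \<in> D"
    then obtain G S where x: "x = (G, S)" "G \<in> forests V" "S \<in> graph_components G" by (auto simp: D_def)
    note G = forestsD[OF x(2)]
    show "(case case x of (G, S) \<Rightarrow> (S, restrict_graph G S, restrict_graph G (V - S)) of
        (S, A, B) \<Rightarrow> (graph_union A B, S)) = x"
      using graph_union_restrict[OF G(1) x(3)] G(2) x(1) by simp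
    show "(case x of (G, S) \<Rightarrow> (S, restrict_graph G S, restrict_graph G (V - S))) \<in> P"
      using forest_remove[OF x(2,3)] G(3)[OF x(3)] component_subset(1)[OF G(1) x(3)] G(2) x(1) by (simp add: P_def)
    show "(case case x of (G, S) \<Rightarrow> (S, restrict_graph G S, restrict_graph G (V - S)) of (S, A, B) \<Rightarrow> w A * z B) =
        (case x of (G, S) \<Rightarrow> w (restrict_graph G S) * z (restrict_graph G (V - S)))"
      using x(1) by simp
  next
    fix y assume "y \<in> P"
    then obtain S A B where y: "y = (S, A, B)" "S \<subseteq> V" "A \<in> caterpillars S" "B \<in> forests (V - S)"
      by (auto simp: P_def)
    note U = graph_union_forest[OF y(3,4,2)]
    show "(case case y of (S, A, B) \<Rightarrow> (graph_union A B, S) of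
        (G, S) \<Rightarrow> (S, restrict_graph G S, restrict_graph G (V - S))) = y"
      using U(3,4) y(1) by simp
    show "(case y of (S, A, B) \<Rightarrow> (graph_union A B, S)) \<in> D"
      using U(1,2) y(1) by (simp add: D_def)
  qed
  also have "\<dots> = (\<Sum>S\<in>Pow V. \<Sum>(A, B)\<in>caterpillars S \<times> forests (V - S). w A * z B)"
    unfolding P_def using V finP
    by (subst sum.Sigma[symmetric]) auto
  also have "\<dots> = (\<Sum>S\<in>Pow V. (\<Sum>A\<in>caterpillars S. w A) * (\<Sum>B\<in>forests (V - S). z B))"
    by (intro sum.cong refl) (simp add: sum_product sum.cartesian_product)
  finally show ?thesis .
qed

section \<open>Invariance under relabelling\<close>

lemma bij_extension:
  fixes A B :: "nat set"
  assumes "finite A" "finite B" and g: "bij_betw g A B"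
  obtains f where "bij f" "\<And>x. x \<in> A \<Longrightarrow> f x = g x"
proof -
  have "bij_betw (enumerate (- A)) UNIV (- A)" "bij_betw (enumerate (- B)) UNIV (- B)"
    using assms by (auto intro!: bij_enumerate)
  then have h: "bij_betw (enumerate (- B) \<circ> inv_into UNIV (enumerate (- A))) (- A) (- B)"
    by (meson bij_betw_inv_into bij_betw_trans)
  define f where "f = (\<lambda>x. if x \<in> A then g x else (enumerate (- B) \<circ> inv_into UNIV (enumerate (- A))) x)"
  have 1: "bij_betw f A B" using g bij_betw_cong[of A f g B] by (simp add: f_def)
  have 2: "bij_betw f (- A) (- B)"
    using h bij_betw_cong[of "- A" f "enumerate (- B) \<circ> inv_into UNIV (enumerate (- A))" "- B"] by (simp add: f_def)
  have "bij f" using bij_betw_combine[OF 1 2] by simp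
  then show thesis by (rule that) (simp add: f_def)
qed

lemma bij_extending:
  fixes A B :: "nat set"
  assumes "finite A" "finite B" "card A = card B"
  obtains f where "bij f" "f ` A = B"
proof -
  obtain g where g: "bij_betw g A B" using finite_same_card_bij[OF assms] by blast
  obtain f where f: "bij f" "\<And>x. x \<in> A \<Longrightarrow> f x = g x" using bij_extension[OF assms(1,2) g] by metis
  then have "f ` A = B" using g by (simp add: bij_betw_def)
  with f(1) show thesis by (rule that)
qed

text \<open>Quantifying over bijections of all of \<open>nat\<close> loses nothing on finite graphs:
  by \<open>bij_extension\<close>, a bijection between finite vertex sets extends to such a map, the
  infinite complements being enumerated.\<close>

definition iso_invariant :: "(nat pair_pre_digraph \<Rightarrow> 'b) \<Rightarrow> bool" where
  "iso_invariant K \<longleftrightarrow> (\<forall>f G. bij f \<longrightarrow> K (map_graph f G) = K G)"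

lemma map_graph_inv: "bij f \<Longrightarrow> map_graph (inv f) (map_graph f G) = G" "bij f \<Longrightarrow> map_graph f (map_graph (inv f) G) = G"
  using map_graph_id by (simp_all add: map_graph_comp inv_o_cancel bij_is_inj surj_iff[THEN iffD1] bij_is_surj id_def)

lemma simple_graph_map: "inj f \<Longrightarrow> simple_graph G \<Longrightarrow> simple_graph (map_graph f G)"
  by (auto simp: simple_graph_def sym_def irrefl_def inj_eq)

lemma rtrancl_map_prod:
  assumes "inj f"
  shows "(map_prod f f ` E)\<^sup>* `` {f v} = f ` (E\<^sup>* `` {v})"
proof (intro equalityI subsetI)
  fix x assume "x \<in> (map_prod f f ` E)\<^sup>* `` {f v}"
  then have "(f v, x) \<in> (map_prod f f ` E)\<^sup>*" by simp
  then show "x \<in> f ` (E\<^sup>* `` {v})"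
  proof (induction rule: rtrancl_induct)
    case (step y z)
    then obtain a b where "(a, b) \<in> E" "y = f a" "z = f b" by auto
    moreover obtain c where "y = f c" "(v, c) \<in> E\<^sup>*" using step.IH by auto
    ultimately have "(v, b) \<in> E\<^sup>*" using assms by (metis inj_eq rtrancl.rtrancl_into_rtrancl)
    then show ?case using \<open>z = f b\<close> by auto
  qed auto
next
  fix x assume "x \<in> f ` (E\<^sup>* `` {v})"
  then obtain u where u: "x = f u" "(v, u) \<in> E\<^sup>*" by auto
  have "(f v, f u) \<in> (map_prod f f ` E)\<^sup>*" using u(2)
  proof (induction rule: rtrancl_induct)
    case (step y z)
    have "(f y, f z) \<in> map_prod f f ` E" using step.hyps(2) by force
    with step.IH show ?case by (rule rtrancl.rtrancl_into_rtrancl)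
  qed auto
  then show "x \<in> (map_prod f f ` E)\<^sup>* `` {f v}" using u(1) by simp
qed

lemma components_map_graph:
  assumes "inj f"
  shows "graph_components (map_graph f G) = image f ` graph_components G"
  unfolding graph_components_def by (simp add: image_image rtrancl_map_prod[OF assms])

lemma restrict_map_graph:
  assumes "inj f"
  shows "restrict_graph (map_graph f G) (f ` S) = map_graph f (restrict_graph G S)"
proof (rule pair_pre_digraph.equality)
  show "parcs (restrict_graph (map_graph f G) (f ` S)) = parcs (map_graph f (restrict_graph G S))"
    using assms by (auto simp: inj_eq intro: rev_image_eqI)
qed simp_all

lemma caterpillars_map: "bij f \<Longrightarrow> A \<in> caterpillars V \<Longrightarrow> map_graph f A \<in> caterpillars (f ` V)"
  using caterpillar_map_graph[of f A] by (auto simp: caterpillars_def bij_is_inj)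

lemma forests_map:
  assumes "bij f" "G \<in> forests V"
  shows "map_graph f G \<in> forests (f ` V)"
proof -
  note G = forestsD[OF assms(2)]
  have f: "inj f" using assms(1) by (rule bij_is_inj)
  have "caterpillar (with_proj (restrict_graph (map_graph f G) T))" if T: "T \<in> graph_components (map_graph f G)" for T
  proof -
    obtain S where S: "S \<in> graph_components G" "T = f ` S"
      using T unfolding components_map_graph[OF f] by auto
    then show ?thesis
      using G(3)[OF S(1)] caterpillar_map_graph[OF f] by (simp add: restrict_map_graph[OF f] caterpillars_def)
  qed
  then show ?thesis
    using simple_graph_map[OF f G(1)] G(2) by (simp add: forests_def caterpillar_forest_iff)
qed

lemma card_Collect_map_graph:
  assumes f: "bij f" and K: "iso_invariant K"
    and X: "\<And>G. G \<in> X \<Longrightarrow> map_graph f G \<in> Y" and Y: "\<And>G. G \<in> Y \<Longrightarrow> map_graph (inv f) G \<in> X"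
  shows "card {G \<in> X. K G} = card {G \<in> Y. K G}"
proof (rule bij_betw_same_card)
  have f': "bij (inv f)" using f by (rule bij_imp_bij_inv)
  have K1: "K (map_graph f G) = K G" "K (map_graph (inv f) G) = K G" for G
    using K f f' unfolding iso_invariant_def by blast+
  show "bij_betw (map_graph f) {G \<in> X. K G} {G \<in> Y. K G}"
    by (rule bij_betw_byWitness[where f' = "map_graph (inv f)"])
      (use f X Y K1 in \<open>auto simp: map_graph_inv\<close>)
qed

definition count_caterpillars :: "(nat pair_pre_digraph \<Rightarrow> bool) \<Rightarrow> nat \<Rightarrow> nat" where
  "count_caterpillars K n = card {A \<in> caterpillars {1..n}. K A}"

definition count_forests :: "(nat pair_pre_digraph \<Rightarrow> bool) \<Rightarrow> nat \<Rightarrow> nat" where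
  "count_forests K n = card {A \<in> forests {1..n}. K A}"

lemma card_caterpillars_iso:
  assumes K: "iso_invariant K" and V: "finite V"
  shows "card {A \<in> caterpillars V. K A} = count_caterpillars K (card V)"
proof -
  obtain f where f: "bij f" "f ` V = {1..card V}" using bij_extending[of V "{1..card V}"] V by auto
  have "inv f ` {1..card V} = V" using f by (metis bij_is_inj image_inv_f_f)
  then show ?thesis unfolding count_caterpillars_def
    using caterpillars_map[OF f(1), of _ V] caterpillars_map[OF bij_imp_bij_inv[OF f(1)], of _ "{1..card V}"] f(2)
    by (intro card_Collect_map_graph[OF f(1) K]) auto
qed

lemma card_forests_iso:
  assumes K: "iso_invariant K" and V: "finite V"
  shows "card {A \<in> forests V. K A} = count_forests K (card V)"
proof -
  obtain f where f: "bij f" "f ` V = {1..card V}" using bij_extending[of V "{1..card V}"] V by auto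
  have "inv f ` {1..card V} = V" using f by (metis bij_is_inj image_inv_f_f)
  then show ?thesis unfolding count_forests_def
    using forests_map[OF f(1), of _ V] forests_map[OF bij_imp_bij_inv[OF f(1)], of _ "{1..card V}"] f(2)
    by (intro card_Collect_map_graph[OF f(1) K]) auto
qed

definition component_count :: "('a pair_pre_digraph \<Rightarrow> bool) \<Rightarrow> 'a pair_pre_digraph \<Rightarrow> nat" where
  "component_count K G = card {S \<in> graph_components G. K (restrict_graph G S)}"

lemma component_count_map_graph:
  assumes K: "iso_invariant K" and f: "bij f"
  shows "component_count K (map_graph f G) = component_count K G"
proof -
  have inj: "inj f" using f by (rule bij_is_inj)
  have K': "K (map_graph f A) = K A" for A using K f by (simp add: iso_invariant_def)
  have "{S \<in> graph_components (map_graph f G). K (restrict_graph (map_graph f G) S)} =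
      image f ` {S \<in> graph_components G. K (restrict_graph G S)}"
    unfolding components_map_graph[OF inj] by (auto simp: restrict_map_graph[OF inj] K')
  moreover have "inj_on (image f) X" for X using inj by (meson inj_image_eq_iff inj_onI)
  ultimately show ?thesis unfolding component_count_def by (simp add: card_image)
qed

lemma component_count_remove:
  assumes G: "simple_graph G" and S: "S \<in> graph_components G"
  shows "component_count K G =
    component_count K (restrict_graph G (pverts G - S)) + (if K (restrict_graph G S) then 1 else 0)"
proof -
  let ?X = "{T \<in> graph_components G. K (restrict_graph G T)}"
  have "{T \<in> graph_components (restrict_graph G (pverts G - S)). K (restrict_graph (restrict_graph G (pverts G - S)) T)} = ?X - {S}"
  proof -
    have "restrict_graph (restrict_graph G (pverts G - S)) T = restrict_graph G T"
      if T: "T \<in> graph_components G - {S}" for T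
    proof (rule restrict_restrict)
      have "T \<inter> S = {}" using components_unique[OF G, of T S] T S by auto
      then show "T \<subseteq> pverts G - S" using component_subset(1)[OF G, of T] T by auto
    qed
    then have "{T \<in> graph_components G - {S}. K (restrict_graph (restrict_graph G (pverts G - S)) T)} =
        {T \<in> graph_components G - {S}. K (restrict_graph G T)}" by (metis (no_types, lifting))
    also have "\<dots> = ?X - {S}" by blast
    finally show ?thesis unfolding components_remove(1)[OF G S] .
  qed
  then have *: "component_count K (restrict_graph G (pverts G - S)) = card (?X - {S})"
    by (simp add: component_count_def)
  have fin: "finite ?X" using finite_components[OF G] by simp
  show ?thesis
  proof (cases "K (restrict_graph G S)")
    case True
    then have "S \<in> ?X" using S by simp
    then show ?thesis using True * fin card_Suc_Diff1[OF fin, of S] by (simp add: component_count_def)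
  next
    case False
    then have "?X - {S} = ?X" by auto
    then show ?thesis using False * by (simp add: component_count_def)
  qed
qed

text \<open>The weight \<open>c\<close> depends on the size of the marked component. Weight 1 marks
  a component of a class, as in the recursion on counts; weight equal to the size marks a vertex, as
  in the differential equation.\<close>

lemma sum_forests_components_iso:
  fixes V :: "nat set"
  assumes V: "finite V" and K: "iso_invariant K" and Z: "iso_invariant Z"
  shows "(\<Sum>G\<in>forests V. \<Sum>S\<in>graph_components G.
      (if K (restrict_graph G S) then c (card S) else 0) * (if Z (restrict_graph G (V - S)) then 1 else 0)) =
    (\<Sum>k\<le>card V. (card V choose k) * ((c k * count_caterpillars K k) * count_forests Z (card V - k)))"
proof -
  let ?w = "\<lambda>A. if K A then c (card (pverts A)) else 0" and ?z = "\<lambda>B. if Z B then 1 else (0 :: nat)"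
  have 1: "(\<Sum>A\<in>caterpillars S. ?w A) = c (card S) * count_caterpillars K (card S)" if "S \<subseteq> V" for S
  proof -
    have S: "finite S" using that V finite_subset by blast
    have "(\<Sum>A\<in>caterpillars S. ?w A) = (\<Sum>A\<in>{A \<in> caterpillars S. K A}. c (card S))"
      using finite_caterpillars(1)[OF S]
      by (intro sum.mono_neutral_cong_right) (auto simp: caterpillars_def)
    then show ?thesis using card_caterpillars_iso[OF K S] by simp
  qed
  have 2: "(\<Sum>B\<in>forests (V - S). ?z B) = count_forests Z (card V - card S)" if "S \<subseteq> V" for S
  proof -
    have S: "finite S" using that V finite_subset by blast
    have "(\<Sum>B\<in>forests (V - S). ?z B) = (\<Sum>B\<in>{B \<in> forests (V - S). Z B}. 1)"
      using finite_forests[of "V - S"] V by (intro sum.mono_neutral_cong_right) auto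
    also have "\<dots> = count_forests Z (card (V - S))" using card_forests_iso[OF Z, of "V - S"] V by simp
    finally show ?thesis using card_Diff_subset[OF S that] by simp
  qed
  have "(\<Sum>G\<in>forests V. \<Sum>S\<in>graph_components G.
      (if K (restrict_graph G S) then c (card S) else 0) * (if Z (restrict_graph G (V - S)) then 1 else 0)) =
    (\<Sum>G\<in>forests V. \<Sum>S\<in>graph_components G. ?w (restrict_graph G S) * ?z (restrict_graph G (V - S)))"
    unfolding restrict_graph_simps ..
  also have "\<dots> = (\<Sum>S\<in>Pow V. (\<Sum>A\<in>caterpillars S. ?w A) * (\<Sum>B\<in>forests (V - S). ?z B))"
    by (rule sum_forests_components[OF V])
  also have "\<dots> = (\<Sum>S\<in>Pow V. (c (card S) * count_caterpillars K (card S)) * count_forests Z (card V - card S))"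
    by (intro sum.cong refl) (use 1 2 in auto)
  also have "\<dots> = (\<Sum>k\<le>card V. (card V choose k) * ((c k * count_caterpillars K k) * count_forests Z (card V - k)))"
    using sum_card_Pow[OF V, where I = UNIV and g = "\<lambda>k. (c k * count_caterpillars K k) * count_forests Z (card V - k)"]
    by (simp add: Pow_def atMost_def)
  finally show ?thesis .
qed

lemma egf_convolution:
  assumes "\<And>n. x n = (\<Sum>k\<le>n. (n choose k) * (a k * b (n - k)))"
  shows "egf x = egf a * egf b"
proof (rule fps_ext)
  fix n
  have summand: "real ((n choose k) * (a k * b (n - k))) * rho ^ n / fact n =
      (real (a k) * rho ^ k / fact k) * (real (b (n - k)) * rho ^ (n - k) / fact (n - k))" if "k \<le> n" for k
  proof -
    have b: "real (n choose k) = fact n / (fact k * fact (n - k))" by (rule binomial_fact[OF that])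
    have p: "rho ^ n = rho ^ k * rho ^ (n - k)" using that by (simp flip: power_add)
    show ?thesis unfolding of_nat_mult b p by simp
  qed
  have "fps_nth (egf x) n = (\<Sum>k\<le>n. real ((n choose k) * (a k * b (n - k))) * rho ^ n / fact n)"
    by (simp add: egf_def assms[of n] sum_distrib_right sum_divide_distrib)
  also have "\<dots> = fps_nth (egf a * egf b) n"
    unfolding fps_mult_nth_atMost by (rule sum.cong) (use summand in \<open>auto simp: egf_def\<close>)
  finally show "fps_nth (egf x) n = fps_nth (egf a * egf b) n" .
qed

lemma egf_add: "egf (\<lambda>n. x n + y n) = egf x + egf y"
  by (rule fps_ext) (simp add: egf_def distrib_right add_divide_distrib)

lemma egf_mult_const: "egf (\<lambda>n. c * x n) = fps_const (real c) * egf x"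
  by (rule fps_ext) (simp add: egf_def)

definition profile :: "'i set \<Rightarrow> ('i \<Rightarrow> 'a pair_pre_digraph \<Rightarrow> bool) \<Rightarrow> ('i \<Rightarrow> nat) \<Rightarrow> 'a pair_pre_digraph \<Rightarrow> bool" where
  "profile J K m G \<longleftrightarrow> (\<forall>i\<in>J. component_count (K i) G = m i)"

lemma iso_invariant_profile:
  assumes "\<And>i. i \<in> J \<Longrightarrow> iso_invariant (K i)"
  shows "iso_invariant (profile J K m)"
  using component_count_map_graph assms unfolding iso_invariant_def[of "profile J K m"] profile_def by simp

text \<open>A forest with this profile has m j ways to mark a component of class \<open>K j\<close>;
  removing it lowers that count by one and, the classes being disjoint, no other.\<close>

lemma egf_profile_step:
  assumes K: "\<And>i. i \<in> J \<Longrightarrow> iso_invariant (K i)"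
    and disj: "\<And>i i' A. i \<in> J \<Longrightarrow> i' \<in> J \<Longrightarrow> K i A \<Longrightarrow> K i' A \<Longrightarrow> i = i'"
    and j: "j \<in> J" and m: "m j = Suc l"
  shows "fps_const (real (m j)) * egf (count_forests (profile J K m)) =
    egf (count_caterpillars (K j)) * egf (count_forests (profile J K (m(j := l))))"
proof -
  let ?m' = "m(j := l)"
  have "m j * count_forests (profile J K m) n =
    (\<Sum>k\<le>n. (n choose k) * (count_caterpillars (K j) k * count_forests (profile J K ?m') (n - k)))" for n
  proof -
    let ?V = "{1..n}"
    have inner: "(\<Sum>S\<in>graph_components G. (if K j (restrict_graph G S) then 1 else 0) *
        (if profile J K ?m' (restrict_graph G (?V - S)) then 1 else 0)) = (if profile J K m G then m j else 0)"
      if G: "G \<in> forests ?V" for G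
    proof -
      note G' = forestsD[OF G]
      have eq: "profile J K ?m' (restrict_graph G (?V - S)) \<longleftrightarrow> profile J K m G"
        if S: "S \<in> graph_components G" "K j (restrict_graph G S)" for S
      proof -
        have "component_count (K i) (restrict_graph G (?V - S)) = ?m' i \<longleftrightarrow> component_count (K i) G = m i"
          if "i \<in> J" for i
        proof (cases "i = j")
          case True
          then show ?thesis using component_count_remove[OF G'(1) S(1), of "K j"] G'(2) S(2) m by simp
        next
          case False
          then have "\<not> K i (restrict_graph G S)" using disj[OF that j] S(2) by metis
          then show ?thesis using component_count_remove[OF G'(1) S(1), of "K i"] G'(2) False by simp
        qed
        then show ?thesis by (simp add: profile_def)
      qed
      have "(\<Sum>S\<in>graph_components G. (if K j (restrict_graph G S) then 1 else 0) *
          (if profile J K ?m' (restrict_graph G (?V - S)) then 1 else 0)) =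
        (\<Sum>S\<in>{S \<in> graph_components G. K j (restrict_graph G S)}. if profile J K m G then 1 else (0 :: nat))"
        using finite_components[OF G'(1)] eq by (intro sum.mono_neutral_cong_right) auto
      also have "\<dots> = (if profile J K m G then component_count (K j) G else 0)"
        by (simp add: component_count_def)
      also have "\<dots> = (if profile J K m G then m j else 0)" using j by (auto simp: profile_def)
      finally show ?thesis .
    qed
    have "m j * count_forests (profile J K m) n = (\<Sum>G\<in>{G \<in> forests ?V. profile J K m G}. m j)"
      by (simp add: count_forests_def)
    also have "\<dots> = (\<Sum>G\<in>forests ?V. if profile J K m G then m j else 0)"
      using finite_forests[of ?V] by (intro sum.mono_neutral_cong_left) auto
    also have "\<dots> = (\<Sum>G\<in>forests ?V. \<Sum>S\<in>graph_components G. (if K j (restrict_graph G S) then 1 else 0) *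
        (if profile J K ?m' (restrict_graph G (?V - S)) then 1 else 0))"
      using inner by simp
    also have "\<dots> = (\<Sum>k\<le>card ?V. (card ?V choose k) * ((1 * count_caterpillars (K j) k) * count_forests (profile J K ?m') (card ?V - k)))"
      by (rule sum_forests_components_iso[of ?V "K j" "profile J K ?m'" "\<lambda>_. 1"])
        (use K j iso_invariant_profile[OF K] in auto)
    finally show ?thesis by simp
  qed
  then have "egf (\<lambda>n. m j * count_forests (profile J K m) n) =
      egf (count_caterpillars (K j)) * egf (count_forests (profile J K ?m'))"
    by (rule egf_convolution)
  then show ?thesis by (simp add: egf_mult_const)
qed

lemma count_caterpillars_0: "count_caterpillars K 0 = 0"
  by (simp add: count_caterpillars_def caterpillars_empty)

lemma forests_empty: "forests {} = {\<lparr>pverts = {}, parcs = {}\<rparr>}"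
proof (intro equalityI subsetI)
  fix G :: "'a pair_pre_digraph" assume G: "G \<in> forests {}"
  then have "pverts G = {}" "parcs G = {}" using forestsD(1,2)[OF G] by (auto simp: simple_graph_def)
  then show "G \<in> {\<lparr>pverts = {}, parcs = {}\<rparr>}" by (cases G) auto
qed (auto simp: forests_def caterpillar_forest_iff simple_graph_def graph_components_def irrefl_def sym_def)

text \<open>Marking a vertex: component sizes add up to n, so n times the number of forests counts
  pairs of the component of a marked vertex and the remaining forest. This is the coefficient form
  of F' = A' * F. A forest avoids \<open>U\<close> exactly if both the component and the rest
  do.\<close>

lemma egf_count_forests_avoiding:
  assumes U: "iso_invariant U"
  shows "egf (count_forests (\<lambda>G. component_count U G = 0)) = fps_Exp (egf (count_caterpillars (\<lambda>A. \<not> U A)))"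
proof (rule fps_Exp_unique_recurrence)
  let ?Z = "\<lambda>G. component_count U G = 0" and ?K = "\<lambda>A. \<not> U A"
  show "fps_nth (egf (count_caterpillars ?K)) 0 = 0" by (simp add: egf_def count_caterpillars_0)
  have e: "forests {1..0 :: nat} = {\<lparr>pverts = {}, parcs = {}\<rparr>}" by (simp add: forests_empty)
  have "?Z \<lparr>pverts = {}, parcs = {}\<rparr>" by (simp add: component_count_def graph_components_def)
  then have "{A \<in> forests {1..0}. ?Z A} = {\<lparr>pverts = {}, parcs = {}\<rparr>}" unfolding e by blast
  then have "count_forests ?Z 0 = 1" unfolding count_forests_def by simp
  then show "fps_nth (egf (count_forests ?Z)) 0 = 1" by (simp add: egf_def)
  have K: "iso_invariant ?K" using U by (simp add: iso_invariant_def)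
  have Z: "iso_invariant ?Z" using component_count_map_graph[OF U] by (simp add: iso_invariant_def)
  have rec: "n * count_forests ?Z n =
    (\<Sum>k\<le>n. (n choose k) * ((k * count_caterpillars ?K k) * count_forests ?Z (n - k)))" for n
  proof -
    let ?V = "{1..n}"
    have inner: "(\<Sum>S\<in>graph_components G. (if ?K (restrict_graph G S) then card S else 0) *
        (if ?Z (restrict_graph G (?V - S)) then 1 else 0)) = (if ?Z G then n else 0)"
      if G: "G \<in> forests ?V" for G
    proof -
      note G' = forestsD[OF G]
      have "(if ?K (restrict_graph G S) then card S else 0) * (if ?Z (restrict_graph G (?V - S)) then 1 else 0) =
          (if ?Z G then card S else 0)" if S: "S \<in> graph_components G" for S
        using component_count_remove[OF G'(1) S, of U] G'(2) by auto
      then have "(\<Sum>S\<in>graph_components G. (if ?K (restrict_graph G S) then card S else 0) *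
          (if ?Z (restrict_graph G (?V - S)) then 1 else 0)) = (\<Sum>S\<in>graph_components G. if ?Z G then card S else 0)"
        by (rule sum.cong[OF refl])
      also have "\<dots> = (if ?Z G then (\<Sum>S\<in>graph_components G. card S) else 0)" by simp
      also have "(\<Sum>S\<in>graph_components G. card S) = card (\<Union> (graph_components G))"
      proof (rule card_Union_disjoint[symmetric])
        show "disjoint (graph_components G)" using components_splits[OF G'(1)] by (simp add: splits_def)
        show "finite S" if "S \<in> graph_components G" for S
          using component_subset(1)[OF G'(1) that] G'(2) finite_subset by auto
      qed
      also have "\<dots> = n" using Union_components[OF G'(1)] G'(2) by simp
      finally show ?thesis .
    qed
    have "n * count_forests ?Z n = (\<Sum>G\<in>{G \<in> forests ?V. ?Z G}. n)"
      by (simp add: count_forests_def)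
    also have "\<dots> = (\<Sum>G\<in>forests ?V. if ?Z G then n else 0)"
      using finite_forests[of ?V] by (intro sum.mono_neutral_cong_left) auto
    also have "\<dots> = (\<Sum>G\<in>forests ?V. \<Sum>S\<in>graph_components G. (if ?K (restrict_graph G S) then card S else 0) *
        (if ?Z (restrict_graph G (?V - S)) then 1 else 0))"
      using inner by simp
    also have "\<dots> = (\<Sum>k\<le>card ?V. (card ?V choose k) * ((k * count_caterpillars ?K k) * count_forests ?Z (card ?V - k)))"
      by (rule sum_forests_components_iso[of ?V ?K ?Z "\<lambda>k. k"]) (use K Z in auto)
    finally show ?thesis by simp
  qed
  have egfn: "fps_nth (egf (\<lambda>n. n * x n)) n = real n * fps_nth (egf x) n" for x n
    by (simp add: egf_def)
  have "egf (\<lambda>n. n * count_forests ?Z n) = egf (\<lambda>k. k * count_caterpillars ?K k) * egf (count_forests ?Z)"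
    by (rule egf_convolution) (rule rec)
  then have "fps_nth (egf (\<lambda>n. n * count_forests ?Z n)) n =
      fps_nth (egf (\<lambda>k. k * count_caterpillars ?K k) * egf (count_forests ?Z)) n" for n by simp
  then show "real n * fps_nth (egf (count_forests ?Z)) n =
      (\<Sum>k\<le>n. real k * fps_nth (egf (count_caterpillars ?K)) k * fps_nth (egf (count_forests ?Z)) (n - k))" for n
    unfolding fps_mult_nth_atMost egfn .
qed

section \<open>Limiting distribution of component counts\<close>

definition forest_prob :: "(nat pair_pre_digraph \<Rightarrow> bool) \<Rightarrow> nat \<Rightarrow> real" where
  "forest_prob K n = real (count_forests K n) / real (count_forests (\<lambda>_. True) n)"

lemma count_forests_cong:
  assumes "\<And>n G. G \<in> forests {1..n} \<Longrightarrow> K G = K' G"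
  shows "count_forests K = count_forests K'"
proof
  fix n
  have "{G \<in> forests {1..n}. K G} = {G \<in> forests {1..n}. K' G}" using assms by blast
  then show "count_forests K n = count_forests K' n" by (simp add: count_forests_def)
qed

lemma count_forests_mono:
  assumes "\<And>G. G \<in> forests {1..n} \<Longrightarrow> K G \<Longrightarrow> K' G"
  shows "count_forests K n \<le> count_forests K' n"
  unfolding count_forests_def using assms finite_forests[of "{1..n}"] by (intro card_mono) auto

lemma forest_prob_mono:
  assumes "\<And>G. G \<in> forests {1..n} \<Longrightarrow> K G \<Longrightarrow> K' G"
  shows "forest_prob K n \<le> forest_prob K' n"
  unfolding forest_prob_def using count_forests_mono[of n K K'] assms by (intro divide_right_mono) auto

lemma forest_prob_nonneg: "0 \<le> forest_prob K n"
  by (simp add: forest_prob_def)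

lemma forest_prob_UN_le:
  assumes I: "finite I" and K: "\<And>G. G \<in> forests {1..n} \<Longrightarrow> K G \<Longrightarrow> \<exists>i\<in>I. P i G"
  shows "forest_prob K n \<le> (\<Sum>i\<in>I. forest_prob (P i) n)"
proof -
  have "{G \<in> forests {1..n}. K G} \<subseteq> (\<Union>i\<in>I. {G \<in> forests {1..n}. P i G})" using K by blast
  then have "count_forests K n \<le> card (\<Union>i\<in>I. {G \<in> forests {1..n}. P i G})"
    unfolding count_forests_def using I finite_forests[of "{1..n}"] by (intro card_mono) auto
  also have "\<dots> \<le> (\<Sum>i\<in>I. count_forests (P i) n)"
    unfolding count_forests_def by (rule card_UN_le[OF I])
  finally have "real (count_forests K n) \<le> (\<Sum>i\<in>I. real (count_forests (P i) n))"
    by (metis of_nat_mono of_nat_sum)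
  then show ?thesis
    unfolding forest_prob_def sum_divide_distrib[symmetric] by (intro divide_right_mono) auto
qed

lemma forest_prob_UN_disjoint:
  assumes I: "finite I" and K: "\<And>G. G \<in> forests {1..n} \<Longrightarrow> K G \<longleftrightarrow> (\<exists>i\<in>I. P i G)"
    and disj: "\<And>G i i'. G \<in> forests {1..n} \<Longrightarrow> i \<in> I \<Longrightarrow> i' \<in> I \<Longrightarrow> P i G \<Longrightarrow> P i' G \<Longrightarrow> i = i'"
  shows "forest_prob K n = (\<Sum>i\<in>I. forest_prob (P i) n)"
proof -
  have "{G \<in> forests {1..n}. K G} = (\<Union>i\<in>I. {G \<in> forests {1..n}. P i G})" using K by blast
  then have "count_forests K n = card (\<Union>i\<in>I. {G \<in> forests {1..n}. P i G})"
    by (simp add: count_forests_def)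
  also have "\<dots> = (\<Sum>i\<in>I. count_forests (P i) n)"
    unfolding count_forests_def using I finite_forests[of "{1..n}"] disj
    by (intro card_UN_disjoint) auto
  finally show ?thesis by (simp add: forest_prob_def sum_divide_distrib)
qed

lemma component_count_eq_0: "simple_graph G \<Longrightarrow> component_count K G = 0 \<longleftrightarrow> (\<forall>S\<in>graph_components G. \<not> K (restrict_graph G S))"
  using finite_components[of G] by (auto simp: component_count_def)

lemma egf_count_forests_True: "egf (count_forests (\<lambda>_. True)) = fps_Exp (egf num_caterpillars)"
proof -
  have "count_caterpillars (\<lambda>A. \<not> False) = num_caterpillars"
    by (rule ext) (simp add: count_caterpillars_def num_caterpillars_def)
  moreover have "(\<lambda>G :: nat pair_pre_digraph. component_count (\<lambda>_. False) G = 0) = (\<lambda>_. True)"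
    by (rule ext) (simp add: component_count_def)
  ultimately show ?thesis
    using egf_count_forests_avoiding[of "\<lambda>_. False"] by (simp add: iso_invariant_def)
qed

lemma count_forests_True_pos: "count_forests (\<lambda>_. True) n > 0"
proof -
  have "forests {1..n} = caterpillar_forests_on n" by (simp add: forests_def caterpillar_forests_on_def)
  then show ?thesis
    using caterpillar_forests_on_nonempty[of n] finite_forests[of "{1..n}"]
    by (simp add: count_forests_def card_gt_0_iff)
qed

lemma smooth_seq_forests: "smooth_seq (fps_nth (egf (count_forests (\<lambda>_. True))))"
proof -
  obtain c A where cA: "c > 0" "abs_summable_fps A" "egf num_caterpillars = fps_const c * fps_ones + A"
    by (rule egf_num_caterpillars)
  show ?thesis unfolding egf_count_forests_True
  proof (rule smooth_seq_Exp[OF cA])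
    show "fps_nth (egf num_caterpillars) 0 = 0" by (simp add: egf_def num_caterpillars_0)
    show "fps_nth (fps_Exp (egf num_caterpillars)) n > 0" for n
      unfolding egf_count_forests_True[symmetric] using count_forests_True_pos[of n] rho(1)
      by (simp add: egf_def)
  qed
qed

lemma forest_prob_egf: "forest_prob K n = fps_nth (egf (count_forests K)) n / fps_nth (egf (count_forests (\<lambda>_. True))) n"
  unfolding forest_prob_def egf_ratio ..

lemma count_caterpillars_Not:
  "num_caterpillars n = count_caterpillars U n + count_caterpillars (\<lambda>A. \<not> U A) n"
proof -
  have "caterpillars {1..n} = {A \<in> caterpillars {1..n}. U A} \<union> {A \<in> caterpillars {1..n}. \<not> U A}" by auto
  then show ?thesis
    unfolding num_caterpillars_def count_caterpillars_def
    using finite_caterpillars(1)[of "{1..n}"] by (subst card_Un_disjoint[symmetric]) auto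
qed

text \<open>Leaving out the class with series u turns exp C into exp (- u) * exp C, and convolution
  with the absolutely summable exp (- u) multiplies the coefficients asymptotically by its value at
  1.\<close>

lemma forest_prob_avoiding:
  assumes U: "iso_invariant U" and s: "abs_summable_fps (egf (count_caterpillars U))"
  shows "forest_prob (\<lambda>G. component_count U G = 0) \<longlonglongrightarrow> exp (- fps_sum (egf (count_caterpillars U)))"
proof -
  let ?u = "egf (count_caterpillars U)" and ?F = "egf (count_forests (\<lambda>_. True))"
  have u0: "fps_nth ?u 0 = 0" by (simp add: egf_def count_caterpillars_0)
  have n0: "fps_nth (egf num_caterpillars) 0 = 0" by (simp add: egf_def num_caterpillars_0)
  have "egf num_caterpillars = ?u + egf (count_caterpillars (\<lambda>A. \<not> U A))"
    unfolding egf_add[symmetric] using count_caterpillars_Not by (intro arg_cong[of _ _ egf] ext) blast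
  then have "egf (count_caterpillars (\<lambda>A. \<not> U A)) = egf num_caterpillars + - ?u" by simp
  then have "egf (count_forests (\<lambda>G. component_count U G = 0)) = fps_Exp (- ?u) * ?F"
    unfolding egf_count_forests_avoiding[OF U] egf_count_forests_True
    using fps_Exp_add[OF n0, of "- ?u"] u0 by (simp add: mult.commute)
  then have eq: "fps_nth (egf (count_forests (\<lambda>G. component_count U G = 0))) n =
      (\<Sum>i\<le>n. fps_nth (fps_Exp (- ?u)) i * fps_nth ?F (n - i))" for n
    by (simp add: fps_mult_nth_atMost)
  have pos: "fps_nth ?F n \<noteq> 0" for n using smooth_seq_forests unfolding smooth_seq_def by (metis less_irrefl)
  have su: "abs_summable_fps (- ?u)" "fps_nth (- ?u) 0 = 0"
    using s u0 by (simp_all add: abs_summable_fps_uminus)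
  have "(\<lambda>n. (\<Sum>i\<le>n. fps_nth (fps_Exp (- ?u)) i * fps_nth ?F (n - i)) / fps_nth ?F n)
      \<longlonglongrightarrow> 1 * fps_sum (fps_Exp (- ?u))"
    by (rule smooth_seq_convolution[OF smooth_seq_forests fps_Exp_abs_summable(1)[OF su(2,1)]])
      (simp add: pos)
  then show ?thesis
    unfolding forest_prob_egf[abs_def] eq using fps_Exp_abs_summable(2)[OF su(2,1)] fps_sum_uminus[OF s] by simp
qed

text \<open>In the limit the marking identity is the recursion p (l + 1) = p l * lambda / (l + 1) of
  Poisson probabilities, with lambda the mass of the class.\<close>

lemma forest_prob_profile_step:
  assumes K: "\<And>i. i \<in> J \<Longrightarrow> iso_invariant (K i)"
    and disj: "\<And>i i' A. i \<in> J \<Longrightarrow> i' \<in> J \<Longrightarrow> K i A \<Longrightarrow> K i' A \<Longrightarrow> i = i'"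
    and j: "j \<in> J" and m: "m j = Suc l" and s: "abs_summable_fps (egf (count_caterpillars (K j)))"
    and lim: "forest_prob (profile J K (m(j := l))) \<longlonglongrightarrow> L"
  shows "forest_prob (profile J K m) \<longlonglongrightarrow> L * fps_sum (egf (count_caterpillars (K j))) / real (Suc l)"
proof -
  let ?u = "egf (count_caterpillars (K j))" and ?F = "egf (count_forests (\<lambda>_. True))"
  let ?P = "egf (count_forests (profile J K m))" and ?Q = "egf (count_forests (profile J K (m(j := l))))"
  have "fps_const (real (Suc l)) * ?P = ?u * ?Q"
    using egf_profile_step[where J = J and K = K and j = j and m = m and l = l, OF K disj j m] m by simp
  then have "fps_nth (fps_const (real (Suc l)) * ?P) n = fps_nth (?u * ?Q) n" for n by simp
  then have "real (Suc l) * fps_nth ?P n = (\<Sum>i\<le>n. fps_nth ?u i * fps_nth ?Q (n - i))" for n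
    unfolding fps_mult_nth_atMost[of ?u] by (simp del: of_nat_Suc)
  then have eq: "fps_nth ?P n = (\<Sum>i\<le>n. fps_nth ?u i * fps_nth ?Q (n - i)) / real (Suc l)" for n
    by (simp add: field_simps del: of_nat_Suc)
  have "(\<lambda>n. (\<Sum>i\<le>n. fps_nth ?u i * fps_nth ?Q (n - i)) / fps_nth ?F n) \<longlonglongrightarrow> L * fps_sum ?u"
    using lim unfolding forest_prob_egf[abs_def] by (rule smooth_seq_convolution[OF smooth_seq_forests s])
  then have "(\<lambda>n. (\<Sum>i\<le>n. fps_nth ?u i * fps_nth ?Q (n - i)) / fps_nth ?F n / real (Suc l)) \<longlonglongrightarrow> L * fps_sum ?u / real (Suc l)"
    by (rule tendsto_divide) auto
  then show ?thesis unfolding forest_prob_egf[abs_def] eq by (simp add: divide_divide_eq_left mult.commute del: of_nat_Suc)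
qed

lemma forest_prob_poisson:
  assumes U: "iso_invariant U" and s: "abs_summable_fps (egf (count_caterpillars U))"
  defines "lam \<equiv> fps_sum (egf (count_caterpillars U))"
  shows "forest_prob (\<lambda>G. component_count U G = j) \<longlonglongrightarrow> exp (- lam) * (lam ^ j / fact j)"
proof -
  have "forest_prob (profile {()} (\<lambda>_. U) (\<lambda>_. j)) \<longlonglongrightarrow> exp (- lam) * (lam ^ j / fact j)"
  proof (induction j)
    case 0
    have "profile {()} (\<lambda>_. U) (\<lambda>_. 0) = (\<lambda>G. component_count U G = 0)" by (rule ext) (simp add: profile_def)
    then show ?case using forest_prob_avoiding[OF U s] by (simp add: lam_def)
  next
    case (Suc j)
    have upd: "(\<lambda>_. Suc j)(() := j) = (\<lambda>_. j)" by (rule ext) simp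
    have "forest_prob (profile {()} (\<lambda>_. U) (\<lambda>_. Suc j)) \<longlonglongrightarrow> exp (- lam) * (lam ^ j / fact j) * lam / real (Suc j)"
      unfolding lam_def
      by (rule forest_prob_profile_step[where j = "()" and K = "\<lambda>_. U"])
        (use U s Suc in \<open>auto simp: upd lam_def simp del: of_nat_Suc\<close>)
    then show ?case by (simp add: field_simps del: of_nat_Suc)
  qed
  moreover have "profile {()} (\<lambda>_. U) (\<lambda>_. j) = (\<lambda>G. component_count U G = j)" by (rule ext) (simp add: profile_def)
  ultimately show ?thesis by simp
qed

lemma egf_nth_nonneg: "fps_nth (egf x) n \<ge> 0"
  using rho(1) by (simp add: egf_def)

lemma fps_nth_egf_mono: "x n \<le> y n \<Longrightarrow> fps_nth (egf x) n \<le> fps_nth (egf y) n"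
  using rho(1) by (auto simp: egf_def intro!: divide_right_mono mult_right_mono)

text \<open>The class is truncated to components with fewer than N vertices. The truncated class has
  finite mass, as large as desired, and at most j components in the full class means at most j in
  the truncated one, which is unlikely for a Poisson variable of large mean.\<close>

lemma forest_prob_infinite_mass:
  assumes K: "iso_invariant K" and inf: "\<not> abs_summable_fps (egf (count_caterpillars K))"
  shows "forest_prob (\<lambda>G. component_count K G = j) \<longlonglongrightarrow> 0"
proof (rule LIMSEQ_I)
  fix \<epsilon> :: real assume e: "\<epsilon> > 0"
  let ?u = "fps_nth (egf (count_caterpillars K))"
  \<comment> \<open>The probability that a Poisson variable of mean x is at most j, as x tends to
    infinity.\<close>
  have "((\<lambda>x :: real. \<Sum>i\<le>j. x ^ i / exp x / fact i) \<longlongrightarrow> (\<Sum>i\<le>j. 0 / fact i)) at_top"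
    by (intro tendsto_sum tendsto_divide tendsto_power_div_exp_0 tendsto_const) auto
  then have "eventually (\<lambda>x :: real. (\<Sum>i\<le>j. x ^ i / exp x / fact i) < \<epsilon>) at_top"
    using e by (intro order_tendstoD(2)) auto
  then obtain B where B: "\<And>x :: real. x \<ge> B \<Longrightarrow> (\<Sum>i\<le>j. x ^ i / exp x / fact i) < \<epsilon>"
    by (auto simp: eventually_at_top_linorder)
  have "\<exists>N. (\<Sum>k<N. ?u k) > B"
  proof (rule ccontr)
    assume "\<not> ?thesis"
    then have "(\<Sum>k<N. ?u k) \<le> B" for N by (meson not_le)
    then have "summable ?u" by (intro summableI_nonneg_bounded[of ?u B] egf_nth_nonneg)
    then show False using inf egf_nth_nonneg by (simp add: abs_summable_fps_def)
  qed
  then obtain N where N: "(\<Sum>k<N. ?u k) > B" by auto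
  define U where "U = (\<lambda>A. K A \<and> card (pverts A) < N)"
  have "card (f ` X) = card X" if "bij f" for f :: "nat \<Rightarrow> nat" and X
    using that by (intro card_image) (auto simp: bij_def inj_on_def)
  then have "iso_invariant U"
    using K unfolding U_def iso_invariant_def by simp
  have cU: "count_caterpillars U n = (if n < N then count_caterpillars K n else 0)" for n
  proof -
    have "{A \<in> caterpillars {1..n}. U A} = (if n < N then {A \<in> caterpillars {1..n}. K A} else {})"
      by (auto simp: U_def caterpillars_def)
    then show ?thesis by (simp add: count_caterpillars_def)
  qed
  have z: "fps_nth (egf (count_caterpillars U)) n = 0" if "n \<ge> N" for n
    using that by (simp add: egf_def cU)
  have fin: "abs_summable_fps (egf (count_caterpillars U))"
    "fps_sum (egf (count_caterpillars U)) = (\<Sum>n<N. fps_nth (egf (count_caterpillars U)) n)"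
    by (rule abs_summable_fps_finite, erule z)+
  define lam where "lam = fps_sum (egf (count_caterpillars U))"
  have "lam = (\<Sum>k<N. ?u k)" unfolding lam_def fin(2) by (rule sum.cong) (auto simp: egf_def cU)
  then have "(\<Sum>i\<le>j. lam ^ i / exp lam / fact i) < \<epsilon>" using B[of lam] N by simp
  moreover have "(\<Sum>i\<le>j. lam ^ i / exp lam / fact i) = (\<Sum>i\<le>j. exp (- lam) * (lam ^ i / fact i))"
    by (intro sum.cong refl) (simp add: exp_minus field_simps)
  moreover have "(\<lambda>n. \<Sum>i\<le>j. forest_prob (\<lambda>G. component_count U G = i) n) \<longlonglongrightarrow> (\<Sum>i\<le>j. exp (- lam) * (lam ^ i / fact i))"
    unfolding lam_def by (intro tendsto_sum forest_prob_poisson \<open>iso_invariant U\<close> fin(1))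
  ultimately have "eventually (\<lambda>n. (\<Sum>i\<le>j. forest_prob (\<lambda>G. component_count U G = i) n) < \<epsilon>) sequentially"
    by (intro order_tendstoD(2)) auto
  then obtain n0 where n0: "\<And>n. n \<ge> n0 \<Longrightarrow> (\<Sum>i\<le>j. forest_prob (\<lambda>G. component_count U G = i) n) < \<epsilon>"
    by (auto simp: eventually_at_top_linorder)
  have "forest_prob (\<lambda>G. component_count K G = j) n \<le> (\<Sum>i\<le>j. forest_prob (\<lambda>G. component_count U G = i) n)" for n
  proof (rule forest_prob_UN_le)
    fix G assume G: "G \<in> forests {1..n}" "component_count K G = j"
    have "component_count U G \<le> component_count K G"
      unfolding component_count_def
      using finite_components[OF forestsD(1)[OF G(1)]] by (intro card_mono) (auto simp: U_def)
    then show "\<exists>i\<in>{..j}. component_count U G = i" using G(2) by auto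
  qed simp
  then show "\<exists>no. \<forall>n\<ge>no. norm (forest_prob (\<lambda>G. component_count K G = j) n - 0) < \<epsilon>"
    using n0 forest_prob_nonneg by (intro exI[of _ n0]) (auto intro: le_less_trans)
qed

text \<open>Induction on the total number of prescribed components. If it is 0, the profile says
  that the union of the classes is avoided, and the mass of this union is at most the sum of the
  masses.\<close>

lemma convergent_forest_prob_profile_summable:
  assumes J: "finite J" and K: "\<And>i. i \<in> J \<Longrightarrow> iso_invariant (K i)"
    and disj: "\<And>i i' A. i \<in> J \<Longrightarrow> i' \<in> J \<Longrightarrow> K i A \<Longrightarrow> K i' A \<Longrightarrow> i = i'"
    and s: "\<And>i. i \<in> J \<Longrightarrow> abs_summable_fps (egf (count_caterpillars (K i)))"
  shows "convergent (forest_prob (profile J K m))"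
proof (induction "\<Sum>i\<in>J. m i" arbitrary: m)
  case 0
  define U where "U = (\<lambda>A. \<exists>i\<in>J. K i A)"
  have U: "iso_invariant U" using K by (simp add: U_def iso_invariant_def)
  have "count_caterpillars U n \<le> (\<Sum>i\<in>J. count_caterpillars (K i) n)" for n
  proof -
    have "{A \<in> caterpillars {1..n}. U A} = (\<Union>i\<in>J. {A \<in> caterpillars {1..n}. K i A})" by (auto simp: U_def)
    then show ?thesis unfolding count_caterpillars_def using card_UN_le[OF J] by simp
  qed
  then have le: "real (count_caterpillars U n) \<le> (\<Sum>i\<in>J. real (count_caterpillars (K i) n))" for n
    by (metis of_nat_mono of_nat_sum)
  have "abs_summable_fps (egf (count_caterpillars U))"
    unfolding abs_summable_fps_def
  proof (rule summable_comparison_test'[where N = 0])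
    show "summable (\<lambda>n. \<Sum>i\<in>J. fps_nth (egf (count_caterpillars (K i))) n)"
      using s by (intro summable_sum abs_summable_fps_imp_summable) auto
    fix n
    have "fps_nth (egf (count_caterpillars U)) n \<le> (\<Sum>i\<in>J. real (count_caterpillars (K i) n)) * rho ^ n / fact n"
      unfolding egf_def fps_nth_Abs_fps using le[of n] rho(1) by (intro divide_right_mono mult_right_mono) auto
    also have "\<dots> = (\<Sum>i\<in>J. fps_nth (egf (count_caterpillars (K i))) n)"
      by (simp add: egf_def sum_distrib_right sum_divide_distrib)
    finally show "norm \<bar>fps_nth (egf (count_caterpillars U)) n\<bar> \<le> (\<Sum>i\<in>J. fps_nth (egf (count_caterpillars (K i))) n)"
      using egf_nth_nonneg[of "count_caterpillars U" n] by simp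
  qed
  then have "convergent (forest_prob (\<lambda>G. component_count U G = 0))"
    using forest_prob_avoiding[OF U] convergentI by blast
  moreover have "profile J K m G \<longleftrightarrow> component_count U G = 0" if "G \<in> forests {1..n}" for n G
  proof -
    have "m i = 0" if "i \<in> J" for i using 0 J that by simp
    then have "profile J K m G \<longleftrightarrow> (\<forall>i\<in>J. component_count (K i) G = 0)" by (simp add: profile_def)
    also have "\<dots> \<longleftrightarrow> component_count U G = 0"
      unfolding component_count_eq_0[OF forestsD(1)[OF that]] U_def by blast
    finally show ?thesis .
  qed
  then have "count_forests (profile J K m) = count_forests (\<lambda>G. component_count U G = 0)"
    by (rule count_forests_cong)
  ultimately show ?case by (simp add: forest_prob_def[abs_def])
next
  case (Suc x)
  then have "(\<Sum>i\<in>J. m i) \<noteq> 0" by simp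
  then obtain j where j: "j \<in> J" "m j \<noteq> 0" by (meson sum.neutral)
  then obtain l where l: "m j = Suc l" using not0_implies_Suc by blast
  have "(\<Sum>i\<in>J. m i) = m j + (\<Sum>i\<in>J - {j}. m i)" using J j(1) by (simp add: sum.remove)
  moreover have "(\<Sum>i\<in>J. (m(j := l)) i) = l + (\<Sum>i\<in>J - {j}. m i)" using J j(1) by (simp add: sum.remove)
  ultimately have "x = (\<Sum>i\<in>J. (m(j := l)) i)" using Suc.hyps(2) l by simp
  then have "convergent (forest_prob (profile J K (m(j := l))))" by (rule Suc.hyps(1))
  then obtain L where L: "forest_prob (profile J K (m(j := l))) \<longlonglongrightarrow> L" by (auto simp: convergent_def)
  have "forest_prob (profile J K m) \<longlonglongrightarrow> L * fps_sum (egf (count_caterpillars (K j))) / real (Suc l)"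
    by (rule forest_prob_profile_step[where J = J and K = K and j = j and m = m and l = l])
      (erule K, (rule disj; assumption), rule j(1), rule l, rule s[OF j(1)], rule L)
  then show ?case by (rule convergentI)
qed

text \<open>If one class has infinite mass, its prescribed count alone forces the limit 0.\<close>

lemma convergent_forest_prob_profile:
  assumes J: "finite J" and K: "\<And>i. i \<in> J \<Longrightarrow> iso_invariant (K i)"
    and disj: "\<And>i i' A. i \<in> J \<Longrightarrow> i' \<in> J \<Longrightarrow> K i A \<Longrightarrow> K i' A \<Longrightarrow> i = i'"
  shows "convergent (forest_prob (profile J K m))"
proof (cases "\<forall>i\<in>J. abs_summable_fps (egf (count_caterpillars (K i)))")
  case True
  then show ?thesis
    by (intro convergent_forest_prob_profile_summable[where J = J and K = K and m = m] J)
      (erule K, (rule disj; assumption), blast)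
next
  case False
  then obtain i where i: "i \<in> J" "\<not> abs_summable_fps (egf (count_caterpillars (K i)))" by blast
  have "forest_prob (profile J K m) \<longlonglongrightarrow> 0"
  proof (rule tendsto_sandwich[where f = "\<lambda>_. 0" and h = "forest_prob (\<lambda>G. component_count (K i) G = m i)"])
    show "forest_prob (\<lambda>G. component_count (K i) G = m i) \<longlonglongrightarrow> 0"
      by (rule forest_prob_infinite_mass[OF K[OF i(1)] i(2)])
    have "forest_prob (profile J K m) n \<le> forest_prob (\<lambda>G. component_count (K i) G = m i) n" for n
      by (rule forest_prob_mono) (use i(1) in \<open>simp add: profile_def\<close>)
    then show "eventually (\<lambda>n. forest_prob (profile J K m) n \<le> forest_prob (\<lambda>G. component_count (K i) G = m i) n) sequentially"
      by simp
  qed (auto simp: forest_prob_nonneg)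
  then show ?thesis by (rule convergentI)
qed

text \<open>Each condition "at least k" in \<open>B\<close> is the complement of "exactly i" for i <
  k. Imposing "exactly i" moves the index from \<open>B\<close> to \<open>A\<close>, so the
  induction must hold for arbitrary \<open>A\<close> and \<open>m\<close>.\<close>

lemma convergent_forest_prob_threshold:
  assumes B: "finite B" and A: "finite A" "A \<inter> B = {}"
    and K: "\<And>i. i \<in> A \<union> B \<Longrightarrow> iso_invariant (K i)"
    and disj: "\<And>i i' G. i \<in> A \<union> B \<Longrightarrow> i' \<in> A \<union> B \<Longrightarrow> K i G \<Longrightarrow> K i' G \<Longrightarrow> i = i'"
  shows "convergent (forest_prob (\<lambda>G. profile A K m G \<and> (\<forall>i\<in>B. k \<le> component_count (K i) G)))"
  using B A K disj
proof (induction B arbitrary: A m rule: finite_induct)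
  case empty
  then show ?case using convergent_forest_prob_profile[of A K m] by simp
next
  case (insert b B)
  let ?P = "\<lambda>A m G. profile A K m G \<and> (\<forall>i\<in>B. k \<le> component_count (K i) G)"
  have "b \<notin> A" using insert.prems by auto
  have 1: "convergent (forest_prob (?P A m))"
    using insert.prems by (intro insert.IH) auto
  have 2: "convergent (forest_prob (?P (insert b A) (m(b := j))))" for j
    using insert.prems insert.hyps(2) by (intro insert.IH) auto
  \<comment> \<open>The events below k fix the count of class \<open>b\<close>; the last index k
    stands for a count of at least k.\<close>
  let ?Q = "\<lambda>i G. if i < k then ?P (insert b A) (m(b := i)) G
    else profile A K m G \<and> (\<forall>i\<in>insert b B. k \<le> component_count (K i) G)"
  have "forest_prob (?P A m) n = (\<Sum>i\<le>k. forest_prob (?Q i) n)" for n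
  proof (rule forest_prob_UN_disjoint)
    have prof: "profile (insert b A) K (m(b := i)) G \<longleftrightarrow> profile A K m G \<and> component_count (K b) G = i" for i G
      using \<open>b \<notin> A\<close> by (auto simp: profile_def)
    fix G
    show "?P A m G \<longleftrightarrow> (\<exists>i\<in>{..k}. ?Q i G)"
    proof (cases "component_count (K b) G < k")
      case True
      then show ?thesis unfolding prof by (auto intro!: bexI[of _ "component_count (K b) G"])
    next
      case False
      then show ?thesis unfolding prof by (auto intro!: bexI[of _ k])
    qed
    fix i i' assume "i \<in> {..k}" "i' \<in> {..k}" "?Q i G" "?Q i' G"
    then show "i = i'" unfolding prof by (auto split: if_splits)
  qed simp
  then have "forest_prob (?P A m) n = (\<Sum>i<k. forest_prob (?P (insert b A) (m(b := i))) n)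
      + forest_prob (\<lambda>G. profile A K m G \<and> (\<forall>i\<in>insert b B. k \<le> component_count (K i) G)) n" for n
    by (simp add: lessThan_Suc_atMost[symmetric])
  then have "forest_prob (\<lambda>G. profile A K m G \<and> (\<forall>i\<in>insert b B. k \<le> component_count (K i) G)) =
      (\<lambda>n. forest_prob (?P A m) n - (\<Sum>i<k. forest_prob (?P (insert b A) (m(b := i))) n))"
    by (intro ext) (simp add: algebra_simps)
  moreover have "convergent (\<lambda>n. forest_prob (?P A m) n - (\<Sum>i<k. forest_prob (?P (insert b A) (m(b := i))) n))"
    using 1 2 by (intro convergent_diff convergent_sum)
  ultimately show ?case by simp
qed

section \<open>The convergence law\<close>

lemma atomic_diagram_map_graph:
  assumes "inj f"
  shows "atomic_diagram (map_graph f G) (map f as) = atomic_diagram G as"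
proof -
  have arcs: "(f a, f b) \<in> map_prod f f ` parcs G \<longleftrightarrow> (a, b) \<in> parcs G" for a b
    using assms by (auto simp: inj_eq intro: rev_image_eqI)
  show ?thesis unfolding atomic_diagram_def using assms arcs
    by (auto simp: inj_eq)
qed

lemma rank_type_map_graph:
  assumes "inj f"
  shows "rank_type k (map_graph f G) (map f as) = rank_type k G as"
proof (induction k arbitrary: as)
  case (Suc k)
  have "rank_type k (map_graph f G) (map f as @ [f v]) = rank_type k G (as @ [v])" for v
    using Suc[of "as @ [v]"] by simp
  then show ?case by (simp add: atomic_diagram_map_graph[OF assms] image_image)
qed (simp add: atomic_diagram_map_graph[OF assms])

text \<open>The vector \<open>pf\<close> of truncated counts has finitely many possible values and
  decides the sentence, so the probability is a finite sum over values of \<open>pf\<close>, and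
  each of these events combines exact counts with thresholds.\<close>

theorem convergent_forest_prob_models:
  assumes \<phi>: "sentence \<phi>"
  shows "convergent (forest_prob (\<lambda>G. models G \<phi>))"
proof -
  define q where "q = quantifier_rank \<phi>"
  define J where "J = {rank_type q G as | (G :: nat pair_pre_digraph) as. length as = 0}"
  have J: "finite J" unfolding J_def by (rule finite_rank_types)
  define K where "K = (\<lambda>\<tau> (A :: nat pair_pre_digraph). rank_type q A [] = \<tau>)"
  have inv: "iso_invariant (K \<tau>)" for \<tau>
    unfolding iso_invariant_def K_def
  proof (intro allI impI)
    fix f :: "nat \<Rightarrow> nat" and G assume "bij f"
    then have "rank_type q (map_graph f G) (map f []) = rank_type q G []"
      by (intro rank_type_map_graph bij_is_inj)
    then show "(rank_type q (map_graph f G) [] = \<tau>) = (rank_type q G [] = \<tau>)" by simp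
  qed
  define pf where "pf = (\<lambda>G. restrict (\<lambda>\<tau>. min q (component_count (K \<tau>) G)) J)"
  have pf: "pf G \<in> J \<rightarrow>\<^sub>E {..q}" for G by (auto simp: pf_def)
  \<comment> \<open>One forest of any size satisfying the sentence is enough, as all forests with
    the same vector then agree with it. The set therefore does not depend on n.\<close>
  define Good where "Good = {p \<in> J \<rightarrow>\<^sub>E {..q}. \<exists>n. \<exists>G\<in>forests {1..n}. pf G = p \<and> models G \<phi>}"
  have Good: "finite Good"
    by (rule finite_subset[of _ "J \<rightarrow>\<^sub>E {..q}"]) (auto simp: Good_def intro!: finite_PiE J)
  have det: "models G \<phi> \<longleftrightarrow> models H \<phi>"
    if "G \<in> forests {1..n}" "H \<in> forests {1..n'}" "pf G = pf H" for G H n n'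
  proof (rule models_determined_by_component_types[where K = q])
    show "splits G (graph_components G)" "splits H (graph_components H)"
      using components_splits forestsD(1) that by blast+
    show "finite (pverts G)" "finite (pverts H)" using forestsD(2)[OF that(1)] forestsD(2)[OF that(2)] by auto
    show "sentence \<phi>" "quantifier_rank \<phi> \<le> q" using \<phi> by (auto simp: q_def)
    fix \<tau>
    have "min q (component_count (K \<tau>) G) = min q (component_count (K \<tau>) H)"
    proof (cases "\<tau> \<in> J")
      case True
      then show ?thesis using fun_cong[OF that(3), of \<tau>] by (simp add: pf_def)
    next
      case False
      then have "\<not> K \<tau> A" for A by (auto simp: J_def K_def)
      then show ?thesis by (simp add: component_count_def)
    qed
    then show "min q (card {S \<in> graph_components G. rank_type q (restrict_graph G S) [] = \<tau>}) =
        min q (card {S \<in> graph_components H. rank_type q (restrict_graph H S) [] = \<tau>})"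
      by (simp add: component_count_def K_def)
  qed
  have "forest_prob (\<lambda>G. models G \<phi>) n = (\<Sum>p\<in>Good. forest_prob (\<lambda>G. pf G = p) n)" for n
  proof (rule forest_prob_UN_disjoint[OF Good])
    fix G assume G: "G \<in> forests {1..n}"
    show "models G \<phi> \<longleftrightarrow> (\<exists>p\<in>Good. pf G = p)"
    proof
      assume "models G \<phi>"
      then have "pf G \<in> Good" using G pf[of G] unfolding Good_def by blast
      then show "\<exists>p\<in>Good. pf G = p" by blast
    next
      assume "\<exists>p\<in>Good. pf G = p"
      then obtain n' H where H: "H \<in> forests {1..n'}" "pf H = pf G" "models H \<phi>" unfolding Good_def by auto
      then show "models G \<phi>" using det[OF G H(1)] by simp
    qed
  qed simp
  moreover have "convergent (forest_prob (\<lambda>G. pf G = p))" if p: "p \<in> Good" for p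
  proof -
    \<comment> \<open>A truncated count below q is exact; the value q only says that the count is at
      least q.\<close>
    define A B where "A = {\<tau> \<in> J. p \<tau> < q}" and "B = {\<tau> \<in> J. p \<tau> = q}"
    have pJ: "p \<in> J \<rightarrow>\<^sub>E {..q}" using p by (simp add: Good_def)
    have "pf G = p \<longleftrightarrow> profile A K p G \<and> (\<forall>\<tau>\<in>B. q \<le> component_count (K \<tau>) G)" for G
    proof -
      have "pf G = p \<longleftrightarrow> (\<forall>\<tau>\<in>J. min q (component_count (K \<tau>) G) = p \<tau>)"
        using PiE_ext[OF pf[of G] pJ] by (auto simp: pf_def)
      also have "\<dots> \<longleftrightarrow> (\<forall>\<tau>\<in>J. if p \<tau> < q then component_count (K \<tau>) G = p \<tau> else q \<le> component_count (K \<tau>) G)"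
      proof (rule ball_cong[OF refl])
        fix \<tau> assume "\<tau> \<in> J"
        then have "p \<tau> \<le> q" using pJ by (auto simp: PiE_iff)
        then show "min q (component_count (K \<tau>) G) = p \<tau> \<longleftrightarrow>
            (if p \<tau> < q then component_count (K \<tau>) G = p \<tau> else q \<le> component_count (K \<tau>) G)"
          by (auto simp: min_def)
      qed
      also have "\<dots> \<longleftrightarrow> profile A K p G \<and> (\<forall>\<tau>\<in>B. q \<le> component_count (K \<tau>) G)"
      proof -
        have "p \<tau> \<le> q" if "\<tau> \<in> J" for \<tau> using that pJ by (auto simp: PiE_iff)
        then show ?thesis unfolding profile_def A_def B_def by (auto simp: order_le_less)
      qed
      finally show ?thesis .
    qed
    moreover have "convergent (forest_prob (\<lambda>G. profile A K p G \<and> (\<forall>\<tau>\<in>B. q \<le> component_count (K \<tau>) G)))"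
      by (rule convergent_forest_prob_threshold) (use J inv in \<open>auto simp: A_def B_def K_def\<close>)
    ultimately show ?thesis by simp
  qed
  ultimately have "convergent (\<lambda>n. \<Sum>p\<in>Good. forest_prob (\<lambda>G. pf G = p) n) \<and>
      forest_prob (\<lambda>G. models G \<phi>) = (\<lambda>n. \<Sum>p\<in>Good. forest_prob (\<lambda>G. pf G = p) n)"
    by (intro conjI convergent_sum ext) auto
  then show ?thesis by simp
qed

lemma prob_models_forest: "prob_models random_caterpillar_forest \<phi> = forest_prob (\<lambda>G. models G \<phi>)"
proof
  fix n
  have eq: "caterpillar_forests_on n = forests {1..n}" by (simp add: forests_def caterpillar_forests_on_def)
  have "prob_models random_caterpillar_forest \<phi> n =
      real (card (forests {1..n} \<inter> {G. models G \<phi>})) / real (card (forests {1..n}))"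
    unfolding prob_models_def random_caterpillar_forest_def eq[symmetric]
    by (rule measure_pmf_of_set[OF caterpillar_forests_on_nonempty finite_caterpillar_forests_on])
  also have "forests {1..n} \<inter> {G. models G \<phi>} = {G \<in> forests {1..n}. models G \<phi>}" by blast
  finally show "prob_models random_caterpillar_forest \<phi> n = forest_prob (\<lambda>G. models G \<phi>) n"
    by (simp add: forest_prob_def count_forests_def)
qed

section \<open>Density of the limiting probabilities\<close>

text \<open>The empty conjunction is a closed formula that also holds in the graph without vertices,
  so no free variable and no exception for empty graphs arises.\<close>

primrec conj_list :: "fo list \<Rightarrow> fo" where
  "conj_list [] = All 0 (Eq 0 0)"
| "conj_list (\<phi> # \<phi>s) = And \<phi> (conj_list \<phi>s)"

primrec disj_list :: "fo list \<Rightarrow> fo" where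
  "disj_list [] = Neg (All 0 (Eq 0 0))"
| "disj_list (\<phi> # \<phi>s) = Or \<phi> (disj_list \<phi>s)"

primrec exs :: "nat \<Rightarrow> fo \<Rightarrow> fo" where
  "exs 0 \<phi> = \<phi>"
| "exs (Suc m) \<phi> = Ex m (exs m \<phi>)"

lemma sat_conj_list [simp]: "sat G e (conj_list \<phi>s) \<longleftrightarrow> (\<forall>\<phi>\<in>set \<phi>s. sat G e \<phi>)"
  by (induction \<phi>s) auto

lemma sat_disj_list [simp]: "sat G e (disj_list \<phi>s) \<longleftrightarrow> (\<exists>\<phi>\<in>set \<phi>s. sat G e \<phi>)"
  by (induction \<phi>s) auto

lemma fv_conj_list [simp]: "fv (conj_list \<phi>s) = (\<Union>\<phi>\<in>set \<phi>s. fv \<phi>)"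
  by (induction \<phi>s) auto

lemma fv_disj_list [simp]: "fv (disj_list \<phi>s) = (\<Union>\<phi>\<in>set \<phi>s. fv \<phi>)"
  by (induction \<phi>s) auto

lemma fv_exs: "fv (exs m \<phi>) = fv \<phi> - {..<m}"
proof (induction m)
  case (Suc m)
  have "fv (exs (Suc m) \<phi>) = fv \<phi> - {..<m} - {m}" by (simp add: Suc)
  also have "\<dots> = fv \<phi> - {..<Suc m}" by (auto simp: less_Suc_eq)
  finally show ?case .
qed simp

lemma sat_exs:
  "sat G e (exs m \<phi>) \<longleftrightarrow> (\<exists>a. (\<forall>i<m. a i \<in> pverts G) \<and> sat G (\<lambda>i. if i < m then a i else e i) \<phi>)"
proof (induction m arbitrary: e)
  case (Suc m)
  have upd: "(\<lambda>i. if i < m then a i else (e(m := v)) i) = (\<lambda>i. if i < Suc m then (a(m := v)) i else e i)" for a v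
    by (auto simp: fun_eq_iff less_Suc_eq)
  show ?case
  proof
    assume "sat G e (exs (Suc m) \<phi>)"
    then obtain v a where va: "v \<in> pverts G" "\<forall>i<m. a i \<in> pverts G"
        "sat G (\<lambda>i. if i < m then a i else (e(m := v)) i) \<phi>"
      using Suc by auto
    have "\<forall>i<Suc m. (a(m := v)) i \<in> pverts G" using va by (auto simp: less_Suc_eq)
    then show "\<exists>a. (\<forall>i<Suc m. a i \<in> pverts G) \<and> sat G (\<lambda>i. if i < Suc m then a i else e i) \<phi>"
      using va(3) unfolding upd by blast
  next
    assume "\<exists>a. (\<forall>i<Suc m. a i \<in> pverts G) \<and> sat G (\<lambda>i. if i < Suc m then a i else e i) \<phi>"
    then obtain a where a: "\<forall>i<Suc m. a i \<in> pverts G" "sat G (\<lambda>i. if i < Suc m then a i else e i) \<phi>" by blast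
    have "sat G (\<lambda>i. if i < m then a i else (e(m := a m)) i) \<phi>" using a(2) unfolding upd fun_upd_triv .
    moreover have "\<forall>i<m. a i \<in> pverts G" using a(1) by simp
    ultimately have "sat G (e(m := a m)) (exs m \<phi>)" unfolding Suc by blast
    moreover have "a m \<in> pverts G" using a(1) by simp
    ultimately show "sat G e (exs (Suc m) \<phi>)" unfolding exs.simps sat.simps by blast
  qed
qed simp

text \<open>\<open>has_component H m\<close> expresses that some component is isomorphic to the connected graph \<open>H\<close>
  with vertex set \<open>{1..m}\<close>; variable \<open>i\<close> stands for the vertex \<open>Suc i\<close>.\<close>

definition has_component :: "nat pair_pre_digraph \<Rightarrow> nat \<Rightarrow> fo" where
  "has_component H m = exs m (conj_list
     (map (\<lambda>(i, j). if i = j then Eq i j else Neg (Eq i j)) (List.product [0..<m] [0..<m]) @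
      map (\<lambda>(i, j). if (Suc i, Suc j) \<in> parcs H then Adj i j else Neg (Adj i j)) (List.product [0..<m] [0..<m]) @
      [All m (conj_list (map (\<lambda>i. Imp (Adj i m) (disj_list (map (\<lambda>j. Eq m j) [0..<m]))) [0..<m]))]))"

lemma sentence_has_component: "sentence (has_component H m)"
  unfolding sentence_def has_component_def fv_exs by (auto split: if_splits)

lemma sat_has_component:
  "sat G e (has_component H m) \<longleftrightarrow> (\<exists>a. (\<forall>i<m. a i \<in> pverts G) \<and>
     (\<forall>i<m. \<forall>j<m. (a i = a j \<longleftrightarrow> i = j) \<and> ((a i, a j) \<in> parcs G \<longleftrightarrow> (Suc i, Suc j) \<in> parcs H)) \<and>
     (\<forall>y\<in>pverts G. \<forall>i<m. (a i, y) \<in> parcs G \<longrightarrow> (\<exists>j<m. y = a j)))"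
proof -
  let ?B = "map (\<lambda>(i, j). if i = j then Eq i j else Neg (Eq i j)) (List.product [0..<m] [0..<m])"
  let ?C = "map (\<lambda>(i, j). if (Suc i, Suc j) \<in> parcs H then Adj i j else Neg (Adj i j)) (List.product [0..<m] [0..<m])"
  let ?D = "All m (conj_list (map (\<lambda>i. Imp (Adj i m) (disj_list (map (\<lambda>j. Eq m j) [0..<m]))) [0..<m]))"
  have prod_all: "(\<forall>\<phi>\<in>set (map (\<lambda>(i, j). F i j) (List.product [0..<m] [0..<m])). P \<phi>) \<longleftrightarrow>
      (\<forall>i<m. \<forall>j<m. P (F i j))" for F :: "nat \<Rightarrow> nat \<Rightarrow> fo" and P
    by auto
  have "(\<forall>\<phi>\<in>set ?B. sat G (\<lambda>i. if i < m then a i else e i) \<phi>) \<longleftrightarrow> (\<forall>i<m. \<forall>j<m. (a i = a j \<longleftrightarrow> i = j))" for a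
  proof -
    have "(\<forall>\<phi>\<in>set ?B. sat G (\<lambda>i. if i < m then a i else e i) \<phi>) \<longleftrightarrow>
        (\<forall>i<m. \<forall>j<m. sat G (\<lambda>i. if i < m then a i else e i) (if i = j then Eq i j else Neg (Eq i j)))"
      unfolding prod_all by blast
    also have "\<dots> \<longleftrightarrow> (\<forall>i<m. \<forall>j<m. (a i = a j \<longleftrightarrow> i = j))"
      by (intro all_cong) auto
    finally show ?thesis .
  qed
  moreover have "(\<forall>\<phi>\<in>set ?C. sat G (\<lambda>i. if i < m then a i else e i) \<phi>) \<longleftrightarrow>
      (\<forall>i<m. \<forall>j<m. ((a i, a j) \<in> parcs G \<longleftrightarrow> (Suc i, Suc j) \<in> parcs H))" for a
  proof -
    have "(\<forall>\<phi>\<in>set ?C. sat G (\<lambda>i. if i < m then a i else e i) \<phi>) \<longleftrightarrow>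
        (\<forall>i<m. \<forall>j<m. sat G (\<lambda>i. if i < m then a i else e i) (if (Suc i, Suc j) \<in> parcs H then Adj i j else Neg (Adj i j)))"
      unfolding prod_all by blast
    also have "\<dots> \<longleftrightarrow> (\<forall>i<m. \<forall>j<m. ((a i, a j) \<in> parcs G \<longleftrightarrow> (Suc i, Suc j) \<in> parcs H))"
      by (intro all_cong) auto
    finally show ?thesis .
  qed
  moreover have "sat G (\<lambda>i. if i < m then a i else e i) ?D \<longleftrightarrow>
      (\<forall>y\<in>pverts G. \<forall>i<m. (a i, y) \<in> parcs G \<longrightarrow> (\<exists>j<m. y = a j))" for a
    by (auto simp: atLeast0LessThan)
  ultimately show ?thesis
    unfolding has_component_def sat_exs sat_conj_list set_append ball_Un by auto
qed

section \<open>Isomorphism types and their masses\<close>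

definition isomorphic_to :: "nat pair_pre_digraph \<Rightarrow> nat pair_pre_digraph \<Rightarrow> bool" where
  "isomorphic_to H A \<longleftrightarrow> (\<exists>f. bij f \<and> A = map_graph f H)"

lemma iso_invariant_isomorphic_to: "iso_invariant (isomorphic_to H)"
  unfolding iso_invariant_def
proof (intro allI impI iffI)
  fix f :: "nat \<Rightarrow> nat" and G assume f: "bij f"
  show "isomorphic_to H (map_graph f G)" if "isomorphic_to H G"
    using that f unfolding isomorphic_to_def by (metis bij_comp map_graph_comp)
  show "isomorphic_to H G" if "isomorphic_to H (map_graph f G)"
  proof -
    obtain g where g: "bij g" "map_graph f G = map_graph g H" using \<open>isomorphic_to H (map_graph f G)\<close> unfolding isomorphic_to_def by metis
    then have "G = map_graph (inv f) (map_graph g H)" using map_graph_inv(1)[OF f, of G] by simp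
    then have "G = map_graph (inv f \<circ> g) H" by (simp add: map_graph_comp)
    moreover have "bij (inv f \<circ> g)" using g(1) f by (intro bij_comp bij_imp_bij_inv)
    ultimately show ?thesis unfolding isomorphic_to_def by blast
  qed
qed

text \<open>An induced copy of \<open>H\<close> from which no arc leads out contains the component
  of each of its vertices; as \<open>H\<close> is connected, it is that component.\<close>

lemma models_has_component:
  assumes G: "simple_graph G" and H: "H \<in> caterpillars {1..m}"
  shows "models G (has_component H m) \<longleftrightarrow> component_count (isomorphic_to H) G \<noteq> 0"
proof -
  note H' = caterpillarsD[OF H]
  have arcH: "u \<in> {1..m} \<and> v \<in> {1..m}" if "(u, v) \<in> parcs H" for u v
    using simple_graph_arc_verts[OF H'(1) that] H'(2) by simp
  have m: "m \<ge> 1" using H'(4) by (cases m) auto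
  have "models G (has_component H m) \<longleftrightarrow> sat G (\<lambda>_. 0) (has_component H m)"
    by (rule models_iff_sat[OF sentence_has_component])
  also have "\<dots> \<longleftrightarrow> component_count (isomorphic_to H) G \<noteq> 0"
  proof
    assume "sat G (\<lambda>_. 0) (has_component H m)"
    then obtain a where A1: "\<forall>i<m. a i \<in> pverts G"
      and A2: "\<forall>i<m. \<forall>j<m. (a i = a j \<longleftrightarrow> i = j) \<and> ((a i, a j) \<in> parcs G \<longleftrightarrow> (Suc i, Suc j) \<in> parcs H)"
      and A3: "\<forall>y\<in>pverts G. \<forall>i<m. (a i, y) \<in> parcs G \<longrightarrow> (\<exists>j<m. y = a j)"
      unfolding sat_has_component by (elim exE conjE)
    note aV = A1[rule_format] and a = A2[rule_format] and closed = A3[rule_format]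
    define g where "g = (\<lambda>v. a (v - 1))"
    have "inj_on g {1..m}"
    proof (rule inj_onI)
      fix u v assume uv: "u \<in> {1..m}" "v \<in> {1..m}" "g u = g v"
      then have "u - 1 = v - 1" using a[of "u - 1" "v - 1"] by (auto simp: g_def)
      then show "u = v" using uv by auto
    qed
    \<comment> \<open>Isomorphism is defined through bijections of all of \<open>nat\<close>, so the
      embedding of the m vertices has to be extended.\<close>
    then obtain f where f: "bij f" "\<And>v. v \<in> {1..m} \<Longrightarrow> f v = g v"
      using bij_extension[of "{1..m}" "g ` {1..m}" g] by (auto simp: bij_betw_def)
    have inj: "inj f" using f(1) by (rule bij_is_inj)
    define S where "S = f ` {1..m}"
    have S: "S = a ` {..<m}"
    proof -
      have "f ` {1..m} = (\<lambda>v. a (v - 1)) ` {1..m}" using f(2) by (intro image_cong) (auto simp: g_def)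
      also have "\<dots> = a ` ((\<lambda>v. v - 1) ` {1..m})" by (simp add: image_image)
      also have "(\<lambda>v. v - 1) ` {1..m} = {..<m}"
      proof (intro equalityI subsetI)
        fix x assume "x \<in> {..<m}"
        then show "x \<in> (\<lambda>v. v - 1) ` {1..m}" by (intro image_eqI[of _ _ "Suc x"]) auto
      qed auto
      finally show ?thesis by (simp add: S_def)
    qed
    have arc: "(f u, f v) \<in> parcs G \<longleftrightarrow> (u, v) \<in> parcs H" if "u \<in> {1..m}" "v \<in> {1..m}" for u v
      using a[of "u - 1" "v - 1"] that f(2) by (auto simp: g_def)
    have res: "parcs G \<inter> S \<times> S = map_prod f f ` parcs H"
    proof (intro equalityI subrelI)
      fix x y assume "(x, y) \<in> parcs G \<inter> S \<times> S"
      then obtain u v where "x = f u" "y = f v" "u \<in> {1..m}" "v \<in> {1..m}" "(x, y) \<in> parcs G" by (auto simp: S_def)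
      then show "(x, y) \<in> map_prod f f ` parcs H" using arc[of u v] by auto
    next
      fix x y assume "(x, y) \<in> map_prod f f ` parcs H"
      then obtain u v where uv: "x = f u" "y = f v" "(u, v) \<in> parcs H" by auto
      then show "(x, y) \<in> parcs G \<inter> S \<times> S" using arc[of u v] arcH[OF uv(3)] by (auto simp: S_def)
    qed
    have clS: "y \<in> S" if xy: "(x, y) \<in> parcs G" "x \<in> S" for x y
    proof -
      obtain i where i: "i < m" "x = a i" using \<open>x \<in> S\<close> S by auto
      have "y \<in> pverts G" using simple_graph_arc_verts[OF G xy(1)] by simp
      then obtain j where "j < m" "y = a j" using closed[of y i] i xy(1) by auto
      then show ?thesis using S by auto
    qed
    have 1: "f 1 \<in> S" using m by (auto simp: S_def)
    have "(parcs G)\<^sup>* `` {f 1} = (parcs G \<inter> S \<times> S)\<^sup>* `` {f 1}"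
      by (rule rtrancl_restrict[symmetric]) (use clS 1 in auto)
    also have "\<dots> = f ` ((parcs H)\<^sup>* `` {1})" unfolding res by (rule rtrancl_map_prod[OF inj])
    also have "(parcs H)\<^sup>* `` {1} = {1..m}"
    proof
      show "(parcs H)\<^sup>* `` {1} \<subseteq> {1..m}"
      proof
        fix v assume "v \<in> (parcs H)\<^sup>* `` {1}"
        then show "v \<in> {1..m}" using rtrancl_in_verts[OF H'(1), of 1 v] H'(2) m by simp
      qed
      show "{1..m} \<subseteq> (parcs H)\<^sup>* `` {1}" using H'(3)[of 1] m by auto
    qed
    finally have "(parcs G)\<^sup>* `` {f 1} = S" by (simp add: S_def)
    moreover have "f 1 \<in> pverts G" using 1 S aV by auto
    ultimately have comp: "S \<in> graph_components G" unfolding graph_components_def by blast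
    have "restrict_graph G S = map_graph f H"
      using res H'(2) by (intro pair_pre_digraph.equality) (auto simp: S_def)
    then have "isomorphic_to H (restrict_graph G S)" using f(1) unfolding isomorphic_to_def by blast
    then show "component_count (isomorphic_to H) G \<noteq> 0"
      unfolding component_count_eq_0[OF G] using comp by blast
  next
    assume "component_count (isomorphic_to H) G \<noteq> 0"
    then obtain S where S: "S \<in> graph_components G" "isomorphic_to H (restrict_graph G S)"
      unfolding component_count_eq_0[OF G] by blast
    then obtain f where f: "bij f" "restrict_graph G S = map_graph f H" unfolding isomorphic_to_def by blast
    have inj: "inj f" using f(1) by (rule bij_is_inj)
    have "pverts (restrict_graph G S) = pverts (map_graph f H)" "parcs (restrict_graph G S) = parcs (map_graph f H)"
      using f(2) by auto
    then have SV: "S = f ` {1..m}" and SE: "parcs G \<inter> S \<times> S = map_prod f f ` parcs H"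
      using H'(2) by auto
    define a where "a = (\<lambda>i. f (Suc i))"
    have aS: "a i \<in> S" if "i < m" for i using that SV by (auto simp: a_def)
    show "sat G (\<lambda>_. 0) (has_component H m)"
      unfolding sat_has_component
    proof (intro exI[of _ a] conjI allI impI ballI)
      show "a i \<in> pverts G" if "i < m" for i using aS[OF that] component_subset(1)[OF G S(1)] by auto
      show "a i = a j \<longleftrightarrow> i = j" for i j using inj by (simp add: a_def inj_eq)
      show "(a i, a j) \<in> parcs G \<longleftrightarrow> (Suc i, Suc j) \<in> parcs H" if "i < m" "j < m" for i j
      proof -
        have "(a i, a j) \<in> parcs G \<longleftrightarrow> (a i, a j) \<in> parcs G \<inter> S \<times> S" using aS that by auto
        also have "\<dots> \<longleftrightarrow> (Suc i, Suc j) \<in> parcs H"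
          unfolding SE a_def using inj by (auto simp: inj_eq intro: rev_image_eqI)
        finally show ?thesis .
      qed
      show "\<exists>j<m. y = a j" if "y \<in> pverts G" "i < m" "(a i, y) \<in> parcs G" for y i
      proof -
        have "y \<in> S" using component_closed[OF G S(1) that(3)] aS[OF that(2)] by simp
        then obtain v where "v \<in> {1..m}" "y = f v" using SV by auto
        then show ?thesis by (intro exI[of _ "v - 1"]) (auto simp: a_def)
      qed
    qed
  qed
  finally show ?thesis .
qed

text \<open>Labellings of one type on \<open>{1..m}\<close> are images of \<open>H\<close> under
  permutations. After rescaling, m! becomes the bound rho^m on the mass of a type of size m.\<close>

lemma count_caterpillars_isomorphic_to:
  assumes H: "H \<in> caterpillars {1..m}"
  shows "count_caterpillars (isomorphic_to H) n \<le> (if n = m then fact m else 0)"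
proof -
  note H' = caterpillarsD[OF H]
  have *: "A \<in> (\<lambda>p. map_graph p H) ` {p. p permutes {1..m}} \<and> n = m"
    if A: "A \<in> caterpillars {1..n}" "isomorphic_to H A" for A
  proof -
    obtain f where f: "bij f" "A = map_graph f H" using A(2) unfolding isomorphic_to_def by blast
    have im: "f ` {1..m} = {1..n}" using caterpillarsD(2)[OF A(1)] f(2) H'(2) by simp
    have inj: "inj_on f {1..m}" using f(1) by (meson bij_is_inj inj_on_subset subset_UNIV)
    then have "card {1..n} = card {1..m}" using card_image[OF inj] im by simp
    then have nm: "n = m" by simp
    \<comment> \<open>The bijection \<open>f\<close> preserves \<open>{1..m}\<close> but may move
      the other numbers; resetting these gives a genuine permutation with the same image of
      \<open>H\<close>.\<close>
    define p where "p = (\<lambda>v. if v \<in> {1..m} then f v else v)"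
    have "bij_betw p {1..m} {1..m}"
      using inj im nm bij_betw_cong[of "{1..m}" p f "{1..m}"] by (simp add: p_def bij_betw_def)
    then have "p permutes {1..m}" by (rule bij_imp_permutes) (unfold p_def, rule if_not_P)
    moreover have "A = map_graph p H"
      unfolding f(2)
    proof (rule pair_pre_digraph.equality)
      show "pverts (map_graph f H) = pverts (map_graph p H)" using H'(2) by (simp add: p_def)
      have "map_prod f f e = map_prod p p e" if "e \<in> parcs H" for e
        using that simple_graph_arc_verts[OF H'(1), of "fst e" "snd e"] H'(2) by (cases e) (auto simp: p_def)
      then show "parcs (map_graph f H) = parcs (map_graph p H)" by (auto simp: image_iff)
    qed simp
    ultimately show ?thesis using nm by blast
  qed
  show ?thesis
  proof (cases "n = m")
    case True
    have "{A \<in> caterpillars {1..n}. isomorphic_to H A} \<subseteq> (\<lambda>p. map_graph p H) ` {p. p permutes {1..m}}"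
      using * by blast
    then have "count_caterpillars (isomorphic_to H) n \<le> card {p. p permutes {1..m}}"
      unfolding count_caterpillars_def by (intro surj_card_le) (auto intro: finite_permutations)
    then show ?thesis using True card_permutations[of "{1..m}" m] by simp
  next
    case False
    then have "{A \<in> caterpillars {1..n}. isomorphic_to H A} = {}" using * by blast
    then show ?thesis unfolding count_caterpillars_def by (simp only: card.empty)
  qed
qed

text \<open>The limiting Poisson mean of the number of components isomorphic to a member of the set.
  Isomorphic members contribute only once.\<close>

definition iso_class_mass :: "nat pair_pre_digraph set \<Rightarrow> real" where
  "iso_class_mass \<H> = fps_sum (egf (count_caterpillars (\<lambda>A. \<exists>H\<in>\<H>. isomorphic_to H A)))"

lemma iso_classes:
  assumes "\<H> \<subseteq> (\<Union>k\<in>{M..<N}. caterpillars {1..k})"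
  shows "iso_invariant (\<lambda>A. \<exists>H\<in>\<H>. isomorphic_to H A)"
    "\<And>n. n \<ge> N \<Longrightarrow> fps_nth (egf (count_caterpillars (\<lambda>A. \<exists>H\<in>\<H>. isomorphic_to H A))) n = 0"
    "abs_summable_fps (egf (count_caterpillars (\<lambda>A. \<exists>H\<in>\<H>. isomorphic_to H A)))"
    "iso_class_mass \<H> = (\<Sum>n<N. fps_nth (egf (count_caterpillars (\<lambda>A. \<exists>H\<in>\<H>. isomorphic_to H A))) n)"
proof -
  let ?U = "\<lambda>A. \<exists>H\<in>\<H>. isomorphic_to H A"
  show "iso_invariant ?U"
    using iso_invariant_isomorphic_to unfolding iso_invariant_def by auto
  show z: "\<And>n. n \<ge> N \<Longrightarrow> fps_nth (egf (count_caterpillars ?U)) n = 0"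
  proof -
    fix n assume n: "n \<ge> N"
    have "\<not> ?U A" if A: "A \<in> caterpillars {1..n}" for A
    proof
      assume "?U A"
      then obtain H where H: "H \<in> \<H>" "isomorphic_to H A" by blast
      then have "H \<in> (\<Union>k\<in>{M..<N}. caterpillars {1..k})" using assms by blast
      then obtain k where k: "k < N" "H \<in> caterpillars {1..k}" by auto
      have "finite {A \<in> caterpillars {1..n}. isomorphic_to H A}" using finite_caterpillars(1)[of "{1..n}"] by auto
      moreover have "A \<in> {A \<in> caterpillars {1..n}. isomorphic_to H A}" using A H by blast
      ultimately have "count_caterpillars (isomorphic_to H) n > 0"
        unfolding count_caterpillars_def card_gt_0_iff by blast
      then show False using count_caterpillars_isomorphic_to[OF k(2), of n] k(1) n by simp
    qed
    then have "{A \<in> caterpillars {1..n}. ?U A} = {}" by blast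
    then have "count_caterpillars ?U n = 0" unfolding count_caterpillars_def by (simp only: card.empty)
    then show "fps_nth (egf (count_caterpillars ?U)) n = 0" by (simp add: egf_def)
  qed
  show "abs_summable_fps (egf (count_caterpillars ?U))"
    by (rule abs_summable_fps_finite(1), erule z)
  show "iso_class_mass \<H> = (\<Sum>n<N. fps_nth (egf (count_caterpillars ?U)) n)"
    unfolding iso_class_mass_def by (rule abs_summable_fps_finite(2), erule z)
qed

lemma iso_class_mass_empty: "iso_class_mass {} = 0"
  by (simp add: iso_class_mass_def fps_sum_def egf_def count_caterpillars_def)

text \<open>The bound rho^M on the step size is uniform over all types with at least M vertices, as
  the discrete intermediate value argument requires.\<close>

lemma iso_class_mass_insert:
  assumes \<H>: "insert H \<H> \<subseteq> (\<Union>k\<in>{M..<N}. caterpillars {1..k})"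
  shows "iso_class_mass (insert H \<H>) \<le> iso_class_mass \<H> + rho ^ M"
proof -
  obtain k where k: "M \<le> k" "k < N" "H \<in> caterpillars {1..k}" using \<H> by auto
  let ?U = "\<lambda>\<H> A. \<exists>H\<in>\<H>. isomorphic_to H A"
  have le: "fps_nth (egf (count_caterpillars (?U (insert H \<H>)))) n \<le>
      fps_nth (egf (count_caterpillars (?U \<H>))) n + (if n = k then rho ^ k else 0)" for n
  proof -
    have "{A \<in> caterpillars {1..n}. ?U (insert H \<H>) A} \<subseteq>
        {A \<in> caterpillars {1..n}. ?U \<H> A} \<union> {A \<in> caterpillars {1..n}. isomorphic_to H A}" by auto
    then have "count_caterpillars (?U (insert H \<H>)) n \<le>
        card ({A \<in> caterpillars {1..n}. ?U \<H> A} \<union> {A \<in> caterpillars {1..n}. isomorphic_to H A})"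
      unfolding count_caterpillars_def using finite_caterpillars(1)[of "{1..n}"] by (intro card_mono) auto
    also have "\<dots> \<le> count_caterpillars (?U \<H>) n + count_caterpillars (isomorphic_to H) n"
      unfolding count_caterpillars_def by (rule card_Un_le)
    also have "\<dots> \<le> count_caterpillars (?U \<H>) n + (if n = k then fact k else 0)"
      using count_caterpillars_isomorphic_to[OF k(3)] by (intro add_left_mono)
    finally have "fps_nth (egf (count_caterpillars (?U (insert H \<H>)))) n \<le>
        fps_nth (egf (\<lambda>n. count_caterpillars (?U \<H>) n + (if n = k then fact k else 0))) n"
      by (rule fps_nth_egf_mono)
    then show ?thesis by (auto simp: egf_def distrib_right add_divide_distrib)
  qed
  have "iso_class_mass (insert H \<H>) \<le>
      (\<Sum>n<N. fps_nth (egf (count_caterpillars (?U \<H>))) n + (if n = k then rho ^ k else 0))"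
    unfolding iso_classes(4)[OF \<H>] by (rule sum_mono) (rule le)
  also have "\<dots> = iso_class_mass \<H> + rho ^ k"
    using k(2) iso_classes(4)[of \<H> M N] \<H> by (simp add: sum.distrib)
  also have "\<dots> \<le> iso_class_mass \<H> + rho ^ M"
    using k(1) rho(1) rho_less_1 by (intro add_left_mono power_decreasing) auto
  finally show ?thesis .
qed

lemma iso_class_mass_full:
  "(\<Sum>n\<in>{M..<N}. fps_nth (egf num_caterpillars) n) \<le> iso_class_mass (\<Union>k\<in>{M..<N}. caterpillars {1..k})"
proof -
  let ?F = "\<Union>k\<in>{M..<N}. caterpillars {1..k :: nat}"
  let ?U = "\<lambda>A. \<exists>H\<in>?F. isomorphic_to H A"
  have iso_refl: "isomorphic_to A A" for A
    unfolding isomorphic_to_def by (intro exI[of _ "\<lambda>x. x"]) (simp add: map_graph_id bij_def)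
  have cc: "count_caterpillars ?U n = num_caterpillars n" if "n \<in> {M..<N}" for n
  proof -
    have "{A \<in> caterpillars {1..n}. ?U A} = caterpillars {1..n}" using that iso_refl by blast
    then show ?thesis by (simp add: count_caterpillars_def num_caterpillars_def)
  qed
  have "(\<Sum>n\<in>{M..<N}. fps_nth (egf num_caterpillars) n) = (\<Sum>n\<in>{M..<N}. fps_nth (egf (count_caterpillars ?U)) n)"
  proof (rule sum.cong[OF refl])
    fix n assume "n \<in> {M..<N}"
    show "fps_nth (egf num_caterpillars) n = fps_nth (egf (count_caterpillars ?U)) n"
      unfolding egf_def fps_nth_Abs_fps cc[OF \<open>n \<in> {M..<N}\<close>] ..
  qed
  also have "\<dots> \<le> (\<Sum>n<N. fps_nth (egf (count_caterpillars ?U)) n)"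
    by (rule sum_mono2) (auto simp: egf_nth_nonneg)
  also have "\<dots> = iso_class_mass ?F" by (rule iso_classes(4)[symmetric]) (rule order_refl)
  finally show ?thesis .
qed

text \<open>Adding the elements one at a time, the first set whose value reaches \<open>t\<close>
  overshoots by at most one step; monotonicity plays no part in this.\<close>

lemma discrete_intermediate_value:
  fixes f :: "'a set \<Rightarrow> real"
  assumes "finite F" "f {} \<le> t" "t \<le> f F" "0 \<le> \<epsilon>"
    and step: "\<And>x X. insert x X \<subseteq> F \<Longrightarrow> f (insert x X) \<le> f X + \<epsilon>"
  obtains X where "X \<subseteq> F" "t \<le> f X" "f X \<le> t + \<epsilon>"
proof -
  have "\<exists>X\<subseteq>F. t \<le> f X \<and> f X \<le> t + \<epsilon>"
    using assms
  proof (induction F rule: finite_induct)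
    case empty
    then show ?case by force
  next
    case (insert x F)
    show ?case
    proof (cases "t \<le> f F")
      case True
      then have "\<exists>X\<subseteq>F. t \<le> f X \<and> f X \<le> t + \<epsilon>"
        using insert.prems by (intro insert.IH) auto
      then show ?thesis by blast
    next
      case False
      then have "f (insert x F) \<le> t + \<epsilon>" using insert.prems(4)[of x F] by simp
      then show ?thesis using insert.prems(2) by blast
    qed
  qed
  then show thesis using that by blast
qed

text \<open>The coefficients are c plus a null sequence with c > 0; were the sum bounded, they would
  tend to 0.\<close>

lemma sum_num_caterpillars_unbounded: "\<exists>N. B \<le> (\<Sum>n\<in>{M..<N}. fps_nth (egf num_caterpillars) n)"
proof (rule ccontr)
  let ?c = "fps_nth (egf num_caterpillars)"
  assume "\<not> ?thesis"
  then have lt: "(\<Sum>n\<in>{M..<N}. ?c n) < B" for N by (meson not_le)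
  have "(\<Sum>n<N. ?c (n + M)) \<le> B" for N
  proof -
    have "(\<Sum>n<N. ?c (n + M)) = (\<Sum>n\<in>{M..<N + M}. ?c n)"
      using sum.shift_bounds_nat_ivl[of ?c 0 M N] by (simp add: atLeast0LessThan)
    then show ?thesis using lt[of "N + M"] by simp
  qed
  then have "summable (\<lambda>n. ?c (n + M))"
    by (intro summableI_nonneg_bounded[of _ B] egf_nth_nonneg)
  then have "summable ?c" by simp
  then have to0: "?c \<longlonglongrightarrow> 0" by (rule summable_LIMSEQ_zero)
  obtain c A where cA: "c > 0" "abs_summable_fps A" "egf num_caterpillars = fps_const c * fps_ones + A"
    by (rule egf_num_caterpillars)
  have "fps_nth A \<longlonglongrightarrow> 0" by (intro summable_LIMSEQ_zero abs_summable_fps_imp_summable cA(2))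
  then have "(\<lambda>n. ?c n - fps_nth A n) \<longlonglongrightarrow> 0 - 0" by (intro tendsto_diff to0)
  moreover have "?c n - fps_nth A n = c" for n unfolding cA(3) by (simp add: fps_ones_def)
  ultimately have "(\<lambda>n :: nat. c) \<longlonglongrightarrow> 0" by simp
  then have "c = 0" by (simp add: LIMSEQ_const_iff)
  then show False using cA(1) by simp
qed

lemma avoiding_sentence:
  assumes "finite \<H>" and \<H>: "\<H> \<subseteq> (\<Union>k\<in>{M..<N}. caterpillars {1..k})"
  obtains \<phi> where "sentence \<phi>" "forest_prob (\<lambda>G. models G \<phi>) \<longlonglongrightarrow> exp (- iso_class_mass \<H>)"
proof -
  obtain Hs where Hs: "set Hs = \<H>" using finite_list[OF assms(1)] by blast
  define \<phi> where "\<phi> = conj_list (map (\<lambda>H. Neg (has_component H (card (pverts H)))) Hs)"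
  have s: "sentence \<phi>"
    by (simp add: \<phi>_def sentence_def sentence_has_component[unfolded sentence_def])
  have "models G \<phi> \<longleftrightarrow> component_count (\<lambda>A. \<exists>H\<in>\<H>. isomorphic_to H A) G = 0"
    if "G \<in> forests {1..n}" for G n
  proof -
    note G = forestsD(1)[OF that]
    have "models G \<phi> \<longleftrightarrow> sat G (\<lambda>_. 0) \<phi>" by (rule models_iff_sat[OF s])
    also have "\<dots> \<longleftrightarrow> (\<forall>H\<in>\<H>. \<not> sat G (\<lambda>_. 0) (has_component H (card (pverts H))))"
      by (simp add: \<phi>_def Hs)
    also have "\<dots> \<longleftrightarrow> (\<forall>H\<in>\<H>. component_count (isomorphic_to H) G = 0)"
    proof (rule ball_cong[OF refl])
      fix H assume "H \<in> \<H>"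
      then obtain k where k: "H \<in> caterpillars {1..k}" using \<H> by blast
      then have "card (pverts H) = k" by (simp add: caterpillars_def)
      then show "\<not> sat G (\<lambda>_. 0) (has_component H (card (pverts H))) \<longleftrightarrow> component_count (isomorphic_to H) G = 0"
        using models_has_component[OF G k] models_iff_sat[OF sentence_has_component, of G H k "\<lambda>_. 0"] by simp
    qed
    also have "\<dots> \<longleftrightarrow> component_count (\<lambda>A. \<exists>H\<in>\<H>. isomorphic_to H A) G = 0"
      unfolding component_count_eq_0[OF G] by blast
    finally show ?thesis .
  qed
  then have "count_forests (\<lambda>G. models G \<phi>) = count_forests (\<lambda>G. component_count (\<lambda>A. \<exists>H\<in>\<H>. isomorphic_to H A) G = 0)"
    by (rule count_forests_cong)
  then have "forest_prob (\<lambda>G. models G \<phi>) = forest_prob (\<lambda>G. component_count (\<lambda>A. \<exists>H\<in>\<H>. isomorphic_to H A) G = 0)"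
    by (simp add: forest_prob_def[abs_def])
  moreover have "forest_prob (\<lambda>G. component_count (\<lambda>A. \<exists>H\<in>\<H>. isomorphic_to H A) G = 0) \<longlonglongrightarrow> exp (- iso_class_mass \<H>)"
    unfolding iso_class_mass_def by (rule forest_prob_avoiding[OF iso_classes(1)[OF \<H>] iso_classes(3)[OF \<H>]])
  ultimately show thesis using that[OF s] by simp
qed

text \<open>Types with at least M vertices change the mass in steps of at most rho^M < epsilon, and
  together they exceed t. So some finite set of types has mass between t and t + epsilon, and exp (-
  t) changes by less than epsilon there, being 1-Lipschitz for t >= 0.\<close>

lemma limits_approach:
  assumes t: "t \<ge> 0" and e: "\<epsilon> > 0"
  obtains \<phi> where "sentence \<phi>" "\<bar>lim (prob_models random_caterpillar_forest \<phi>) - exp (- t)\<bar> < \<epsilon>"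
proof -
  obtain M where M: "rho ^ M < \<epsilon>" using real_arch_pow_inv[OF e rho_less_1] by blast
  obtain N where N: "t \<le> (\<Sum>n\<in>{M..<N}. fps_nth (egf num_caterpillars) n)"
    using sum_num_caterpillars_unbounded by blast
  let ?F = "\<Union>k\<in>{M..<N}. caterpillars {1..k :: nat}"
  have F: "finite ?F" using finite_caterpillars(1) by auto
  obtain \<H> where \<H>: "\<H> \<subseteq> ?F" "t \<le> iso_class_mass \<H>" "iso_class_mass \<H> \<le> t + rho ^ M"
  proof (rule discrete_intermediate_value[of ?F iso_class_mass t "rho ^ M"])
    show "iso_class_mass {} \<le> t" using t by (simp add: iso_class_mass_empty)
    show "t \<le> iso_class_mass ?F" using N iso_class_mass_full[of M N] by simp
    show "0 \<le> rho ^ M" using rho(1) by simp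
    show "iso_class_mass (insert H \<H>) \<le> iso_class_mass \<H> + rho ^ M" if "insert H \<H> \<subseteq> ?F" for H \<H>
      by (rule iso_class_mass_insert[OF that])
  qed (use F in auto)
  have "finite \<H>" using \<H>(1) F finite_subset by blast
  then obtain \<phi> where \<phi>: "sentence \<phi>" "forest_prob (\<lambda>G. models G \<phi>) \<longlonglongrightarrow> exp (- iso_class_mass \<H>)"
    using avoiding_sentence[OF _ \<H>(1)] by blast
  have lim: "lim (prob_models random_caterpillar_forest \<phi>) = exp (- iso_class_mass \<H>)"
    using limI[OF \<phi>(2)] by (simp add: prob_models_forest)
  define d where "d = iso_class_mass \<H> - t"
  have d: "0 \<le> d" "d < \<epsilon>" using \<H> M by (auto simp: d_def)
  have "exp (- iso_class_mass \<H>) = exp (- t) * exp (- d)" by (simp add: d_def flip: exp_add)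
  moreover have "1 - d \<le> exp (- d)" using exp_ge_add_one_self[of "- d"] by simp
  moreover have "exp (- d) \<le> 1" using d by simp
  moreover have "exp (- t) * (1 - exp (- d)) \<le> 1 * (1 - exp (- d))"
    using t d by (intro mult_right_mono) auto
  moreover have "0 \<le> exp (- t) * (1 - exp (- d))" using d by simp
  ultimately have "\<bar>exp (- iso_class_mass \<H>) - exp (- t)\<bar> < \<epsilon>"
    using d by (simp add: right_diff_distrib)
  then show thesis using that[OF \<phi>(1)] lim by simp
qed

theorem closure_limits:
  "closure {lim (prob_models random_caterpillar_forest \<phi>) | \<phi>. sentence \<phi>} = {0..1}"
proof
  let ?L = "{lim (prob_models random_caterpillar_forest \<phi>) | \<phi>. sentence \<phi>}"
  have "lim (prob_models random_caterpillar_forest \<phi>) \<in> {0..1}" if s: "sentence \<phi>" for \<phi>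
  proof -
    have "convergent (prob_models random_caterpillar_forest \<phi>)"
      using convergent_forest_prob_models[OF s] by (simp add: prob_models_forest)
    then have lim: "prob_models random_caterpillar_forest \<phi> \<longlonglongrightarrow> lim (prob_models random_caterpillar_forest \<phi>)"
      by (simp add: convergent_LIMSEQ_iff)
    have "prob_models random_caterpillar_forest \<phi> n \<in> {0..1}" for n
      by (simp add: prob_models_def)
    then show ?thesis using closed_sequentially[OF closed_real_atLeastAtMost _ lim] by blast
  qed
  then show "closure ?L \<subseteq> {0..1}" by (intro closure_minimal) auto
  have pos: "{0<..1} \<subseteq> closure ?L"
  proof
    fix y :: real assume y: "y \<in> {0<..1}"
    have "\<exists>z\<in>?L. dist z y < \<epsilon>" if e: "\<epsilon> > 0" for \<epsilon>
    proof -
      have "- ln y \<ge> 0" "exp (- (- ln y)) = y" using y by auto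
      then obtain \<phi> where "sentence \<phi>" "\<bar>lim (prob_models random_caterpillar_forest \<phi>) - y\<bar> < \<epsilon>"
        using limits_approach[OF _ e] by metis
      then show ?thesis by (auto simp: dist_real_def)
    qed
    then show "y \<in> closure ?L" by (simp add: closure_approachable)
  qed
  \<comment> \<open>The values exp (- t) are positive and cover only the half-open interval; the
    endpoint 0 comes from closedness.\<close>
  have "{0..1} = closure {0<..1 :: real}" by simp
  also have "\<dots> \<subseteq> closure ?L" using pos by (intro closure_minimal) auto
  finally show "{0..1} \<subseteq> closure ?L" .
qed

section \<open>Failure of the zero-one law for caterpillars\<close>

text \<open>Some leaf is adjacent to a vertex of degree two. If the spine has at least two vertices, this
  means that an end of the spine carries a single leaf.\<close>

definition pendant_path :: fo where
  "pendant_path = Ex 0 (Ex 1 (And (Adj 0 1) (And (All 2 (Imp (Adj 0 2) (Eq 2 1)))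
     (Ex 2 (And (Adj 1 2) (And (Neg (Eq 2 0)) (All 3 (Imp (Adj 1 3) (Or (Eq 3 0) (Eq 3 2))))))))))"

lemma sentence_pendant_path: "sentence pendant_path"
  by (auto simp: sentence_def pendant_path_def)

lemma models_pendant_path:
  assumes G: "simple_graph G"
  shows "models G pendant_path \<longleftrightarrow> (\<exists>x y. (x, y) \<in> parcs G \<and> (\<forall>z. (x, z) \<in> parcs G \<longrightarrow> z = y) \<and>
    (\<exists>z. (y, z) \<in> parcs G \<and> z \<noteq> x \<and> (\<forall>w. (y, w) \<in> parcs G \<longrightarrow> w = x \<or> w = z)))"
proof -
  have v: "u \<in> pverts G \<and> w \<in> pverts G" if "(u, w) \<in> parcs G" for u w
    by (rule simple_graph_arc_verts[OF G that])
  have all: "(\<forall>z\<in>pverts G. (x, z) \<in> parcs G \<longrightarrow> P z) \<longleftrightarrow> (\<forall>z. (x, z) \<in> parcs G \<longrightarrow> P z)" for x P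
    using v by blast
  have ex: "(\<exists>z\<in>pverts G. (x, z) \<in> parcs G \<and> P z) \<longleftrightarrow> (\<exists>z. (x, z) \<in> parcs G \<and> P z)" for x P
    using v by blast
  have "models G pendant_path \<longleftrightarrow> sat G e pendant_path" for e
    by (rule models_iff_sat[OF sentence_pendant_path])
  also have "sat G e pendant_path \<longleftrightarrow> (\<exists>x\<in>pverts G. \<exists>y\<in>pverts G. (x, y) \<in> parcs G \<and>
      (\<forall>z\<in>pverts G. (x, z) \<in> parcs G \<longrightarrow> z = y) \<and>
      (\<exists>z\<in>pverts G. (y, z) \<in> parcs G \<and> z \<noteq> x \<and> (\<forall>w\<in>pverts G. (y, w) \<in> parcs G \<longrightarrow> w = x \<or> w = z)))" for e
    by (simp add: pendant_path_def)
  finally show ?thesis unfolding all ex using v by blast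
qed

lemma ended_end_block:
  assumes L: "L \<in> ended_blob_lists {k} {k} V"
  obtains v A M where "L = (v, A) # M" "M \<noteq> []" "card A = k" "wf_blobs L"
proof -
  have L': "wf_blobs L" "2 \<le> length L" "card (snd (hd L)) = k"
    using L by (auto simp: ended_blob_lists_def blob_lists_def)
  obtain b M where bM: "L = b # M" using L'(2) by (cases L) auto
  obtain v A where b: "b = (v, A)" by (cases b)
  have "M \<noteq> []" using L'(2) bM by auto
  then show thesis using that[of v A M] L' bM b by simp
qed

text \<open>The witnesses are the single leaf of the first blob and the end vertex of the spine,
  whose other neighbour is the next spine vertex.\<close>

lemma models_pendant_path_1:
  assumes L: "L \<in> ended_blob_lists {1} {1} V"
  shows "models (blob_graph L) pendant_path"
proof -
  obtain v A M where M: "L = (v, A) # M" "M \<noteq> []" "card A = 1" "wf_blobs L"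
    using ended_end_block[OF L] .
  obtain a where A: "A = {a}" using M(3) card_1_singletonE by blast
  obtain c N where N: "M = c # N" using M(2) by (cases M) auto
  let ?G = "blob_graph L"
  have G: "parcs ?G = {v} \<times> {a} \<union> {a} \<times> {v} \<union> {(v, fst c), (fst c, v)} \<union> parcs (blob_graph M)"
    unfolding M(1) N A by simp
  have wf: "v \<noteq> a" "v \<notin> blobs_set M" "a \<notin> blobs_set M" using M(4) unfolding M(1) A by auto
  have c: "fst c \<in> blobs_set M" by (simp add: N blob_set_def)
  have sub: "(x, y) \<notin> parcs (blob_graph M)" if "x \<notin> blobs_set M" for x y
    using parcs_blob_graph_subset[of M] that by blast
  have nv: "(v, w) \<in> parcs ?G \<longleftrightarrow> w = a \<or> w = fst c" for w
    unfolding G using wf c sub[OF wf(2)] by auto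
  have na: "(a, w) \<in> parcs ?G \<longleftrightarrow> w = v" for w
    unfolding G using wf c sub[OF wf(3)] by auto
  have "fst c \<noteq> a" using wf c by auto
  then show ?thesis
    unfolding models_pendant_path[OF simple_graph_blob_graph[OF M(4)]]
    by (intro exI[of _ a] exI[of _ v]) (simp add: nv na)
qed

text \<open>A vertex with only one neighbour is a leaf, so its neighbour is a spine vertex. That
  vertex has degree at least three: at an end two leaves and a spine neighbour, in the interior the
  given leaf and two spine neighbours.\<close>

lemma not_models_pendant_path_2:
  assumes L: "L \<in> ended_blob_lists {2} {2} V"
  shows "\<not> models (blob_graph L) pendant_path"
proof
  have L': "wf_blobs L" "2 \<le> length L" "card (snd (hd L)) = 2" "card (snd (last L)) = 2"
    using L by (auto simp: ended_blob_lists_def blob_lists_def)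
  then have ne: "L \<noteq> []" "snd (hd L) \<noteq> {}" "snd (last L) \<noteq> {}" by auto
  let ?G = "blob_graph L" and ?p = "map fst L"
  assume "models ?G pendant_path"
  then obtain x y z where xy: "(x, y) \<in> parcs ?G" "\<forall>z. (x, z) \<in> parcs ?G \<longrightarrow> z = y"
    and y: "\<forall>w. (y, w) \<in> parcs ?G \<longrightarrow> w = x \<or> w = z"
    unfolding models_pendant_path[OF simple_graph_blob_graph[OF L'(1)]] by blast
  have three: False if "(y, a) \<in> parcs ?G" "(y, b) \<in> parcs ?G" "(y, c) \<in> parcs ?G" "a \<noteq> b" "a \<noteq> c" "b \<noteq> c" for a b c
    using y that by metis
  have "x \<notin> branch_vertices ?G" using xy by (auto simp: branch_vertices_def)
  then have "x \<notin> set ?p" using branch_vertices_blob_graph[OF L'(1,2) ne(2,3)] by simp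
  moreover have "x \<in> blobs_set L" using xy(1) parcs_blob_graph_subset by blast
  then obtain b where b: "b \<in> set L" "x \<in> blob_set b" by (auto simp: blobs_set_def)
  ultimately have xb: "x \<in> snd b" by (auto simp: blob_set_def)
  then have yb: "y = fst b" using blob_graph_leaf[OF L'(1) b(1) _ xy(1)] by simp
  obtain i where i: "i < length L" "b = L ! i" using b(1) by (auto simp: in_set_conv_nth)
  have leaf: "(y, a) \<in> parcs ?G" "a \<notin> set ?p" if "a \<in> snd b" for a
    using that b(1) leaf_not_spine[OF L'(1) b(1)] unfolding yb by (auto simp: blob_graph_def)
  have P: "path_arcs ?p \<subseteq> parcs ?G" by (auto simp: blob_graph_def)
  have yi: "y = ?p ! i" using yb i by simp
  have two: False if c2: "card (snd b) = 2" "j < length L" "(y, ?p ! j) \<in> path_arcs ?p" for j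
  proof -
    obtain a c where ac: "snd b = {a, c}" "a \<noteq> c" using c2 by (auto simp: card_2_iff)
    have "?p ! j \<in> set ?p" using that(2) by (intro nth_mem) simp
    then have "?p ! j \<noteq> a" "?p ! j \<noteq> c" using leaf(2)[of a] leaf(2)[of c] ac by auto
    then show False
      using three[of a c "?p ! j"] leaf(1)[of a] leaf(1)[of c] ac that(3) P by auto
  qed
  consider "i = 0" | "i = length L - 1" "i \<noteq> 0" | "i \<noteq> 0" "Suc i < length L" using i by linarith
  then show False
  proof cases
    case 1
    then have "card (snd b) = 2" using L'(3) i ne(1) by (simp add: hd_conv_nth)
    moreover have "(y, ?p ! 1) \<in> path_arcs ?p" using path_arcs_nth[of 0 ?p] L'(2) yi 1 by simp
    ultimately show False using two[of 1] L'(2) by simp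
  next
    case 2
    then obtain j where j: "i = Suc j" using not0_implies_Suc by blast
    have "card (snd b) = 2" using L'(4) i ne(1) 2 by (simp add: last_conv_nth)
    moreover have "(y, ?p ! j) \<in> path_arcs ?p" using path_arcs_nth[of j ?p] i yi j by simp
    ultimately show False using two[of j] i j by simp
  next
    case 3
    then obtain j where j: "i = Suc j" using not0_implies_Suc by blast
    have arcs: "(y, ?p ! j) \<in> parcs ?G" "(y, ?p ! Suc i) \<in> parcs ?G"
      using path_arcs_nth[of j ?p] path_arcs_nth[of i ?p] i yi j 3 P by auto
    have "?p ! j \<noteq> ?p ! Suc i" using distinct_spine[OF L'(1)] i j 3 by (subst nth_eq_iff_index_eq) auto
    moreover have "j < length ?p" "Suc i < length ?p" using i j 3 by auto
    then have "?p ! j \<in> set ?p" "?p ! Suc i \<in> set ?p" by (metis nth_mem)+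
    then have "x \<noteq> ?p ! j" "x \<noteq> ?p ! Suc i" using leaf(2)[OF xb] by auto
    ultimately show False using three[OF leaf(1)[OF xb] arcs] by blast
  qed
qed

lemma prob_models_caterpillar:
  assumes "n \<ge> 1"
  shows "prob_models random_caterpillar \<phi> n =
    real (card {G \<in> caterpillars {1..n}. models G \<phi>}) / real (num_caterpillars n)"
proof -
  have eq: "caterpillars_on n = caterpillars {1..n}" by (simp add: caterpillars_def caterpillars_on_def)
  have "prob_models random_caterpillar \<phi> n =
      real (card (caterpillars {1..n} \<inter> {G. models G \<phi>})) / real (card (caterpillars {1..n}))"
    unfolding prob_models_def random_caterpillar_def eq[symmetric]
    by (rule measure_pmf_of_set[OF caterpillars_on_nonempty[OF assms] finite_caterpillars_on])
  also have "caterpillars {1..n} \<inter> {G. models G \<phi>} = {G \<in> caterpillars {1..n}. models G \<phi>}" by blast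
  finally show ?thesis by (simp add: num_caterpillars_def)
qed

text \<open>A deliberately crude bound: halving allows for reversal, and the number of all blob
  lists replaces the smaller number of caterpillars. Only positivity of the limit matters.\<close>

lemma ended_fraction_le:
  assumes n: "n \<ge> 1" and k: "k \<ge> 1"
    and P: "\<And>L. L \<in> ended_blob_lists {k} {k} {1..n} \<Longrightarrow> P (blob_graph L)"
  shows "real (cons_count {k} (cons_count {k} num_blob_lists) n) / real (num_blob_lists n) / 2 \<le>
    real (card {G \<in> caterpillars {1..n}. P G}) / real (num_caterpillars n)"
proof -
  let ?V = "{1..n}" and ?T = "ended_blob_lists {k} {k} {1..n}"
  have "?T \<subseteq> ended_blob_lists {1..} {1..} ?V" using k by (auto simp: ended_blob_lists_def)
  then have "card ?T \<le> 2 * card (blob_graph ` ?T)" by (intro card_le_fibres) auto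
  also have "blob_graph ` ?T \<subseteq> {G \<in> caterpillars ?V. P G}"
    using blob_graph_image_subset[of ?V "{k}" "{k}"] P n by auto
  then have "card (blob_graph ` ?T) \<le> card {G \<in> caterpillars ?V. P G}"
    using finite_caterpillars(1)[of ?V] by (intro card_mono) auto
  finally have "real (cons_count {k} (cons_count {k} num_blob_lists) n) / 2 \<le> real (card {G \<in> caterpillars ?V. P G})"
    using card_ended_blob_lists(2)[of ?V "{k}" "{k}"] by simp
  moreover have "num_caterpillars n \<le> num_blob_lists n"
    using finite_caterpillars(2)[of ?V] by (simp add: num_caterpillars_def)
  moreover have "caterpillars ?V \<noteq> {}"
    using caterpillars_on_nonempty[OF n] by (simp add: caterpillars_def caterpillars_on_def)
  then have "num_caterpillars n > 0"
    using finite_caterpillars(1)[of ?V] by (simp add: num_caterpillars_def card_gt_0_iff)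
  ultimately have "real (cons_count {k} (cons_count {k} num_blob_lists) n) / 2 / real (num_blob_lists n) \<le>
      real (card {G \<in> caterpillars ?V. P G}) / real (num_caterpillars n)"
    by (intro frac_le) auto
  then show ?thesis by simp
qed

text \<open>One leaf at each end forces the sentence, two leaves at each end forbid it, and both
  families have a positive limiting proportion among all blob lists. A limit, if it exists,
  therefore lies strictly between 0 and 1.\<close>

theorem caterpillars_no_zero_one_law:
  "\<not> convergent (prob_models random_caterpillar pendant_path) \<or>
    lim (prob_models random_caterpillar pendant_path) \<notin> {0, 1}"
proof (rule disjCI)
  let ?p = "prob_models random_caterpillar pendant_path"
  let ?r = "\<lambda>k n. real (cons_count {k} (cons_count {k} num_blob_lists) n) / real (num_blob_lists n) / 2"
  assume "\<not> lim ?p \<notin> {0, 1}"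
  show "\<not> convergent ?p"
  proof
    assume "convergent ?p"
    then have lim: "?p \<longlonglongrightarrow> lim ?p" by (simp add: convergent_LIMSEQ_iff)
    have r: "?r k \<longlonglongrightarrow> (rho ^ Suc k / fact k) ^ 2 / 2" for k
      by (intro tendsto_divide ended_ratio_tendsto tendsto_const) simp
    have pos: "(rho ^ Suc k / fact k) ^ 2 / 2 > 0" for k using rho(1) by simp
    have "?r 1 n \<le> ?p n" if n: "n \<ge> 1" for n
      unfolding prob_models_caterpillar[OF n]
      by (rule ended_fraction_le[OF n]) (auto intro: models_pendant_path_1)
    then have "(rho ^ Suc 1 / fact 1) ^ 2 / 2 \<le> lim ?p"
      by (intro LIMSEQ_le[OF r lim]) blast
    then have "lim ?p > 0" using pos[of 1] by linarith
    moreover have "?r 2 n \<le> 1 - ?p n" if n: "n \<ge> 1" for n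
    proof -
      have "?r 2 n \<le> real (card {G \<in> caterpillars {1..n}. \<not> models G pendant_path}) / real (num_caterpillars n)"
        by (rule ended_fraction_le[OF n]) (auto dest: not_models_pendant_path_2)
      also have "\<dots> = 1 - ?p n"
      proof -
        have "num_caterpillars n = card {G \<in> caterpillars {1..n}. models G pendant_path} +
            card {G \<in> caterpillars {1..n}. \<not> models G pendant_path}"
          using count_caterpillars_Not[of n "\<lambda>G. models G pendant_path"] by (simp add: count_caterpillars_def)
        moreover have "num_caterpillars n \<noteq> 0"
          using caterpillars_on_nonempty[OF n] finite_caterpillars(1)[of "{1..n}"]
          by (simp add: num_caterpillars_def caterpillars_def caterpillars_on_def)
        moreover have "real b / real m = 1 - real a / real m" if "m = a + b" "m \<noteq> 0" for a b m :: nat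
        proof -
          have "1 - real a / real m = (real m - real a) / real m" using that(2) by (simp add: diff_divide_distrib)
          then show ?thesis using that(1) by simp
        qed
        ultimately show ?thesis unfolding prob_models_caterpillar[OF n] by blast
      qed
      finally show ?thesis .
    qed
    then have "(rho ^ Suc 2 / fact 2) ^ 2 / 2 \<le> 1 - lim ?p"
      by (intro LIMSEQ_le[OF r tendsto_diff[OF tendsto_const lim]]) blast
    then have "lim ?p < 1" using pos[of 2] by linarith
    ultimately show False using \<open>\<not> lim ?p \<notin> {0, 1}\<close> by auto
  qed
qed

theorem theorem1p11:
  shows "(\<exists>\<phi>. sentence \<phi> \<and>
            (\<not> convergent (prob_models random_caterpillar \<phi>) \<or>
             lim (prob_models random_caterpillar \<phi>) \<notin> {0, 1})) \<and>
         (\<forall>\<phi>. sentence \<phi> \<longrightarrow> convergent (prob_models random_caterpillar_forest \<phi>)) \<and>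
         closure {lim (prob_models random_caterpillar_forest \<phi>) | \<phi>. sentence \<phi>} = {0..1}"
proof (intro conjI allI impI)
  show "\<exists>\<phi>. sentence \<phi> \<and> (\<not> convergent (prob_models random_caterpillar \<phi>) \<or>
      lim (prob_models random_caterpillar \<phi>) \<notin> {0, 1})"
    using sentence_pendant_path caterpillars_no_zero_one_law by blast
  show "convergent (prob_models random_caterpillar_forest \<phi>)" if "sentence \<phi>" for \<phi>
    using convergent_forest_prob_models[OF that] by (simp add: prob_models_forest)
  show "closure {lim (prob_models random_caterpillar_forest \<phi>) | \<phi>. sentence \<phi>} = {0..1}"
    by (rule closure_limits)
qed

end
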